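(* Let $\rho\in[0,1]$. **I) The model with source.** Let $\{\eta(t),t\ge0\}$ be the symmetric exclusion process with source at $0$ of intensity $\lambda\ge0$ (generator $L_{\mathrm{SEP},0}$, semigroup $S_0(t)$), let $\nu_{\rho,0}(t)=\nu_\rho S_0(t)$ and $\mu_{\rho,0}=\lim_{t\to\infty}\nu_{\rho,0}(t)$. 1. If $(p(x,y):x,y\in V)$ is recurrent, then $\mu_{\rho,0}=\delta_{\underline 1}$. Moreover, for any configuration $\eta\in\Omega$, $\lim_{t\to\infty}\delta_\eta S_0(t)=\delta_{\underline 1}$. As a consequence, in that case $\delta_{\underline 1}$ is the unique invariant probability measure. 2. If $(p(x,y):x,y\in V)$ is transient, then $\lim_{t\to\infty}\nu_{\rho,0}(t)=\mu_{\rho,0}$ with the following properties. a) Limiting density: for $x\in V$, $$\lim_{t\to\infty}\mathbb{E}_{\nu_\rho}(1-\eta_x(t))=(1-\rho)\,\mathbb{E}^{\mathrm{RW}}_x e^{-\lambda\int_0^\infty\delta_{X_s,0}\,ds}.$$ b) Covariances: for $x\ne y$ in $V$, $$\mathrm{cov}_{\mu_{\rho,0}}(\eta_x,\eta_y)=(1-\rho)^2\Big(\mathbb{E}^{\mathrm{SEP}}_{x,y}e^{-\lambda\int_0^\infty(\delta_{x(s),0}+\delta_{y(s),0})\,ds}-\mathbb{E}^{\mathrm{IRW}}_{x,y}e^{-\lambda\int_0^\infty(\delta_{X_s,0}+\delta_{Y_s,0})\,ds}\Big).$$ **II) The model with source and sink.** Let $\{\eta(t),t\ge0\}$ be the symmetric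 exclusion process with source of intensity $\lambda\ge0$ and sink of intensity $\mu>0$ at $0$ (generator $L_{\mathrm{SEP},1}$, semigroup $S_1(t)$), let $\nu_{\rho,1}(t)=\nu_\rho S_1(t)$ and $\rho_R=\frac{\lambda}{\lambda+\mu}$. 1. If $(p(x,y):x,y\in V)$ is recurrent, then $\lim_{t\to\infty}\nu_{\rho,1}(t)=\nu_{\rho_R}$. The same holds for any initial configuration, i.e. $\lim_{t\to\infty}\delta_\eta S_1(t)=\nu_{\rho_R}$ for every $\eta\in\Omega$. 2. If $(p(x,y):x,y\in V)$ is transient, then $\lim_{t\to\infty}\nu_{\rho,1}(t)=\mu_{\rho,1}$ (the limit exists and is denoted $\mu_{\rho,1}$) with the following properties. a) Limiting density: for $x\in V$, $$\lim_{t\to\infty}\mathbb{E}_{\nu_\rho}(\eta_x(t))=\rho_R+(\rho-\rho_R)\,\mathbb{E}^{\mathrm{RW}}_x e^{-(\lambda+\mu)\int_0^\infty\delta_{X_s,0}\,ds}.$$ b) Covariances: for $x\neq y$ in $V$, $$\mathrm{cov}_{\mu_{\rho,1}}(\eta_x,\eta_y)=(\rho-\rho_R)^2\Big(\mathbb{E}^{\mathrm{SEP}}_{x,y}e^{-\lambda\int_0^\infty(\delta_{x(s),0}+\delta_{y(s),0})\,ds}-\mathbb{E}^{\mathrm{IRW}}_{x,y}e^{-\lambda\int_0^\infty(\delta_{X_s,0}+\delta_{Y_s,0})\,ds}\Big).$$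
   Context: $V$ is a countable set with a distinguished vertex $0\in V$ (the origin). $(p(x,y))_{x,y\in V}$ are irreducible symmetric random walk rates: $p(x,y)=p(y,x)\ge 0$, for all $x,y$ there is $n$ with $p^{(n)}(x,y)>0$ where $p^{(n)}(x,y)=\sum_{z_1,\dots,z_{n-1}}p(x,z_1)\cdots p(z_{n-1},y)$, and $\sup_x\sum_y p(x,y)<\infty$. $X_t$ is the continuous-time random walk on $V$ with generator $L_{\mathrm{RW}}f(x)=\sum_y p(x,y)(f(y)-f(x))$, and $\mathbb{E}^{\mathrm{RW}}_x$ its expectation from $X_0=x$; $(p(x,y))$ is called recurrent (transient) if this walk is. $\delta_{\cdot,\cdot}$ is the Kronecker symbol. $\Omega=\{0,1\}^V$. For $\eta_x=1,\eta_y=0$, $\eta^{x,y}$ is $\eta$ with the particle at $x$ moved to $y$ ($\eta^{x,y}=\eta$ otherwise); $\eta^0$ is $\eta$ with the occupation at $0$ flipped. On local functions $f$ (depending on finitely many coordinates), $$L_{\mathrm{SEP},0}f(\eta)=\sum_{x,y\in V}p(x,y)\eta_x(1-\eta_y)(f(\eta^{x,y})-f(\eta))+\lambda(1-\eta_0)(f(\eta^0)-f(\eta)),$$ $$L_{\mathrm{SEP},1}f(\eta)=L_{\mathrm{SEP},0}f(\eta)+\mu\,\eta_0(f(\eta^0)-f(\eta)).$$ In each part, $\mathbb{E}_\eta$ is expectation for the process under consideration started from $\eta$, and $\mathbb{E}_{\nu_\rho}=\int\mathbb{E}_\eta\,\nu_\rho(d\eta)$. $\nu_\rho$ is the Bernoulli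 product measure on $\Omega$ with $\nu_\rho(\eta_x=1)=\rho$ for all $x$. $\delta_\eta$ is the Dirac measure at the configuration $\eta$; $\underline 1$ is the fully occupied configuration. Limits of measures are weak limits on $\Omega$. $\mathbb{E}^{\mathrm{SEP}}_{x,y}$ is expectation for two labeled particles $(x(t),y(t))$, started at the distinct sites $x,y$, evolving by the symmetric exclusion process without source or sink (each particle jumps from its site $u$ to $v$ at rate $p(u,v)$, jumps to occupied sites being suppressed). $\mathbb{E}^{\mathrm{IRW}}_{x,y}$ is expectation for two independent random walks $X_t,Y_t$ with generator $L_{\mathrm{RW}}$ started from $x,y$.
   Formalization: Part I.1 is stated for λ>0, since for λ=0 there is no source and the empty configuration is frozen; in II.2b the exponents use λ+μ instead of the printed λ, which fails e.g. for λ=0, ρ=1, μ>0 in the transient case. *)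

theory Defs
  imports "HOL-Probability.Probability"
begin

section \<open>Markov processes with a given generator\<close>

text \<open>
  Semigroups act on the Banach space of bounded continuous real functions on the state space.
  For a countable state space with the discrete topology these are all the bounded functions;
  for the compact space of configurations these are all the continuous functions.
\<close>

definition markov_semigroup ::
  "(real \<Rightarrow> ('s::topological_space \<Rightarrow>\<^sub>C real) \<Rightarrow> ('s \<Rightarrow>\<^sub>C real)) \<Rightarrow> bool" where
  "markov_semigroup T \<longleftrightarrow>
     (\<forall>t\<ge>0. linear (T t)) \<and>
     (\<forall>f. T 0 f = f) \<and>
     (\<forall>s\<ge>0. \<forall>t\<ge>0. \<forall>f. T (s + t) f = T s (T t f)) \<and>
     (\<forall>f. \<forall>t\<ge>0. ((\<lambda>s. T s f) \<longlongrightarrow> T t f) (at_right t)) \<and>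
     (\<forall>t\<ge>0. T t (const_bcontfun 1) = const_bcontfun 1) \<and>
     (\<forall>t\<ge>0. \<forall>f. (\<forall>x. 0 \<le> apply_bcontfun f x) \<longrightarrow> (\<forall>x. 0 \<le> apply_bcontfun (T t f) x))"

text \<open>The infinitesimal generator, as a graph (it is an unbounded operator in general).\<close>

definition generator ::
  "(real \<Rightarrow> ('s::topological_space \<Rightarrow>\<^sub>C real) \<Rightarrow> ('s \<Rightarrow>\<^sub>C real))
     \<Rightarrow> (('s \<Rightarrow>\<^sub>C real) \<times> ('s \<Rightarrow>\<^sub>C real)) set" where
  "generator T = {(f, g). ((\<lambda>t. (1 / t) *\<^sub>R (T t f - f)) \<longlongrightarrow> g) (at_right 0)}"

definition operator_graph ::
  "('s::topological_space \<Rightarrow>\<^sub>C real) set \<Rightarrow> (('s \<Rightarrow> real) \<Rightarrow> 's \<Rightarrow> real)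
     \<Rightarrow> (('s \<Rightarrow>\<^sub>C real) \<times> ('s \<Rightarrow>\<^sub>C real)) set" where
  "operator_graph D L = {(f, g). f \<in> D \<and> apply_bcontfun g = L (apply_bcontfun f)}"

definition natural_filtration ::
  "'w measure \<Rightarrow> (real \<Rightarrow> 'w \<Rightarrow> 's::topological_space) \<Rightarrow> real \<Rightarrow> 'w measure" where
  "natural_filtration M X s =
     sigma (space M) {X r -` A \<inter> space M | r A. 0 \<le> r \<and> r \<le> s \<and> A \<in> sets borel}"

definition cadlag :: "(real \<Rightarrow> 's::topological_space) \<Rightarrow> bool" where
  "cadlag \<omega> \<longleftrightarrow> (\<forall>t\<ge>0. (\<omega> \<longlongrightarrow> \<omega> t) (at_right t)) \<and> (\<forall>t>0. \<exists>l. (\<omega> \<longlongrightarrow> l) (at_left t))"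

text \<open>\<open>P x\<close> is the law under which the process \<open>X\<close> starts from \<open>x\<close>; only times \<open>t \<ge> 0\<close> matter.\<close>

definition markov_process ::
  "(real \<Rightarrow> ('s::topological_space \<Rightarrow>\<^sub>C real) \<Rightarrow> ('s \<Rightarrow>\<^sub>C real))
     \<Rightarrow> ('s \<Rightarrow> 'w measure) \<Rightarrow> (real \<Rightarrow> 'w \<Rightarrow> 's) \<Rightarrow> bool" where
  "markov_process T P X \<longleftrightarrow>
     (\<forall>x. prob_space (P x) \<and>
          (\<forall>t\<ge>0. X t \<in> borel_measurable (P x)) \<and>
          (AE \<omega> in P x. X 0 \<omega> = x) \<and>
          (\<forall>\<omega>\<in>space (P x). cadlag (\<lambda>t. X t \<omega>)) \<and>
          (\<forall>s\<ge>0. \<forall>t\<ge>0. \<forall>f. AE \<omega> in P x.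
             real_cond_exp (P x) (natural_filtration (P x) X s)
               (\<lambda>\<omega>'. apply_bcontfun f (X (s + t) \<omega>')) \<omega> = apply_bcontfun (T t f) (X s \<omega>)))"

text \<open>
  \<open>X\<close> is the Markov process with semigroup \<open>T\<close>, whose generator is the closure of the
  operator \<open>L\<close> given on the core \<open>D\<close>.
\<close>

definition process_with_generator ::
  "('s::topological_space \<Rightarrow>\<^sub>C real) set \<Rightarrow> (('s \<Rightarrow> real) \<Rightarrow> 's \<Rightarrow> real)
     \<Rightarrow> (real \<Rightarrow> ('s \<Rightarrow>\<^sub>C real) \<Rightarrow> ('s \<Rightarrow>\<^sub>C real))
     \<Rightarrow> ('s \<Rightarrow> 'w measure) \<Rightarrow> (real \<Rightarrow> 'w \<Rightarrow> 's) \<Rightarrow> bool" where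
  "process_with_generator D L T P X \<longleftrightarrow>
     markov_semigroup T \<and> generator T = closure (operator_graph D L) \<and> markov_process T P X"


section \<open>Measures\<close>

definition borel_prob :: "'s::topological_space measure \<Rightarrow> bool" where
  "borel_prob m \<longleftrightarrow> sets m = sets borel \<and> prob_space m"

text \<open>The measure \<open>m T(t)\<close>, determined by \<open>\<integral> f d(m T(t)) = \<integral> T(t) f dm\<close>.\<close>

definition evolve ::
  "'s::topological_space measure \<Rightarrow> (real \<Rightarrow> ('s \<Rightarrow>\<^sub>C real) \<Rightarrow> ('s \<Rightarrow>\<^sub>C real)) \<Rightarrow> real \<Rightarrow> 's measure" where
  "evolve m T t = (THE m'. borel_prob m' \<and>
     (\<forall>f. (\<integral>x. apply_bcontfun f x \<partial>m') = (\<integral>x. apply_bcontfun (T t f) x \<partial>m)))"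

definition invariant_prob ::
  "(real \<Rightarrow> ('s::topological_space \<Rightarrow>\<^sub>C real) \<Rightarrow> ('s \<Rightarrow>\<^sub>C real)) \<Rightarrow> 's measure \<Rightarrow> bool" where
  "invariant_prob T m \<longleftrightarrow> borel_prob m \<and> (\<forall>t\<ge>0. evolve m T t = m)"

definition weak_limit :: "(real \<Rightarrow> 's::topological_space measure) \<Rightarrow> 's measure \<Rightarrow> bool" where
  "weak_limit m m' \<longleftrightarrow> borel_prob m' \<and>
     (\<forall>f :: 's \<Rightarrow>\<^sub>C real.
        ((\<lambda>t. \<integral>x. apply_bcontfun f x \<partial>m t) \<longlongrightarrow> (\<integral>x. apply_bcontfun f x \<partial>m')) at_top)"

definition covar :: "'s measure \<Rightarrow> ('s \<Rightarrow> real) \<Rightarrow> ('s \<Rightarrow> real) \<Rightarrow> real" where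
  "covar m f g = (\<integral>x. (f x - (\<integral>z. f z \<partial>m)) * (g x - (\<integral>z. g z \<partial>m)) \<partial>m)"


section \<open>Random walks\<close>

text \<open>For \<open>n \<ge> 1\<close> this is the sum of \<open>p x z1 * ... * p z(n-1) y\<close> over all \<open>z1, ..., z(n-1)\<close>.\<close>

primrec rate_power :: "('v \<Rightarrow> 'v \<Rightarrow> real) \<Rightarrow> nat \<Rightarrow> 'v \<Rightarrow> 'v \<Rightarrow> real" where
  "rate_power p 0 x y = of_bool (x = y)"
| "rate_power p (Suc n) x y = (\<Sum>\<^sub>\<infinity>z. p x z * rate_power p n z y)"

definition irreducible_symmetric_rates :: "('v \<Rightarrow> 'v \<Rightarrow> real) \<Rightarrow> bool" where
  "irreducible_symmetric_rates p \<longleftrightarrow>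
     (\<forall>x y. p x y \<ge> 0) \<and> (\<forall>x y. p x y = p y x) \<and>
     (\<forall>x y. \<exists>n\<ge>1. rate_power p n x y > 0) \<and>
     (\<exists>C. \<forall>x. p x summable_on UNIV \<and> (\<Sum>\<^sub>\<infinity>y. p x y) \<le> C)"

definition rw_gen :: "('v \<Rightarrow> 'v \<Rightarrow> real) \<Rightarrow> ('v \<Rightarrow> real) \<Rightarrow> 'v \<Rightarrow> real" where
  "rw_gen p f x = (\<Sum>\<^sub>\<infinity>y. p x y * (f y - f x))"

text \<open>
  Two labelled exclusion particles. Pairs with equal entries are not reachable from the other
  pairs, and the process is only used when started at distinct sites.
\<close>

definition sep2_gen :: "('v \<Rightarrow> 'v \<Rightarrow> real) \<Rightarrow> ('v \<times> 'v \<Rightarrow> real) \<Rightarrow> 'v \<times> 'v \<Rightarrow> real" where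
  "sep2_gen p f = (\<lambda>(x, y).
     (\<Sum>\<^sub>\<infinity>v. p x v * of_bool (v \<noteq> y) * (f (v, y) - f (x, y))) +
     (\<Sum>\<^sub>\<infinity>v. p y v * of_bool (v \<noteq> x) * (f (x, v) - f (x, y))))"

definition recurrent :: "('s \<Rightarrow> 'w measure) \<Rightarrow> (real \<Rightarrow> 'w \<Rightarrow> 's) \<Rightarrow> bool" where
  "recurrent P X \<longleftrightarrow> (\<forall>x. AE \<omega> in P x. \<not> bdd_above {t. 0 \<le> t \<and> X t \<omega> = x})"

definition transient :: "('s \<Rightarrow> 'w measure) \<Rightarrow> (real \<Rightarrow> 'w \<Rightarrow> 's) \<Rightarrow> bool" where
  "transient P X \<longleftrightarrow> (\<forall>x. AE \<omega> in P x. bdd_above {t. 0 \<le> t \<and> X t \<omega> = x})"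

text \<open>
  \<open>exp (- a)\<close> for \<open>a \<in> [0, \<infinity>]\<close>. The occupation times below are taken in \<open>[0, \<infinity>]\<close>, so that an
  infinite one is not silently replaced by \<open>0\<close>.
\<close>

definition exp_neg :: "ennreal \<Rightarrow> real" where
  "exp_neg a = (if a = \<infinity> then 0 else exp (- enn2real a))"

definition rw_functional ::
  "('v \<Rightarrow> 'w measure) \<Rightarrow> (real \<Rightarrow> 'w \<Rightarrow> 'v) \<Rightarrow> 'v \<Rightarrow> real \<Rightarrow> 'v \<Rightarrow> real" where
  "rw_functional P X orig \<kappa> x =
     (\<integral>\<omega>. exp_neg (ennreal \<kappa> * (\<integral>\<^sup>+ s\<in>{0..}. of_bool (X s \<omega> = orig) \<partial>lborel)) \<partial>P x)"

text \<open>Two independent walks live on the product of the sample spaces.\<close>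

definition irw_functional ::
  "('v \<Rightarrow> 'w measure) \<Rightarrow> (real \<Rightarrow> 'w \<Rightarrow> 'v) \<Rightarrow> 'v \<Rightarrow> real \<Rightarrow> 'v \<Rightarrow> 'v \<Rightarrow> real" where
  "irw_functional P X orig \<kappa> x y =
     (\<integral>(\<omega>, \<omega>'). exp_neg (ennreal \<kappa> *
        (\<integral>\<^sup>+ s\<in>{0..}. (of_bool (X s \<omega> = orig) + of_bool (X s \<omega>' = orig)) \<partial>lborel))
      \<partial>(P x \<Otimes>\<^sub>M P y))"

definition sep2_functional ::
  "('v \<times> 'v \<Rightarrow> 'w measure) \<Rightarrow> (real \<Rightarrow> 'w \<Rightarrow> 'v \<times> 'v) \<Rightarrow> 'v \<Rightarrow> real \<Rightarrow> 'v \<Rightarrow> 'v \<Rightarrow> real" where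
  "sep2_functional P Z orig \<kappa> x y =
     (\<integral>\<omega>. exp_neg (ennreal \<kappa> *
        (\<integral>\<^sup>+ s\<in>{0..}. (of_bool (fst (Z s \<omega>) = orig) + of_bool (snd (Z s \<omega>) = orig)) \<partial>lborel))
      \<partial>P (x, y))"


section \<open>Symmetric exclusion with source and sink\<close>

type_synonym 'v config = "'v \<Rightarrow> bool"

definition occ :: "'v \<Rightarrow> 'v config \<Rightarrow> real" where
  "occ x \<eta> = of_bool (\<eta> x)"

definition move :: "'v \<Rightarrow> 'v \<Rightarrow> 'v config \<Rightarrow> 'v config" where
  "move x y \<eta> = (if \<eta> x \<and> \<not> \<eta> y then \<eta>(x := False, y := True) else \<eta>)"

definition flip :: "'v \<Rightarrow> 'v config \<Rightarrow> 'v config" where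
  "flip x \<eta> = \<eta>(x := \<not> \<eta> x)"

definition local_functions :: "('v config \<Rightarrow>\<^sub>C real) set" where
  "local_functions = {f. \<exists>A. finite A \<and>
     (\<forall>\<eta> \<xi>. (\<forall>x\<in>A. \<eta> x = \<xi> x) \<longrightarrow> apply_bcontfun f \<eta> = apply_bcontfun f \<xi>)}"

definition source_gen ::
  "('v \<Rightarrow> 'v \<Rightarrow> real) \<Rightarrow> 'v \<Rightarrow> real \<Rightarrow> ('v config \<Rightarrow> real) \<Rightarrow> 'v config \<Rightarrow> real" where
  "source_gen p orig lam f \<eta> =
     (\<Sum>\<^sub>\<infinity>(x, y). p x y * occ x \<eta> * (1 - occ y \<eta>) * (f (move x y \<eta>) - f \<eta>))
     + lam * (1 - occ orig \<eta>) * (f (flip orig \<eta>) - f \<eta>)"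

definition source_sink_gen ::
  "('v \<Rightarrow> 'v \<Rightarrow> real) \<Rightarrow> 'v \<Rightarrow> real \<Rightarrow> real \<Rightarrow> ('v config \<Rightarrow> real) \<Rightarrow> 'v config \<Rightarrow> real" where
  "source_sink_gen p orig lam mu f \<eta> =
     source_gen p orig lam f \<eta> + mu * occ orig \<eta> * (f (flip orig \<eta>) - f \<eta>)"

definition bernoulli_measure :: "real \<Rightarrow> 'v config measure" where
  "bernoulli_measure \<rho> = (\<Pi>\<^sub>M x\<in>UNIV. measure_pmf (bernoulli_pmf \<rho>))"

end

theory Submission
  imports Defs
begin

text \<open>Let \<open>r\<close> be the reservoir density: \<open>r = 1\<close> for a source alone and \<open>r = lam / (lam + mu)\<close> if there is a sink, so that
\<open>lam = (lam + mu) r\<close> in both cases. For a finite set \<open>A\<close> of sites put \<open>D\<^sub>A(\<eta>) = \<Prod>\<^sub>x\<^sub>\<in>\<^sub>A (\<eta>\<^sub>x - r)\<close>. The idea is that the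
generator maps \<open>D\<^sub>A\<close> to a combination of functions of the same kind: since \<open>p\<close> is symmetric, the exclusion
part may be rewritten as an exchange of the contents of two sites, and exchanging them in \<open>\<eta>\<close> or in \<open>A\<close> is the
same; the flips at the origin act on \<open>\<eta>\<^sub>0 - r\<close> as multiplication by \<open>- (lam + mu)\<close>. Hence, for every initial
law \<open>m\<close>, the numbers \<open>v\<^sub>t(A) = \<integral> T\<^sub>t D\<^sub>A dm\<close> solve the backward equation of exclusion particles with positions \<open>A\<close>,
killed at rate \<open>\<kappa> = lam + mu\<close> while one of them is at the origin (\<open>source_sink_gen_centred_prod\<close>,
\<open>dual_equation\<close>).

One and two particles. For \<open>card A = 1\<close> this is the killed equation of the random walk, for \<open>card A = 2\<close> that of
the two labelled exclusion particles. From a product measure the initial value is the constant \<open>(\<rho> - r)\<^sup>k\<close> for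
\<open>k\<close> particles, so the Feynman--Kac formula (\<open>feynman_kac_limit\<close>) identifies the limits of \<open>v\<^sub>t(A)\<close> with the
exponential functionals of the occupation time of the origin. It is proved by splitting: \<open>n\<close> steps of the
semigroup alternating with multiplication by \<open>exp (- (t/n) V)\<close> have, by the Markov property, the
probabilistic meaning of a right Riemann sum in the exponent, and differ from the solution by \<open>O(1/n)\<close>.

Convergence. From a constant initial value the solution moves monotonically, by a maximum principle for
systems with bounded rates (\<open>ode_positivity_loss\<close>); so \<open>v\<^sub>t(A)\<close> converges for every finite \<open>A\<close>
(\<open>constant_start_converges\<close>). The functions \<open>D\<^sub>A\<close> span a dense space of continuous functions and the configuration
space is compact, so the limits come from a measure (\<open>riesz_configs\<close>, \<open>weak_limit_evolve_exists\<close>). The formulas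
for the densities and the covariances are the cases \<open>card A = 1, 2\<close>.

Recurrence. Let \<open>\<phi>\<^sub>t(x)\<close> be the expected occupation of \<open>x\<close> from the full configuration minus that from the empty
one. It solves the killed walk equation with initial value \<open>1\<close>, and it tends to \<open>0\<close> if the walk is recurrent
(\<open>recurrent_imp_killed\<close>). The maximum principle also gives \<open>\<bar>v\<^sub>t(A)\<bar> \<le> \<Sum>\<^sub>x\<^sub>\<in>\<^sub>A \<phi>\<^sub>t(x)\<close> for nonempty \<open>A\<close> and every initial law,
because on sums over the occupied sites the exclusion rule is invisible. So all \<open>v\<^sub>t(A)\<close> with \<open>A\<close> nonempty
vanish in the limit (\<open>recurrent_dual_vanishes\<close>), which characterises the product measure of density \<open>r\<close>.\<close>

section \<open>Markov semigroups\<close>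

lemma bcontfun_abs_le_norm: "\<bar>apply_bcontfun f x\<bar> \<le> norm f" for f :: "'s::topological_space \<Rightarrow>\<^sub>C real"
  using norm_bounded[of f x] by simp

lemma bounded_linear_apply_bcontfun:
  "bounded_linear (\<lambda>f :: 's::topological_space \<Rightarrow>\<^sub>C real. apply_bcontfun f x)"
  by (rule bounded_linear_intro[where K = 1]) (auto simp: bcontfun_abs_le_norm)

lemma bounded_linear_integral_bcontfun:
  fixes m :: "'s::topological_space measure"
  assumes "borel_prob m"
  shows "bounded_linear (\<lambda>f :: 's \<Rightarrow>\<^sub>C real. \<integral>x. apply_bcontfun f x \<partial>m)"
    and "integrable m (apply_bcontfun (f :: 's \<Rightarrow>\<^sub>C real))"
proof -
  interpret prob_space m using assms by (auto simp: borel_prob_def)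
  have meas: "apply_bcontfun f \<in> borel_measurable m" for f :: "'s \<Rightarrow>\<^sub>C real"
  proof -
    have "apply_bcontfun f \<in> borel_measurable borel"
      by (rule borel_measurable_continuous_onI) simp
    then show ?thesis
      using assms measurable_cong_sets[of m borel borel borel] by (auto simp: borel_prob_def)
  qed
  have int: "integrable m (apply_bcontfun f)" for f :: "'s \<Rightarrow>\<^sub>C real"
    by (rule integrable_const_bound[where B = "norm f"]) (auto simp: meas bcontfun_abs_le_norm)
  then show "integrable m (apply_bcontfun f)" .
  show "bounded_linear (\<lambda>f :: 's \<Rightarrow>\<^sub>C real. \<integral>x. apply_bcontfun f x \<partial>m)"
  proof (rule bounded_linear_intro[where K = 1])
    fix f :: "'s \<Rightarrow>\<^sub>C real"
    have "\<bar>\<integral>x. apply_bcontfun f x \<partial>m\<bar> \<le> (\<integral>x. norm f \<partial>m)"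
      by (rule order_trans[OF integral_abs_bound])
        (intro integral_mono integrable_abs int, auto simp: bcontfun_abs_le_norm)
    then show "norm (\<integral>x. apply_bcontfun f x \<partial>m) \<le> norm f * 1"
      by (simp add: prob_space)
  qed (auto simp: int)
qed

context
  fixes T :: "real \<Rightarrow> ('s::topological_space \<Rightarrow>\<^sub>C real) \<Rightarrow> ('s \<Rightarrow>\<^sub>C real)"
  assumes T: "markov_semigroup T"
begin

lemma semigroup_linear: "0 \<le> t \<Longrightarrow> linear (T t)"
  and semigroup_0: "T 0 f = f"
  and semigroup_add: "0 \<le> s \<Longrightarrow> 0 \<le> t \<Longrightarrow> T (s + t) f = T s (T t f)"
  and semigroup_right_continuous: "0 \<le> t \<Longrightarrow> ((\<lambda>s. T s f) \<longlongrightarrow> T t f) (at_right t)"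
  and semigroup_one: "0 \<le> t \<Longrightarrow> T t (const_bcontfun 1) = const_bcontfun 1"
  and semigroup_pos: "0 \<le> t \<Longrightarrow> (\<And>x. 0 \<le> apply_bcontfun f x) \<Longrightarrow> 0 \<le> apply_bcontfun (T t f) x"
  using T unfolding markov_semigroup_def by auto

lemma semigroup_mono:
  assumes "0 \<le> t" and "\<And>x. apply_bcontfun f x \<le> apply_bcontfun g x"
  shows "apply_bcontfun (T t f) x \<le> apply_bcontfun (T t g) x"
  using semigroup_pos[OF assms(1), of "g - f" x] assms(2) linear_diff[OF semigroup_linear[OF assms(1)], of g f]
  by simp

lemma semigroup_const: "0 \<le> t \<Longrightarrow> T t (const_bcontfun c) = const_bcontfun c"
proof -
  assume t: "0 \<le> t"
  have *: "const_bcontfun c = c *\<^sub>R (const_bcontfun 1 :: 's \<Rightarrow>\<^sub>C real)"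
    by (rule bcontfun_eqI) simp
  show ?thesis
    unfolding * using linear_scale[OF semigroup_linear[OF t]] semigroup_one[OF t] by simp
qed

lemma semigroup_abs_le:
  assumes "0 \<le> t" and "\<And>x. \<bar>apply_bcontfun f x\<bar> \<le> b"
  shows "\<bar>apply_bcontfun (T t f) x\<bar> \<le> b"
proof -
  have "apply_bcontfun (T t f) x \<le> apply_bcontfun (T t (const_bcontfun b)) x"
    by (rule semigroup_mono[OF assms(1)]) (use assms(2) in \<open>auto simp: abs_le_iff\<close>)
  moreover have "apply_bcontfun (T t (const_bcontfun (-b))) x \<le> apply_bcontfun (T t f) x"
    by (rule semigroup_mono[OF assms(1)]) (use assms(2) in \<open>simp add: abs_le_iff minus_le_iff\<close>)
  ultimately show ?thesis
    by (simp add: semigroup_const[OF assms(1)])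
qed

lemma semigroup_norm_le: "0 \<le> t \<Longrightarrow> norm (T t f) \<le> norm f"
  by (rule norm_bound) (auto intro!: semigroup_abs_le simp: bcontfun_abs_le_norm)

lemma semigroup_bounded_linear: "0 \<le> t \<Longrightarrow> bounded_linear (T t)"
  by (rule bounded_linear.intro[OF semigroup_linear])
     (auto simp: bounded_linear_axioms_def intro!: exI[of _ 1] semigroup_norm_le)

text \<open>For times on either side of \<open>t\<close> the difference quotient is the contraction \<open>T (min s t)\<close> applied
  to the difference quotient at \<open>0\<close>; right continuity at \<open>0\<close> therefore gives a two-sided derivative.\<close>

lemma semigroup_has_derivative:
  fixes l :: "('s \<Rightarrow>\<^sub>C real) \<Rightarrow> real"
  assumes fg: "(f, g) \<in> generator T" and l: "bounded_linear l" and t: "0 \<le> t"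
  shows "((\<lambda>t. l (T t f)) has_real_derivative l (T t g)) (at t within {0..})"
proof -
  obtain K where K: "\<And>f. norm (l f) \<le> norm f * K" and Kpos: "0 < K"
    using bounded_linear.pos_bounded[OF l] by auto
  define e where "e h = norm ((1 / h) *\<^sub>R (T h f - f) - g) + norm (T h g - g)" for h
  have e0: "(e \<longlongrightarrow> 0) (at_right 0)"
  proof -
    have 1: "((\<lambda>h. (1 / h) *\<^sub>R (T h f - f) - g) \<longlongrightarrow> g - g) (at_right 0)"
      using fg by (intro tendsto_diff) (auto simp: generator_def)
    have 2: "((\<lambda>h. T h g - g) \<longlongrightarrow> g - g) (at_right 0)"
      using semigroup_right_continuous[of 0 g] by (intro tendsto_diff) (auto simp: semigroup_0)
    show ?thesis
      using tendsto_add[OF tendsto_norm[OF 1] tendsto_norm[OF 2]] unfolding e_def by simp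
  qed
  have key: "norm ((1 / (s - t)) *\<^sub>R (T s f - T t f) - T t g) \<le> e \<bar>s - t\<bar>"
    if s: "s \<ge> 0" "s \<noteq> t" for s
  proof (cases "t < s")
    case True
    define h where "h = s - t"
    have h: "h > 0" "s = t + h" using True by (auto simp: h_def)
    have "(1 / h) *\<^sub>R (T s f - T t f) - T t g = T t ((1 / h) *\<^sub>R (T h f - f) - g)"
      using t h by (simp add: linear_diff[OF semigroup_linear] linear_scale[OF semigroup_linear] semigroup_add)
    then have "norm ((1 / h) *\<^sub>R (T s f - T t f) - T t g) \<le> norm ((1 / h) *\<^sub>R (T h f - f) - g)"
      using semigroup_norm_le[OF t] by simp
    then show ?thesis using h by (auto simp: e_def intro: add_increasing2)
  next
    case False
    define h where "h = t - s"
    have h: "h > 0" "t = s + h" using False s by (auto simp: h_def)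
    have "(1 / (s - t)) *\<^sub>R (T s f - T t f) - T t g = (1 / h) *\<^sub>R (T t f - T s f) - T t g"
      using h by (simp add: scaleR_diff_right)
    also have "\<dots> = T s ((1 / h) *\<^sub>R (T h f - f) - g) - T s (T h g - g)"
      using s h by (simp add: linear_diff[OF semigroup_linear] linear_scale[OF semigroup_linear] semigroup_add)
    finally have "norm ((1 / (s - t)) *\<^sub>R (T s f - T t f) - T t g)
        \<le> norm (T s ((1 / h) *\<^sub>R (T h f - f) - g)) + norm (T s (T h g - g))"
      using norm_triangle_ineq4 by metis
    also have "\<dots> \<le> e h"
      unfolding e_def using s by (intro add_mono semigroup_norm_le) auto
    finally show ?thesis using h by simp
  qed
  have "((\<lambda>s. e \<bar>s - t\<bar>) \<longlongrightarrow> 0) (at t within {0..})"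
  proof (rule filterlim_compose[OF e0])
    have "((\<lambda>s. \<bar>s - t\<bar>) \<longlongrightarrow> \<bar>t - t\<bar>) (at t within {0..})"
      by (intro tendsto_intros)
    then show "filterlim (\<lambda>s. \<bar>s - t\<bar>) (at_right 0) (at t within {0..})"
      unfolding at_within_def
      by (intro filterlim_inf[THEN iffD2] conjI) (auto simp: filterlim_principal at_within_def eventually_inf_principal)
  qed
  then have lim: "((\<lambda>s. e \<bar>s - t\<bar> * K) \<longlongrightarrow> 0) (at t within {0..})"
    by (rule tendsto_mult_left_zero)
  have "((\<lambda>s. (l (T s f) - l (T t f)) / (s - t) - l (T t g)) \<longlongrightarrow> 0) (at t within {0..})"
  proof (rule Lim_null_comparison[OF _ lim])
    show "\<forall>\<^sub>F s in at t within {0..}. norm ((l (T s f) - l (T t f)) / (s - t) - l (T t g)) \<le> e \<bar>s - t\<bar> * K"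
      unfolding eventually_at_filter
    proof (intro always_eventually allI impI)
      fix s assume s: "s \<noteq> t" "s \<in> {0..}"
      have "(l (T s f) - l (T t f)) / (s - t) - l (T t g) = l ((1 / (s - t)) *\<^sub>R (T s f - T t f) - T t g)"
        using bounded_linear.linear[OF l] by (simp add: linear_diff linear_scale diff_divide_distrib)
      then have "norm ((l (T s f) - l (T t f)) / (s - t) - l (T t g))
          \<le> norm ((1 / (s - t)) *\<^sub>R (T s f - T t f) - T t g) * K"
        using K by metis
      also have "\<dots> \<le> e \<bar>s - t\<bar> * K"
        using key[of s] s Kpos by (intro mult_right_mono) auto
      finally show "norm ((l (T s f) - l (T t f)) / (s - t) - l (T t g)) \<le> e \<bar>s - t\<bar> * K" .
    qed
  qed
  then show ?thesis
    unfolding has_field_derivative_iff by (rule LIM_zero_cancel)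
qed

lemma semigroup_has_derivative_at:
  assumes "(f, g) \<in> generator T" "0 \<le> t"
  shows "((\<lambda>t. apply_bcontfun (T t f) x) has_real_derivative apply_bcontfun (T t g) x) (at t within {0..})"
  using semigroup_has_derivative[OF assms(1) bounded_linear_apply_bcontfun assms(2)] .

end

section \<open>A maximum principle\<close>

lemma has_derivative_nonneg_imp_le:
  fixes f :: "real \<Rightarrow> real"
  assumes "a \<le> b"
    and der: "\<And>t. a \<le> t \<Longrightarrow> t \<le> b \<Longrightarrow> (f has_real_derivative f' t) (at t within {a..b})"
    and "\<And>t. a \<le> t \<Longrightarrow> t \<le> b \<Longrightarrow> 0 \<le> f' t"
  shows "f a \<le> f b"
proof (rule DERIV_nonneg_imp_increasing_open[OF assms(1)])
  show "continuous_on {a..b} f"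
    unfolding continuous_on_eq_continuous_within
    using der by (auto intro!: DERIV_continuous)
  fix x assume x: "a < x" "x < b"
  then have "(f has_real_derivative f' x) (at x)"
    using der[of x] at_within_Icc_at[of a x b] by simp
  then show "\<exists>y. (f has_real_derivative y) (at x) \<and> 0 \<le> y"
    using assms(3) x by force
qed

text \<open>Iterating \<open>z' \<ge> - \<kappa> sup z\<^sup>-\<close> from a crude bound improves that bound to \<open>M (\<kappa> t)\<^sup>n / n!\<close> for
  every \<open>n\<close>, hence to \<open>0\<close>.\<close>

lemma ode_positivity:
  fixes z G :: "real \<Rightarrow> 's \<Rightarrow> real"
  assumes der: "\<And>t s. 0 \<le> t \<Longrightarrow> s \<in> S \<Longrightarrow> ((\<lambda>t. z t s) has_real_derivative G t s) (at t within {0..})"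
    and quasi: "\<And>t s b. 0 \<le> t \<Longrightarrow> s \<in> S \<Longrightarrow> 0 \<le> b \<Longrightarrow> (\<And>s'. s' \<in> S \<Longrightarrow> - b \<le> z t s') \<Longrightarrow> - (\<kappa> * b) \<le> G t s"
    and \<kappa>: "0 \<le> \<kappa>"
    and init: "\<And>s. s \<in> S \<Longrightarrow> 0 \<le> z 0 s"
    and bound: "\<And>t s. 0 \<le> t \<Longrightarrow> t \<le> t0 \<Longrightarrow> s \<in> S \<Longrightarrow> - M \<le> z t s"
    and "0 \<le> t" "t \<le> t0" "s \<in> S"
  shows "0 \<le> z t s"
proof -
  have M: "0 \<le> max M 0" by simp
  have step: "- (max M 0 * (\<kappa> * t) ^ n / fact n) \<le> z t s" if "0 \<le> t" "t \<le> t0" "s \<in> S" for n t s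
    using that
  proof (induction n arbitrary: t s)
    case 0
    then show ?case using bound[OF 0] by simp
  next
    case (Suc n)
    define w where "w u = z u s + max M 0 * (\<kappa> * u) ^ Suc n / fact (Suc n)" for u
    have "w 0 \<le> w t"
    proof (rule has_derivative_nonneg_imp_le[OF Suc.prems(1)])
      fix u assume u: "0 \<le> u" "u \<le> t"
      have "(\<lambda>u. max M 0 * (\<kappa> * u) ^ Suc n / fact (Suc n)) = (\<lambda>u. max M 0 * \<kappa> ^ Suc n / fact (Suc n) * u ^ Suc n)"
        by (auto simp: power_mult_distrib)
      moreover have "((\<lambda>u. max M 0 * \<kappa> ^ Suc n / fact (Suc n) * u ^ Suc n) has_real_derivative
          max M 0 * \<kappa> ^ Suc n / fact (Suc n) * (real (Suc n) * u ^ n)) (at u within {0..t})"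
        using DERIV_power[OF DERIV_ident, of "Suc n" u "{0..t}"] by (intro DERIV_cmult) (simp add: mult.commute del: of_nat_Suc)
      moreover have "max M 0 * \<kappa> ^ Suc n / fact (Suc n) * (real (Suc n) * u ^ n) = \<kappa> * (max M 0 * (\<kappa> * u) ^ n / fact n)"
        by (simp add: power_mult_distrib field_simps del: of_nat_Suc)
      ultimately have "((\<lambda>u. max M 0 * (\<kappa> * u) ^ Suc n / fact (Suc n)) has_real_derivative
          \<kappa> * (max M 0 * (\<kappa> * u) ^ n / fact n)) (at u within {0..t})" by (simp only:)
      moreover have "((\<lambda>u. z u s) has_real_derivative G u s) (at u within {0..t})"
        by (rule DERIV_subset[OF der[OF u(1) Suc.prems(3)]]) auto
      ultimately show "(w has_real_derivative G u s + \<kappa> * (max M 0 * (\<kappa> * u) ^ n / fact n)) (at u within {0..t})"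
        unfolding w_def by (intro DERIV_add)
      show "0 \<le> G u s + \<kappa> * (max M 0 * (\<kappa> * u) ^ n / fact n)"
        using quasi[OF u(1) Suc.prems(3), of "max M 0 * (\<kappa> * u) ^ n / fact n"] Suc.IH[OF u(1)] Suc.prems(2) u \<kappa> by auto
    qed
    then show ?case using init[OF Suc.prems(3)] by (simp add: w_def)
  qed
  have "(\<lambda>n. - (max M 0 * ((\<kappa> * t) ^ n / fact n))) \<longlonglongrightarrow> - (max M 0 * 0)"
    by (intro tendsto_intros) (use summable_LIMSEQ_zero[OF summable_exp_generic[of "\<kappa> * t"]] in \<open>simp add: field_simps\<close>)
  then have "- (max M 0 * 0) \<le> z t s"
    by (rule LIMSEQ_le_const2) (use step[OF assms(6,7,8)] in \<open>intro exI[of _ 0] allI impI, simp only: times_divide_eq_right\<close>)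
  then show ?thesis by simp
qed

text \<open>An integrating factor \<open>exp (D t)\<close> absorbs the loss terms, which are not controlled by a lower bound
  on \<open>z\<close>.\<close>

lemma ode_positivity_loss:
  fixes z G :: "real \<Rightarrow> 's \<Rightarrow> real"
  assumes der: "\<And>t s. 0 \<le> t \<Longrightarrow> s \<in> S \<Longrightarrow> ((\<lambda>t. z t s) has_real_derivative G t s) (at t within {0..})"
    and quasi: "\<And>t s b. 0 \<le> t \<Longrightarrow> s \<in> S \<Longrightarrow> 0 \<le> b \<Longrightarrow> (\<And>s'. s' \<in> S \<Longrightarrow> - b \<le> z t s') \<Longrightarrow> - (\<kappa> * b) \<le> G t s + D * z t s"
    and \<kappa>: "0 \<le> \<kappa>" and D: "0 \<le> D"
    and init: "\<And>s. s \<in> S \<Longrightarrow> 0 \<le> z 0 s"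
    and bound: "\<And>t s. 0 \<le> t \<Longrightarrow> s \<in> S \<Longrightarrow> - M \<le> z t s"
    and t: "0 \<le> t" and s: "s \<in> S"
  shows "0 \<le> z t s"
proof -
  have "0 \<le> exp (D * t) * z t s"
  proof (rule ode_positivity[where z = "\<lambda>t s. exp (D * t) * z t s" and S = S and \<kappa> = \<kappa> and t0 = t
      and G = "\<lambda>t s. exp (D * t) * (G t s + D * z t s)" and M = "exp (D * t) * max M 0"])
    fix u :: real and s assume u: "0 \<le> u" and s: "s \<in> S"
    have "((\<lambda>u. exp (D * u)) has_real_derivative exp (D * u) * D) (at u within {0..})"
      by (auto intro!: derivative_eq_intros)
    from DERIV_mult[OF this der[OF u s]]
    show "((\<lambda>u. exp (D * u) * z u s) has_real_derivative exp (D * u) * (G u s + D * z u s)) (at u within {0..})"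
      by (simp add: algebra_simps)
    fix b :: real assume b: "0 \<le> b" and low: "\<And>s'. s' \<in> S \<Longrightarrow> - b \<le> exp (D * u) * z u s'"
    have "- (\<kappa> * (b * exp (- (D * u)))) \<le> G u s + D * z u s"
    proof (rule quasi[OF u s])
      show "0 \<le> b * exp (- (D * u))" using b by simp
      show "- (b * exp (- (D * u))) \<le> z u s'" if "s' \<in> S" for s'
        using mult_left_mono[OF low[OF that], of "exp (- (D * u))"] by (simp add: exp_minus field_simps)
    qed
    from mult_left_mono[OF this, of "exp (D * u)"]
    show "- (\<kappa> * b) \<le> exp (D * u) * (G u s + D * z u s)" by (simp add: exp_minus field_simps)
  next
    fix u :: real and s assume u: "0 \<le> u" "u \<le> t" and s: "s \<in> S"
    have "- (exp (D * t) * max M 0) \<le> - (exp (D * u) * max M 0)"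
      using u D by (simp add: mult_left_mono mult_right_mono)
    also have "\<dots> \<le> exp (D * u) * z u s"
      using mult_left_mono[of "- max M 0" "z u s" "exp (D * u)"] bound[OF u(1) s] by simp
    finally show "- (exp (D * t) * max M 0) \<le> exp (D * u) * z u s" .
  qed (use \<kappa> init t s in auto)
  then show ?thesis by (simp add: zero_le_mult_iff)
qed

section \<open>Finite-dimensional distributions\<close>

definition bmult ::
  "('s::topological_space \<Rightarrow>\<^sub>C real) \<Rightarrow> ('s \<Rightarrow>\<^sub>C real) \<Rightarrow> ('s \<Rightarrow>\<^sub>C real)" where
  "bmult f g = Bcontfun (\<lambda>x. apply_bcontfun f x * apply_bcontfun g x)"

lemma apply_bmult [simp]: "apply_bcontfun (bmult f g) x = apply_bcontfun f x * apply_bcontfun g x"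
proof -
  have "(\<lambda>x. apply_bcontfun f x * apply_bcontfun g x) \<in> bcontfun"
    by (rule bcontfun_normI[where b = "norm f * norm g"])
       (auto intro!: continuous_intros mult_mono simp: abs_mult bcontfun_abs_le_norm)
  then show ?thesis by (simp add: bmult_def Bcontfun_inverse)
qed

definition weighted_step ::
  "(('s::topological_space \<Rightarrow>\<^sub>C real) \<Rightarrow> ('s \<Rightarrow>\<^sub>C real)) \<Rightarrow> ('s \<Rightarrow>\<^sub>C real) \<Rightarrow> ('s \<Rightarrow>\<^sub>C real) \<Rightarrow> ('s \<Rightarrow>\<^sub>C real)" where
  "weighted_step U f g = U (bmult f g)"

text \<open>On a discrete space every bounded function is an element of the Banach space on which the semigroup acts.\<close>

lemma apply_bcontfun_Bcontfun_discrete: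
  fixes f :: "'s::topological_space \<Rightarrow> real"
  assumes "\<And>A :: 's set. open A" and "\<And>x. \<bar>f x\<bar> \<le> b"
  shows "apply_bcontfun (Bcontfun f) = f"
proof -
  have "f \<in> bcontfun"
    by (rule bcontfun_normI[where b = b]) (use assms in \<open>auto simp: continuous_on_open_vimage\<close>)
  then show ?thesis by (simp add: Bcontfun_inverse)
qed

context
  fixes T :: "real \<Rightarrow> ('s::topological_space \<Rightarrow>\<^sub>C real) \<Rightarrow> ('s \<Rightarrow>\<^sub>C real)"
    and P :: "'s \<Rightarrow> 'w measure" and X :: "real \<Rightarrow> 'w \<Rightarrow> 's"
  assumes T: "markov_semigroup T" and P: "markov_process T P X"
begin

lemma process_prob_space: "prob_space (P x)"
  and process_measurable: "0 \<le> t \<Longrightarrow> X t \<in> borel_measurable (P x)"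
  and process_start: "AE \<omega> in P x. X 0 \<omega> = x"
  and process_right_continuous: "\<omega> \<in> space (P x) \<Longrightarrow> 0 \<le> t \<Longrightarrow> ((\<lambda>t. X t \<omega>) \<longlongrightarrow> X t \<omega>) (at_right t)"
  and process_markov: "0 \<le> s \<Longrightarrow> 0 \<le> t \<Longrightarrow> AE \<omega> in P x.
             real_cond_exp (P x) (natural_filtration (P x) X s)
               (\<lambda>\<omega>'. apply_bcontfun f (X (s + t) \<omega>')) \<omega> = apply_bcontfun (T t f) (X s \<omega>)"
  using P unfolding markov_process_def cadlag_def by blast+

lemma process_fun_measurable [measurable]:
  "0 \<le> t \<Longrightarrow> (\<lambda>\<omega>. apply_bcontfun f (X t \<omega>)) \<in> borel_measurable (P x)"
  by (rule measurable_compose[OF process_measurable]) (auto intro: borel_measurable_continuous_onI)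

lemma subalgebra_natural_filtration: "subalgebra (P x) (natural_filtration (P x) X s)"
proof -
  let ?G = "{X r -` A \<inter> space (P x) | r A. 0 \<le> r \<and> r \<le> s \<and> A \<in> sets borel}"
  have G: "?G \<subseteq> sets (P x)"
    using measurable_sets[OF process_measurable] by auto
  then have "?G \<subseteq> Pow (space (P x))"
    using sets.sets_into_space by blast
  then show ?thesis
    using G sets.sigma_sets_subset[OF G]
    by (auto simp: subalgebra_def natural_filtration_def)
qed

lemma natural_filtration_measurable:
  assumes "0 \<le> r" "r \<le> s"
  shows "(\<lambda>\<omega>. apply_bcontfun f (X r \<omega>)) \<in> borel_measurable (natural_filtration (P x) X s)"
proof (rule measurable_compose[of "X r" _ borel])
  let ?G = "{X r -` A \<inter> space (P x) | r A. 0 \<le> r \<and> r \<le> s \<and> A \<in> sets borel}"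
  have "?G \<subseteq> Pow (space (P x))" by auto
  then show "X r \<in> borel_measurable (natural_filtration (P x) X s)"
    unfolding natural_filtration_def
    using assms by (intro measurableI) (auto simp: space_measure_of_conv sets_measure_of)
qed (auto intro: borel_measurable_continuous_onI)

text \<open>In this integrated form the Markov property can be iterated along a grid of times, with \<open>Y\<close> the
  product of the factors collected so far.\<close>

lemma markov_property_integral:
  assumes "0 \<le> s" "0 \<le> t" and Y: "Y \<in> borel_measurable (natural_filtration (P x) X s)" and B: "\<And>\<omega>. \<bar>Y \<omega>\<bar> \<le> B"
  shows "(\<integral>\<omega>. Y \<omega> * apply_bcontfun f (X (s + t) \<omega>) \<partial>P x) = (\<integral>\<omega>. Y \<omega> * apply_bcontfun (T t f) (X s \<omega>) \<partial>P x)"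
proof -
  interpret prob_space "P x" by (rule process_prob_space)
  let ?F = "natural_filtration (P x) X s"
  interpret finite_measure_subalgebra "P x" ?F
    by unfold_locales (rule subalgebra_natural_filtration)
  have [measurable]: "Y \<in> borel_measurable (P x)"
    by (rule measurable_from_subalg[OF subalgebra_natural_filtration Y])
  have [measurable]: "(\<lambda>\<omega>. apply_bcontfun f (X (s + t) \<omega>)) \<in> borel_measurable (P x)"
    "(\<lambda>\<omega>. apply_bcontfun (T t f) (X s \<omega>)) \<in> borel_measurable (P x)"
    using assms by auto
  have "0 \<le> B" using B[of undefined] by linarith
  have int: "integrable (P x) (\<lambda>\<omega>. Y \<omega> * apply_bcontfun f (X (s + t) \<omega>))"
    by (rule integrable_const_bound[where B = "B * norm f"])
       (auto simp: abs_mult intro!: mult_mono B bcontfun_abs_le_norm \<open>0 \<le> B\<close>)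
  have "(\<integral>\<omega>. Y \<omega> * apply_bcontfun f (X (s + t) \<omega>) \<partial>P x)
      = (\<integral>\<omega>. Y \<omega> * real_cond_exp (P x) ?F (\<lambda>\<omega>. apply_bcontfun f (X (s + t) \<omega>)) \<omega> \<partial>P x)"
    by (rule real_cond_exp_intg(2)[OF int Y, symmetric]) measurable
  also have "\<dots> = (\<integral>\<omega>. Y \<omega> * apply_bcontfun (T t f) (X s \<omega>) \<partial>P x)"
    by (rule integral_cong_AE) (use process_markov[OF assms(1,2), of x f] in auto)
  finally show ?thesis .
qed

lemma expectation_eq_semigroup:
  assumes "0 \<le> t"
  shows "(\<integral>\<omega>. apply_bcontfun f (X t \<omega>) \<partial>P x) = apply_bcontfun (T t f) x"
proof -
  interpret prob_space "P x" by (rule process_prob_space)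
  have "(\<integral>\<omega>. apply_bcontfun f (X t \<omega>) \<partial>P x) = (\<integral>\<omega>. apply_bcontfun (T t f) (X 0 \<omega>) \<partial>P x)"
    using markov_property_integral[of 0 t "\<lambda>_. 1" x 1 f] assms by simp
  also have "\<dots> = (\<integral>\<omega>. apply_bcontfun (T t f) x \<partial>P x)"
    by (rule integral_cong_AE) (use process_start[of x] in auto)
  finally show ?thesis by (simp add: prob_space)
qed

text \<open>The last factor is absorbed into the terminal function by one application of the semigroup, so the
  product over the grid unwinds into powers of a single operator.\<close>

lemma expectation_prod_eq_weighted_steps:
  assumes s: "0 \<le> s" and h: "0 \<le> h"
  shows "(\<integral>\<omega>. (\<Prod>i\<in>{1..n}. apply_bcontfun f (X (s + real i * h) \<omega>)) * apply_bcontfun g (X (s + real n * h) \<omega>) \<partial>P x)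
     = apply_bcontfun (T s ((weighted_step (T h) f ^^ n) g)) x"
proof (induction n arbitrary: g)
  case 0
  then show ?case using expectation_eq_semigroup[OF s] by simp
next
  case (Suc n)
  let ?fg = "bmult f g"
  let ?Y = "\<lambda>\<omega>. \<Prod>i\<in>{1..n}. apply_bcontfun f (X (s + real i * h) \<omega>)"
  have sn: "0 \<le> s + real n * h" using s h by simp
  have "(\<Prod>i\<in>{1..Suc n}. apply_bcontfun f (X (s + real i * h) \<omega>)) * apply_bcontfun g (X (s + real (Suc n) * h) \<omega>)
      = ?Y \<omega> * apply_bcontfun ?fg (X ((s + real n * h) + h) \<omega>)" for \<omega>
    by (simp add: algebra_simps)
  then have "(\<integral>\<omega>. (\<Prod>i\<in>{1..Suc n}. apply_bcontfun f (X (s + real i * h) \<omega>)) * apply_bcontfun g (X (s + real (Suc n) * h) \<omega>) \<partial>P x)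
      = (\<integral>\<omega>. ?Y \<omega> * apply_bcontfun ?fg (X ((s + real n * h) + h) \<omega>) \<partial>P x)"
    by (simp only:)
  also have "\<dots> = (\<integral>\<omega>. ?Y \<omega> * apply_bcontfun (T h ?fg) (X (s + real n * h) \<omega>) \<partial>P x)"
  proof (rule markov_property_integral[OF sn h])
    show "?Y \<in> borel_measurable (natural_filtration (P x) X (s + real n * h))"
      using s h by (intro borel_measurable_prod natural_filtration_measurable) (auto intro!: mult_right_mono)
    show "\<bar>?Y \<omega>\<bar> \<le> norm f ^ n" for \<omega>
      using prod_mono[of "{1..n}" "\<lambda>i. \<bar>apply_bcontfun f (X (s + real i * h) \<omega>)\<bar>" "\<lambda>_. norm f"]
      by (simp add: abs_prod bcontfun_abs_le_norm)
  qed
  also have "\<dots> = apply_bcontfun (T s ((weighted_step (T h) f ^^ n) (T h ?fg))) x"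
    by (rule Suc.IH)
  also have "T h ?fg = weighted_step (T h) f g" by (simp add: weighted_step_def)
  finally show ?case by (simp only: funpow_Suc_right o_def)
qed

end

section \<open>Riemann sums of right-continuous functions\<close>

text \<open>Rounding up to a grid approaches a point from the right, where the function is continuous. Sampling at
  the right end points therefore needs no left limits.\<close>

lemma right_continuous_ceiling_tendsto:
  fixes F :: "real \<Rightarrow> real"
  assumes "(F \<longlongrightarrow> F s) (at_right s)" and "0 < c"
  shows "(\<lambda>n. F (of_int \<lceil>s * real (Suc n) / c\<rceil> * (c / real (Suc n)))) \<longlonglongrightarrow> F s"
proof -
  define r where "r n = of_int \<lceil>s * real (Suc n) / c\<rceil> * (c / real (Suc n))" for n
  have r: "s \<le> r n" "r n \<le> s + c / real (Suc n)" for n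
  proof -
    have "s = (s * real (Suc n) / c) * (c / real (Suc n))" using assms by simp
    also have "\<dots> \<le> r n" unfolding r_def using assms(2) by (intro mult_right_mono) (auto simp del: of_nat_Suc)
    finally show "s \<le> r n" .
    have "r n \<le> (s * real (Suc n) / c + 1) * (c / real (Suc n))"
      unfolding r_def using assms(2) by (intro mult_right_mono) (linarith, auto simp del: of_nat_Suc)
    also have "\<dots> = s + c / real (Suc n)"
    proof -
      have *: "(s * N / c + 1) * (c / N) = s + c / N" if "0 < N" for N
        using that assms(2) by (simp add: field_simps)
      show ?thesis by (rule *) simp
    qed
    finally show "r n \<le> s + c / real (Suc n)" .
  qed
  have "(\<lambda>n. s + c / real (Suc n)) \<longlonglongrightarrow> s + 0"
    by (intro tendsto_add tendsto_const LIMSEQ_Suc[OF lim_const_over_n])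
  then have up: "(\<lambda>n. s + c / real (Suc n)) \<longlonglongrightarrow> s"
    by simp
  have "r \<longlonglongrightarrow> s"
  proof (rule tendsto_sandwich[of "\<lambda>_. s" r sequentially "\<lambda>n. s + c / real (Suc n)" s])
    show "\<forall>\<^sub>F n in sequentially. s \<le> r n" "\<forall>\<^sub>F n in sequentially. r n \<le> s + c / real (Suc n)"
      using r by (simp_all only: always_eventually simp_thms)
  qed (rule tendsto_const, rule up)
  moreover have "(F \<longlongrightarrow> F s) (at s within {s..})"
    using assms(1) unfolding at_within_Ici_at_right .
  then have "continuous (at s within {s..}) F" by (simp add: continuous_within)
  ultimately show ?thesis
    unfolding r_def[symmetric]
    using r by (auto simp: continuous_within_sequentially o_def)
qed

lemma right_continuous_borel_measurable:
  fixes F :: "real \<Rightarrow> real"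
  assumes "\<And>s. (F \<longlongrightarrow> F s) (at_right s)"
  shows "F \<in> borel_measurable borel"
proof (rule borel_measurable_LIMSEQ_real[where u = "\<lambda>n s. F (of_int \<lceil>s * real (Suc n) / 1\<rceil> * (1 / real (Suc n)))"])
  fix s show "(\<lambda>n. F (of_int \<lceil>s * real (Suc n) / 1\<rceil> * (1 / real (Suc n)))) \<longlonglongrightarrow> F s"
    by (rule right_continuous_ceiling_tendsto[OF assms]) simp
next
  fix n
  have "(\<lambda>s::real. \<lceil>s * real (Suc n) / 1\<rceil>) \<in> measurable borel (count_space UNIV)"
    by measurable
  from measurable_compose[OF this, of "\<lambda>i. F (of_int i * (1 / real (Suc n)))" borel]
  show "(\<lambda>s. F (of_int \<lceil>s * real (Suc n) / 1\<rceil> * (1 / real (Suc n)))) \<in> borel_measurable borel"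
    by simp
qed

text \<open>The Riemann sum is the integral of the function sampled at rounded-up times, so dominated convergence
  applies.\<close>

lemma right_riemann_sum_tendsto:
  fixes F :: "real \<Rightarrow> real"
  assumes cont: "\<And>s. 0 \<le> s \<Longrightarrow> (F \<longlongrightarrow> F s) (at_right s)" and B: "\<And>s. \<bar>F s\<bar> \<le> B" and t: "0 < t"
  shows "(\<lambda>n. (t / real (Suc n)) * (\<Sum>i\<in>{1..Suc n}. F (real i * (t / real (Suc n))))) \<longlonglongrightarrow> (LBINT s. indicator {0<..t} s * F s)"
    and "(\<lambda>s. indicator {0<..t} s * F s) \<in> borel_measurable borel"
proof -
  \<comment> \<open>Nothing is assumed about \<open>F\<close> at negative times; \<open>F0\<close> is right-continuous on the whole line.\<close>
  define F0 where "F0 s = (if 0 \<le> s then F s else 0)" for s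
  have F0_lim: "(F0 \<longlongrightarrow> F0 s) (at_right s)" for s
  proof (cases "0 \<le> s")
    case True
    have "eventually (\<lambda>u. F u = F0 u) (at_right s)"
      using eventually_at_right_less[of s] by eventually_elim (use True in \<open>simp add: F0_def\<close>)
    then show ?thesis
      using Lim_transform_eventually[OF cont[OF True]] True by (simp add: F0_def)
  next
    case False
    have "eventually (\<lambda>u. u < 0) (at_right s)" 
      by (rule order_tendstoD(2)[OF tendsto_ident_at]) (use False in simp)
    then have "eventually (\<lambda>u. F0 u = F0 s) (at_right s)"
      by eventually_elim (use False in \<open>simp add: F0_def\<close>)
    then show ?thesis by (rule tendsto_eventually)
  qed
  have F0: "F0 \<in> borel_measurable borel"
    by (rule right_continuous_borel_measurable[of F0]) (rule F0_lim)
  have eqF0: "(\<lambda>s. indicator {0<..t} s * F s) = (\<lambda>s. indicator {0<..t} s * F0 s)"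
    by (auto simp: F0_def indicator_def)
  show meas: "(\<lambda>s. indicator {0<..t} s * F s) \<in> borel_measurable borel"
    unfolding eqF0 by (intro borel_measurable_times borel_measurable_indicator F0) simp
  define h where "h n = t / real (Suc n)" for n
  have h: "0 < h n" "real (Suc n) * h n = t" for n using t by (simp_all add: h_def)
  define R where "R n s = (\<Sum>i\<in>{1..Suc n}. indicator {real i * h n - h n<..real i * h n} s * F (real i * h n))" for n s
  have R: "R n s = indicator {0<..t} s * F (of_int \<lceil>s * real (Suc n) / t\<rceil> * h n)" for n s
  proof -
    have ceil: "s \<in> {real i * h n - h n<..real i * h n} \<longleftrightarrow> \<lceil>s * real (Suc n) / t\<rceil> = int i" for i
    proof -
      have eq: "s * real (Suc n) / t = s / h n" using t by (simp add: h_def)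
      show ?thesis unfolding eq using h(1)[of n] by (auto simp: ceiling_eq_iff pos_less_divide_eq pos_divide_le_eq left_diff_distrib)
    qed
    show ?thesis
    proof (cases "s \<in> {0<..t}")
      case True
      define k where "k = nat \<lceil>s * real (Suc n) / t\<rceil>"
      have pos: "0 < s * real (Suc n) / t" using True t by simp
      have "s * real (Suc n) \<le> t * real (Suc n)" using True by (intro mult_right_mono) auto
      then have "s * real (Suc n) / t \<le> real (Suc n)" using t by (simp only: pos_divide_le_eq mult.commute)
      then have k: "\<lceil>s * real (Suc n) / t\<rceil> = int k" "k \<in> {1..Suc n}"
        using pos by (auto simp: k_def ceiling_le_iff le_nat_iff one_le_ceiling nat_le_iff)
      have "R n s = (\<Sum>i\<in>{1..Suc n}. if k = i then F (real i * h n) else 0)"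
        unfolding R_def
      proof (rule sum.cong)
        fix i
        have "s \<in> {real i * h n - h n<..real i * h n} \<longleftrightarrow> k = i"
          unfolding ceil k(1) by simp
        then show "indicator {real i * h n - h n<..real i * h n} s * F (real i * h n) = (if k = i then F (real i * h n) else 0)"
          by (simp only: indicator_def of_bool_def) simp
      qed simp
      also have "\<dots> = F (real k * h n)" using k(2) by (subst sum.delta') auto
      finally show ?thesis using True k by simp
    next
      case False
      have "s \<notin> {real i * h n - h n<..real i * h n}" if i: "i \<in> {1..Suc n}" for i
      proof
        assume s: "s \<in> {real i * h n - h n<..real i * h n}"
        have "h n \<le> real i * h n" using h(1)[of n] i by simp
        moreover have "real i * h n \<le> real (Suc n) * h n" using i h(1)[of n] by (intro mult_right_mono) auto
        ultimately show False using s False h(2)[of n] by auto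
      qed
      then show ?thesis using False unfolding R_def by (intro trans[OF sum.neutral]) auto
    qed
  qed
  have "(\<lambda>n. LBINT s. R n s) \<longlonglongrightarrow> (LBINT s. indicator {0<..t} s * F s)"
  proof (rule integral_dominated_convergence[where w = "\<lambda>s. indicator {0<..t} s * B"])
    show "(\<lambda>s. indicator {0<..t} s * F s) \<in> borel_measurable lborel" using meas by simp
    show "R n \<in> borel_measurable lborel" for n unfolding R_def by measurable
    show "integrable lborel (\<lambda>s. indicator {0<..t} s * B)" using t by (intro integrable_mult_left) (auto intro!: integrable_real_indicator)
    show "AE s in lborel. (\<lambda>n. R n s) \<longlonglongrightarrow> indicator {0<..t} s * F s"
    proof (intro AE_I2)
      fix s :: real
      show "(\<lambda>n. R n s) \<longlonglongrightarrow> indicator {0<..t} s * F s"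
        unfolding R using right_continuous_ceiling_tendsto[OF cont t, of s]
        by (cases "s \<in> {0<..t}") (auto simp: h_def)
    qed
    show "AE s in lborel. norm (R n s) \<le> indicator {0<..t} s * B" for n
      unfolding R by (auto simp: indicator_def abs_mult B)
  qed
  moreover have "(LBINT s. R n s) = h n * (\<Sum>i\<in>{1..Suc n}. F (real i * h n))" for n
  proof -
    have int: "integrable lborel (\<lambda>s. indicator {real i * h n - h n<..real i * h n} s * F (real i * h n))" for i
      using h(1)[of n] by (intro integrable_mult_left integrable_real_indicator) auto
    have "(LBINT s. R n s) = (\<Sum>i\<in>{1..Suc n}. LBINT s. indicator {real i * h n - h n<..real i * h n} s * F (real i * h n))"
      unfolding R_def by (rule Bochner_Integration.integral_sum) (rule int)
    also have "\<dots> = (\<Sum>i\<in>{1..Suc n}. h n * F (real i * h n))"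
      using h(1)[of n] by (intro sum.cong refl) (simp add: measure_def)
    finally show ?thesis by (simp only: sum_distrib_left)
  qed
  ultimately show "(\<lambda>n. (t / real (Suc n)) * (\<Sum>i\<in>{1..Suc n}. F (real i * (t / real (Suc n))))) \<longlonglongrightarrow> (LBINT s. indicator {0<..t} s * F s)"
    unfolding h_def by simp
qed

section \<open>The Feynman--Kac formula\<close>

lemma derivative_bound_imp_increment_bound:
  fixes f :: "real \<Rightarrow> real"
  assumes "0 \<le> h"
    and der: "\<And>u. 0 \<le> u \<Longrightarrow> u \<le> h \<Longrightarrow> (f has_real_derivative f' u) (at u within {0..h})"
    and bd: "\<And>u. 0 \<le> u \<Longrightarrow> u \<le> h \<Longrightarrow> \<bar>f' u\<bar> \<le> b"
  shows "\<bar>f h - f 0\<bar> \<le> b * h"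
proof -
  have "b * 0 - f 0 \<le> b * h - f h"
  proof (rule has_derivative_nonneg_imp_le[OF assms(1), of "\<lambda>u. b * u - f u" "\<lambda>u. b * 1 - f' u"])
    fix u assume "0 \<le> u" "u \<le> h"
    then show "((\<lambda>u. b * u - f u) has_real_derivative b * 1 - f' u) (at u within {0..h})"
      by (intro DERIV_diff DERIV_cmult DERIV_ident der)
    show "0 \<le> b * 1 - f' u" using bd[OF \<open>0 \<le> u\<close> \<open>u \<le> h\<close>] by (simp add: abs_le_iff)
  qed
  moreover have "b * 0 + f 0 \<le> b * h + f h"
  proof (rule has_derivative_nonneg_imp_le[OF assms(1), of "\<lambda>u. b * u + f u" "\<lambda>u. b * 1 + f' u"])
    fix u assume "0 \<le> u" "u \<le> h"
    then show "((\<lambda>u. b * u + f u) has_real_derivative b * 1 + f' u) (at u within {0..h})"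
      by (intro DERIV_add DERIV_cmult DERIV_ident der)
    show "0 \<le> b * 1 + f' u" using bd[OF \<open>0 \<le> u\<close> \<open>u \<le> h\<close>] by (simp add: abs_le_iff)
  qed
  ultimately show ?thesis by (simp add: abs_le_iff)
qed

lemma exp_minus_bounds:
  fixes y :: real
  assumes "0 \<le> y"
  shows "\<bar>exp (- y) - 1\<bar> \<le> y" and "\<bar>exp (- y) - 1 + y\<bar> \<le> y\<^sup>2"
proof -
  have 1: "1 - y \<le> exp (- y)" using exp_ge_add_one_self[of "- y"] by simp
  have "1 \<le> (1 - y + y\<^sup>2) * (1 + y)"
    using assms by (simp add: algebra_simps power2_eq_square)
  also have "\<dots> \<le> (1 - y + y\<^sup>2) * exp y"
  proof (rule mult_left_mono)
    show "1 + y \<le> exp y" by (rule exp_ge_add_one_self)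
    show "0 \<le> 1 - y + y\<^sup>2" using zero_le_power2[of "y - 1/2"] by (simp add: power2_eq_square algebra_simps)
  qed
  finally have 2: "exp (- y) \<le> 1 - y + y\<^sup>2"
    by (simp add: exp_minus field_simps)
  show "\<bar>exp (- y) - 1\<bar> \<le> y" using 1 assms by (simp add: abs_le_iff)
  show "\<bar>exp (- y) - 1 + y\<bar> \<le> y\<^sup>2" using 1 2 by (simp add: abs_le_iff)
qed

text \<open>Singletons are open, so the right limit is attained.\<close>

lemma process_eventually_stays:
  fixes P :: "'s::topological_space \<Rightarrow> 'w measure"
  assumes "markov_semigroup T" "markov_process T P X" and disc: "\<And>B :: 's set. open B"
    and "\<omega> \<in> space (P x)" "0 \<le> s"
  shows "\<forall>\<^sub>F u in at_right s. X u \<omega> = X s \<omega>"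
  using topological_tendstoD[OF process_right_continuous[OF assms(1,2,4,5)] disc[of "{X s \<omega>}"]] by simp

lemma additive_functional_riemann:
  fixes P :: "'s::topological_space \<Rightarrow> 'w measure" and V :: "'s \<Rightarrow>\<^sub>C real"
  assumes T: "markov_semigroup T" and P: "markov_process T P X" and disc: "\<And>B :: 's set. open B" and t: "0 < t"
  shows "\<omega> \<in> space (P x) \<Longrightarrow> (\<lambda>n. (t / real (Suc n)) * (\<Sum>i\<in>{1..Suc n}. apply_bcontfun V (X (real i * (t / real (Suc n))) \<omega>)))
      \<longlonglongrightarrow> (LBINT s. indicator {0<..t} s * apply_bcontfun V (X s \<omega>))"
    and "(\<lambda>\<omega>. LBINT s. indicator {0<..t} s * apply_bcontfun V (X s \<omega>)) \<in> borel_measurable (P x)"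
proof -
  show *: "(\<lambda>n. (t / real (Suc n)) * (\<Sum>i\<in>{1..Suc n}. apply_bcontfun V (X (real i * (t / real (Suc n))) \<omega>)))
      \<longlonglongrightarrow> (LBINT s. indicator {0<..t} s * apply_bcontfun V (X s \<omega>))" if "\<omega> \<in> space (P x)" for \<omega>
  proof (rule right_riemann_sum_tendsto(1)[where B = "norm V", OF _ _ t])
    fix s :: real assume "0 \<le> s"
    show "((\<lambda>s. apply_bcontfun V (X s \<omega>)) \<longlongrightarrow> apply_bcontfun V (X s \<omega>)) (at_right s)"
      using process_eventually_stays[OF T P disc that \<open>0 \<le> s\<close>]
      by (intro tendsto_eventually) (auto elim: eventually_mono)
  qed (rule bcontfun_abs_le_norm)
  show "(\<lambda>\<omega>. LBINT s. indicator {0<..t} s * apply_bcontfun V (X s \<omega>)) \<in> borel_measurable (P x)"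
  proof (rule borel_measurable_LIMSEQ_real[where u = "\<lambda>n \<omega>. (t / real (Suc n)) * (\<Sum>i\<in>{1..Suc n}. apply_bcontfun V (X (real i * (t / real (Suc n))) \<omega>))"])
    show "(\<lambda>\<omega>. (t / real (Suc n)) * (\<Sum>i\<in>{1..Suc n}. apply_bcontfun V (X (real i * (t / real (Suc n))) \<omega>))) \<in> borel_measurable (P x)" for n
      using t by (intro borel_measurable_times borel_measurable_sum process_fun_measurable[OF T P]) auto
  qed (rule *)
qed

context
  fixes T :: "real \<Rightarrow> ('s::topological_space \<Rightarrow>\<^sub>C real) \<Rightarrow> ('s \<Rightarrow>\<^sub>C real)"
    and A :: "('s \<Rightarrow>\<^sub>C real) \<Rightarrow> ('s \<Rightarrow>\<^sub>C real)" and K :: real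
  assumes T: "markov_semigroup T"
    and A: "linear A" "\<And>f. norm (A f) \<le> K * norm f"
    and gen: "\<And>f. (f, A f) \<in> generator T"
begin

lemma semigroup_expansion:
  assumes h: "0 \<le> h"
  shows "\<bar>apply_bcontfun (T h f) x - apply_bcontfun f x\<bar> \<le> h * norm (A f)"
    and "\<bar>apply_bcontfun (T h f) x - apply_bcontfun f x - h * apply_bcontfun (A f) x\<bar> \<le> h\<^sup>2 * norm (A (A f))"
proof -
  have der: "((\<lambda>t. apply_bcontfun (T t f) x) has_real_derivative apply_bcontfun (T u (A f)) x) (at u within {0..h})"
    if "0 \<le> u" for u f h
    by (rule DERIV_subset[OF semigroup_has_derivative_at[OF T gen that]]) auto
  have 1: "\<bar>apply_bcontfun (T h f) x - apply_bcontfun f x\<bar> \<le> norm (A f) * h" if "0 \<le> h" for h f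
    using derivative_bound_imp_increment_bound[OF that der, of f "norm (A f)"]
      order_trans[OF bcontfun_abs_le_norm semigroup_norm_le[OF T]] by (auto simp: semigroup_0[OF T])
  then show "\<bar>apply_bcontfun (T h f) x - apply_bcontfun f x\<bar> \<le> h * norm (A f)"
    using h by (simp add: mult.commute)
  have "\<bar>(apply_bcontfun (T h f) x - apply_bcontfun (A f) x * h) - (apply_bcontfun (T 0 f) x - apply_bcontfun (A f) x * 0)\<bar>
      \<le> (norm (A (A f)) * h) * h"
  proof (rule derivative_bound_imp_increment_bound[OF h])
    fix u assume u: "0 \<le> u" "u \<le> h"
    show "((\<lambda>u. apply_bcontfun (T u f) x - apply_bcontfun (A f) x * u) has_real_derivative
        apply_bcontfun (T u (A f)) x - apply_bcontfun (A f) x * 1) (at u within {0..h})"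
      by (intro DERIV_diff der u DERIV_cmult DERIV_ident)
    show "\<bar>apply_bcontfun (T u (A f)) x - apply_bcontfun (A f) x * 1\<bar> \<le> norm (A (A f)) * h"
      using 1[OF u(1), of "A f"] mult_left_mono[OF u(2), of "norm (A (A f))"] by simp
  qed
  then show "\<bar>apply_bcontfun (T h f) x - apply_bcontfun f x - h * apply_bcontfun (A f) x\<bar> \<le> h\<^sup>2 * norm (A (A f))"
    by (simp add: semigroup_0[OF T] algebra_simps power2_eq_square)
qed

text \<open>The function \<open>v\<close> solves the equation of the process killed at rate \<open>V\<close>, on a set \<open>W\<close> that the process
  does not leave. Extending it by \<open>0\<close> off \<open>W\<close> makes it an element of the Banach space whose norm is
  controlled by the values on \<open>W\<close>.\<close>

context
  fixes W :: "'s set" and v :: "real \<Rightarrow> ('s \<Rightarrow>\<^sub>C real)" and V :: "'s \<Rightarrow>\<^sub>C real" and M :: real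
  assumes disc: "\<And>B :: 's set. open B"
    and closedW: "\<And>t f b x. 0 \<le> t \<Longrightarrow> x \<in> W \<Longrightarrow> (\<And>y. y \<in> W \<Longrightarrow> \<bar>apply_bcontfun f y\<bar> \<le> b) \<Longrightarrow> \<bar>apply_bcontfun (T t f) x\<bar> \<le> b"
    and V: "\<And>x. 0 \<le> apply_bcontfun V x"
    and vM: "\<And>t. 0 \<le> t \<Longrightarrow> norm (v t) \<le> M"
    and v0: "\<And>t x. 0 \<le> t \<Longrightarrow> x \<notin> W \<Longrightarrow> apply_bcontfun (v t) x = 0"
    and ode: "\<And>t x. 0 \<le> t \<Longrightarrow> x \<in> W \<Longrightarrow> ((\<lambda>t. apply_bcontfun (v t) x) has_real_derivative
        apply_bcontfun (A (v t)) x - apply_bcontfun V x * apply_bcontfun (v t) x) (at t within {0..})"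
begin

abbreviation "K' \<equiv> \<bar>K\<bar> + norm V"

lemma solution_bound_nonneg: "0 \<le> M" using order_trans[OF norm_ge_zero vM[of 0]] by simp

lemma generator_norm_le: "norm (A f) \<le> \<bar>K\<bar> * norm f"
  by (rule order_trans[OF A(2)]) (intro mult_right_mono, auto)

lemma killed_generator_bound: "\<bar>apply_bcontfun (A f) x - apply_bcontfun V x * apply_bcontfun f x\<bar> \<le> K' * norm f"
proof -
  have "\<bar>apply_bcontfun (A f) x\<bar> \<le> \<bar>K\<bar> * norm f" using order_trans[OF bcontfun_abs_le_norm generator_norm_le] .
  moreover have "\<bar>apply_bcontfun V x * apply_bcontfun f x\<bar> \<le> norm V * norm f"
    unfolding abs_mult by (intro mult_mono bcontfun_abs_le_norm) auto
  ultimately show ?thesis by (simp add: distrib_right)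
qed

lemma solution_shift:
  assumes "0 \<le> s" "0 \<le> u" "x \<in> W"
  shows "((\<lambda>u. apply_bcontfun (v (s + u)) x) has_real_derivative
    apply_bcontfun (A (v (s + u))) x - apply_bcontfun V x * apply_bcontfun (v (s + u)) x) (at u within {0..h})"
proof -
  have "((\<lambda>t. apply_bcontfun (v t) x) has_real_derivative
    apply_bcontfun (A (v (s + u))) x - apply_bcontfun V x * apply_bcontfun (v (s + u)) x) (at (s + u) within (\<lambda>u. s + u) ` {0..h})"
    by (rule DERIV_subset[OF ode]) (use assms in auto)
  moreover have "((\<lambda>u. s + u) has_real_derivative 0 + 1) (at u within {0..h})"
    by (intro DERIV_add DERIV_const DERIV_ident)
  ultimately have "((\<lambda>t. apply_bcontfun (v t) x) \<circ> (\<lambda>u. s + u) has_real_derivative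
    (apply_bcontfun (A (v (s + u))) x - apply_bcontfun V x * apply_bcontfun (v (s + u)) x) * (0 + 1)) (at u within {0..h})"
    by (rule DERIV_image_chain)
  then show ?thesis by (simp add: o_def)
qed

lemma solution_lipschitz: "0 \<le> s \<Longrightarrow> 0 \<le> h \<Longrightarrow> norm (v (s + h) - v s) \<le> K' * M * h"
proof (rule norm_bound)
  fix x assume s: "0 \<le> s" and h: "0 \<le> h"
  show "norm (apply_bcontfun (v (s + h) - v s) x) \<le> K' * M * h"
  proof (cases "x \<in> W")
    case True
    have "\<bar>apply_bcontfun (v (s + h)) x - apply_bcontfun (v (s + 0)) x\<bar> \<le> K' * M * h"
    proof (rule derivative_bound_imp_increment_bound[OF h])
      fix u assume u: "0 \<le> u" "u \<le> h"
      show "((\<lambda>u. apply_bcontfun (v (s + u)) x) has_real_derivative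
        apply_bcontfun (A (v (s + u))) x - apply_bcontfun V x * apply_bcontfun (v (s + u)) x) (at u within {0..h})"
        by (rule solution_shift[OF s u(1) True])
      show "\<bar>apply_bcontfun (A (v (s + u))) x - apply_bcontfun V x * apply_bcontfun (v (s + u)) x\<bar> \<le> K' * M"
        by (rule order_trans[OF killed_generator_bound]) (intro mult_left_mono vM, use s u in auto)
    qed
    then show ?thesis by simp
  next
    case False
    then show ?thesis using v0 s h solution_bound_nonneg by simp
  qed
qed

lemma solution_expansion:
  assumes s: "0 \<le> s" and h: "0 \<le> h" and x: "x \<in> W"
  shows "\<bar>apply_bcontfun (v (s + h)) x - apply_bcontfun (v s) x - h * (apply_bcontfun (A (v s)) x - apply_bcontfun V x * apply_bcontfun (v s) x)\<bar>
     \<le> K'\<^sup>2 * M * h\<^sup>2"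
proof -
  define G where "G u = apply_bcontfun (A (v (s + u))) x - apply_bcontfun V x * apply_bcontfun (v (s + u)) x" for u
  have "\<bar>(apply_bcontfun (v (s + h)) x - G 0 * h) - (apply_bcontfun (v (s + 0)) x - G 0 * 0)\<bar> \<le> K' * (K' * M * h) * h"
  proof (rule derivative_bound_imp_increment_bound[OF h])
    fix u assume u: "0 \<le> u" "u \<le> h"
    show "((\<lambda>u. apply_bcontfun (v (s + u)) x - G 0 * u) has_real_derivative G u - G 0 * 1) (at u within {0..h})"
      unfolding G_def by (intro DERIV_diff solution_shift s u x DERIV_cmult DERIV_ident)
    have "G u - G 0 = apply_bcontfun (A (v (s + u) - v s)) x - apply_bcontfun V x * apply_bcontfun (v (s + u) - v s) x"
      by (simp add: G_def linear_diff[OF A(1)] algebra_simps)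
    then have "\<bar>G u - G 0\<bar> \<le> K' * norm (v (s + u) - v s)" using killed_generator_bound by metis
    also have "\<dots> \<le> K' * (K' * M * u)" by (intro mult_left_mono solution_lipschitz s u) auto
    also have "\<dots> \<le> K' * (K' * M * h)" using solution_bound_nonneg u by (intro mult_left_mono) auto
    finally show "\<bar>G u - G 0 * 1\<bar> \<le> K' * (K' * M * h)" by simp
  qed
  then show ?thesis by (simp add: G_def algebra_simps power2_eq_square)
qed

abbreviation "damp h \<equiv> Bcontfun (\<lambda>x. exp (- (h * apply_bcontfun V x)))"

lemma apply_damp: "0 \<le> h \<Longrightarrow> apply_bcontfun (damp h) x = exp (- (h * apply_bcontfun V x))"
  using apply_bcontfun_Bcontfun_discrete[OF disc, of "\<lambda>x. exp (- (h * apply_bcontfun V x))" 1] V by auto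

text \<open>Up to second order in \<open>h\<close>, the semigroup step, the damping factor and the solution are all given by their
  first-order Taylor expansions, and these agree by the differential equation.\<close>

lemma weighted_step_consistent:
  assumes s: "0 \<le> s" and h: "0 \<le> h" and x: "x \<in> W"
  shows "\<bar>apply_bcontfun (weighted_step (T h) (damp h) (v s)) x - apply_bcontfun (v (s + h)) x\<bar> \<le> 4 * K'\<^sup>2 * M * h\<^sup>2"
proof -
  define g where "g = bmult (damp h) (v s)"
  have g: "apply_bcontfun g y = exp (- (h * apply_bcontfun V y)) * apply_bcontfun (v s) y" for y
    unfolding g_def apply_bmult apply_damp[OF h] ..
  have vs: "\<bar>apply_bcontfun (v s) y\<bar> \<le> M" for y using order_trans[OF bcontfun_abs_le_norm vM[OF s]] .
  have hV: "0 \<le> h * apply_bcontfun V y" "h * apply_bcontfun V y \<le> h * norm V" for y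
    using h V bcontfun_abs_le_norm[of V y] by (auto intro!: mult_left_mono)
  have gM: "norm g \<le> M"
  proof (rule norm_bound)
    fix y
    have "\<bar>exp (- (h * apply_bcontfun V y))\<bar> * \<bar>apply_bcontfun (v s) y\<bar> \<le> 1 * M"
      by (intro mult_mono vs) (use hV in auto)
    then show "norm (apply_bcontfun g y) \<le> M" by (simp add: g abs_mult)
  qed
  have gd: "norm (g - v s) \<le> h * norm V * M"
  proof (rule norm_bound)
    fix y
    have "apply_bcontfun (g - v s) y = (exp (- (h * apply_bcontfun V y)) - 1) * apply_bcontfun (v s) y"
      by (simp add: g algebra_simps)
    then have "\<bar>apply_bcontfun (g - v s) y\<bar> = \<bar>exp (- (h * apply_bcontfun V y)) - 1\<bar> * \<bar>apply_bcontfun (v s) y\<bar>"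
      by (simp add: abs_mult)
    also have "\<dots> \<le> (h * norm V) * M"
      using exp_minus_bounds(1)[OF hV(1), of y] hV(2)[of y] h by (intro mult_mono vs) auto
    finally show "norm (apply_bcontfun (g - v s) y) \<le> h * norm V * M" by simp
  qed
  have KK: "\<bar>K\<bar>\<^sup>2 \<le> K'\<^sup>2" "\<bar>K\<bar> * norm V \<le> K'\<^sup>2" "(norm V)\<^sup>2 \<le> K'\<^sup>2"
    by (auto simp: power2_eq_square algebra_simps)
  have e1: "\<bar>apply_bcontfun (T h g) x - apply_bcontfun g x - h * apply_bcontfun (A g) x\<bar> \<le> K'\<^sup>2 * M * h\<^sup>2"
  proof -
    have "norm (A (A g)) \<le> \<bar>K\<bar> * (\<bar>K\<bar> * M)"
      by (intro order_trans[OF generator_norm_le] mult_left_mono gM) auto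
    also have "\<dots> \<le> K'\<^sup>2 * M" using mult_right_mono[OF KK(1) solution_bound_nonneg] by (simp add: power2_eq_square)
    finally have "h\<^sup>2 * norm (A (A g)) \<le> h\<^sup>2 * (K'\<^sup>2 * M)" by (intro mult_left_mono) auto
    then show ?thesis using semigroup_expansion(2)[OF h, of g x] by (simp add: algebra_simps)
  qed
  have e2: "\<bar>h * apply_bcontfun (A g) x - h * apply_bcontfun (A (v s)) x\<bar> \<le> K'\<^sup>2 * M * h\<^sup>2"
  proof -
    have "\<bar>apply_bcontfun (A g) x - apply_bcontfun (A (v s)) x\<bar> = \<bar>apply_bcontfun (A (g - v s)) x\<bar>"
      by (simp add: linear_diff[OF A(1)])
    also have "\<dots> \<le> \<bar>K\<bar> * (h * norm V * M)"
      by (rule order_trans[OF bcontfun_abs_le_norm]) (intro order_trans[OF generator_norm_le] mult_left_mono gd, auto)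
    also have "\<dots> = (\<bar>K\<bar> * norm V) * (h * M)" by simp
    also have "\<dots> \<le> K'\<^sup>2 * (h * M)" using KK(2) h solution_bound_nonneg by (intro mult_right_mono) auto
    finally have "h * \<bar>apply_bcontfun (A g) x - apply_bcontfun (A (v s)) x\<bar> \<le> h * (K'\<^sup>2 * (h * M))"
      using h by (intro mult_left_mono)
    moreover have "\<bar>h * apply_bcontfun (A g) x - h * apply_bcontfun (A (v s)) x\<bar> = h * \<bar>apply_bcontfun (A g) x - apply_bcontfun (A (v s)) x\<bar>"
      using h by (simp add: abs_mult flip: right_diff_distrib)
    ultimately show ?thesis by (simp add: power2_eq_square algebra_simps)
  qed
  have e3: "\<bar>apply_bcontfun g x - apply_bcontfun (v s) x + h * apply_bcontfun V x * apply_bcontfun (v s) x\<bar> \<le> K'\<^sup>2 * M * h\<^sup>2"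
  proof -
    have "apply_bcontfun g x - apply_bcontfun (v s) x + h * apply_bcontfun V x * apply_bcontfun (v s) x
      = (exp (- (h * apply_bcontfun V x)) - 1 + h * apply_bcontfun V x) * apply_bcontfun (v s) x"
      by (simp add: g algebra_simps)
    then have "\<bar>apply_bcontfun g x - apply_bcontfun (v s) x + h * apply_bcontfun V x * apply_bcontfun (v s) x\<bar>
      = \<bar>exp (- (h * apply_bcontfun V x)) - 1 + h * apply_bcontfun V x\<bar> * \<bar>apply_bcontfun (v s) x\<bar>"
      by (simp add: abs_mult)
    also have "\<dots> \<le> (h * norm V)\<^sup>2 * M"
      using exp_minus_bounds(2)[OF hV(1), of x] power_mono[OF hV(2,1), of x 2] by (intro mult_mono vs) auto
    also have "\<dots> \<le> (K'\<^sup>2 * h\<^sup>2) * M"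
      using mult_right_mono[OF KK(3), of "h\<^sup>2"] solution_bound_nonneg by (intro mult_right_mono) (auto simp: power_mult_distrib mult.commute)
    finally show ?thesis by (simp add: algebra_simps)
  qed
  have "weighted_step (T h) (damp h) (v s) = T h g" by (simp add: weighted_step_def g_def)
  then show ?thesis
    using e1 e2 e3 solution_expansion[OF s h x] by (simp add: abs_le_iff algebra_simps)
qed

text \<open>The scheme is a contraction on \<open>W\<close>, so the errors of the single steps add up; \<open>n\<close> steps of size \<open>t / n\<close>
  leave an error of order \<open>1 / n\<close>.\<close>

lemma weighted_steps_close:
  assumes h: "0 \<le> h" and g0: "\<And>x. x \<in> W \<Longrightarrow> apply_bcontfun g0 x = apply_bcontfun (v 0) x" and x: "x \<in> W"
  shows "\<bar>apply_bcontfun ((weighted_step (T h) (damp h) ^^ n) g0) x - apply_bcontfun (v (real n * h)) x\<bar> \<le> real n * (4 * K'\<^sup>2 * M * h\<^sup>2)"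
  using x
proof (induction n arbitrary: x)
  case 0
  then show ?case using g0 by simp
next
  case (Suc n)
  let ?a = "(weighted_step (T h) (damp h) ^^ n) g0" and ?b = "v (real n * h)"
  let ?m = "bmult (damp h)"
  have "weighted_step (T h) (damp h) ?a - weighted_step (T h) (damp h) ?b = T h (?m ?a - ?m ?b)"
    by (simp add: weighted_step_def linear_diff[OF semigroup_linear[OF T h]])
  moreover have "\<bar>apply_bcontfun (T h (?m ?a - ?m ?b)) x\<bar> \<le> real n * (4 * K'\<^sup>2 * M * h\<^sup>2)"
  proof (rule closedW[OF h Suc.prems])
    fix y assume y: "y \<in> W"
    have "apply_bcontfun (?m ?a - ?m ?b) y = exp (- (h * apply_bcontfun V y)) * (apply_bcontfun ?a y - apply_bcontfun ?b y)"
      by (simp add: apply_damp[OF h] algebra_simps)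
    then have "\<bar>apply_bcontfun (?m ?a - ?m ?b) y\<bar> \<le> 1 * \<bar>apply_bcontfun ?a y - apply_bcontfun ?b y\<bar>"
      unfolding abs_mult using h V by (simp add: abs_mult mult_left_le_one_le)
    then show "\<bar>apply_bcontfun (?m ?a - ?m ?b) y\<bar> \<le> real n * (4 * K'\<^sup>2 * M * h\<^sup>2)"
      using Suc.IH[OF y] by simp
  qed
  ultimately have 1: "\<bar>apply_bcontfun (weighted_step (T h) (damp h) ?a) x - apply_bcontfun (weighted_step (T h) (damp h) ?b) x\<bar> \<le> real n * (4 * K'\<^sup>2 * M * h\<^sup>2)"
    by (metis minus_bcontfun.rep_eq)
  have 2: "\<bar>apply_bcontfun (weighted_step (T h) (damp h) ?b) x - apply_bcontfun (v (real n * h + h)) x\<bar> \<le> 4 * K'\<^sup>2 * M * h\<^sup>2"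
    by (rule weighted_step_consistent) (use h Suc.prems in auto)
  have "real n * h + h = real (Suc n) * h" by (simp add: algebra_simps)
  then have "\<bar>apply_bcontfun (weighted_step (T h) (damp h) ?a) x - apply_bcontfun (v (real (Suc n) * h)) x\<bar>
      \<le> real n * (4 * K'\<^sup>2 * M * h\<^sup>2) + 4 * K'\<^sup>2 * M * h\<^sup>2"
    using 1 2 by (simp only: abs_le_iff) linarith
  also have "\<dots> = real (Suc n) * (4 * K'\<^sup>2 * M * h\<^sup>2)" by (simp add: algebra_simps)
  finally show ?case by simp
qed

text \<open>The iterates of the scheme are expectations of \<open>exp\<close> of minus a Riemann sum of \<open>V\<close> along the path. Letting
  the mesh tend to \<open>0\<close> gives the right-hand side by dominated convergence and the left-hand side by consistency.\<close>

theorem feynman_kac: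
  fixes P :: "'s \<Rightarrow> 'w measure"
  assumes P: "markov_process T P X" and init: "\<And>x. x \<in> W \<Longrightarrow> apply_bcontfun (v 0) x = c" and x: "x \<in> W" and t: "0 < t"
  shows "apply_bcontfun (v t) x = c * (\<integral>\<omega>. exp (- (LBINT s. indicator {0<..t} s * apply_bcontfun V (X s \<omega>))) \<partial>P x)"
proof -
  interpret prob_space "P x" by (rule process_prob_space[OF T P])
  define h where "h n = t / real (Suc n)" for n
  have h: "0 \<le> h n" "real (Suc n) * h n = t" for n using t by (simp_all add: h_def)
  define S where "S n \<omega> = h n * (\<Sum>i\<in>{1..Suc n}. apply_bcontfun V (X (real i * h n) \<omega>))" for n \<omega>
  define I where "I \<omega> = (LBINT s. indicator {0<..t} s * apply_bcontfun V (X s \<omega>))" for \<omega>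
  have SI: "(\<lambda>n. S n \<omega>) \<longlonglongrightarrow> I \<omega>" if "\<omega> \<in> space (P x)" for \<omega>
    using additive_functional_riemann(1)[OF T P disc t that, of V] unfolding S_def I_def h_def .
  have S: "S n \<in> borel_measurable (P x)" for n
    unfolding S_def using h by (intro borel_measurable_times borel_measurable_sum process_fun_measurable[OF T P]) auto
  have I: "(\<lambda>\<omega>. LBINT s. indicator {0<..t} s * apply_bcontfun V (X s \<omega>)) \<in> borel_measurable (P x)"
    by (rule additive_functional_riemann(2)[OF T P disc t])
  have "(\<lambda>n. \<integral>\<omega>. exp (- S n \<omega>) \<partial>P x) \<longlonglongrightarrow> (\<integral>\<omega>. exp (- I \<omega>) \<partial>P x)"
  proof (rule integral_dominated_convergence[where w = "\<lambda>_. 1"])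
    show "(\<lambda>\<omega>. exp (- I \<omega>)) \<in> borel_measurable (P x)" using I unfolding I_def by measurable
    show "(\<lambda>\<omega>. exp (- S n \<omega>)) \<in> borel_measurable (P x)" for n using S by measurable
    show "AE \<omega> in P x. (\<lambda>n. exp (- S n \<omega>)) \<longlonglongrightarrow> exp (- I \<omega>)"
      using SI by (intro AE_I2 tendsto_exp tendsto_minus)
    show "AE \<omega> in P x. norm (exp (- S n \<omega>)) \<le> 1" for n
      unfolding S_def using h V by (auto intro!: mult_nonneg_nonneg sum_nonneg simp del: sum.cl_ivl_Suc)
  qed simp
  then have lim1: "(\<lambda>n. c * (\<integral>\<omega>. exp (- S n \<omega>) \<partial>P x)) \<longlonglongrightarrow> c * (\<integral>\<omega>. exp (- I \<omega>) \<partial>P x)"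
    by (rule tendsto_mult_left)
  let ?Phi = "\<lambda>n. apply_bcontfun ((weighted_step (T (h n)) (damp (h n)) ^^ Suc n) (const_bcontfun c)) x"
  have eq: "c * (\<integral>\<omega>. exp (- S n \<omega>) \<partial>P x) = ?Phi n" for n
  proof -
    have "exp (- S n \<omega>) * c = (\<Prod>i\<in>{1..Suc n}. apply_bcontfun (damp (h n)) (X (0 + real i * h n) \<omega>)) * apply_bcontfun (const_bcontfun c) (X (0 + real (Suc n) * h n) \<omega>)" for \<omega>
      unfolding S_def apply_damp[OF h(1)] by (simp add: exp_sum[symmetric] sum_distrib_left sum_negf del: sum.cl_ivl_Suc prod.cl_ivl_Suc)
    then have "(\<integral>\<omega>. exp (- S n \<omega>) * c \<partial>P x) = apply_bcontfun (T 0 ((weighted_step (T (h n)) (damp (h n)) ^^ Suc n) (const_bcontfun c))) x"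
      using expectation_prod_eq_weighted_steps[OF T P order_refl h(1)[of n], where n = "Suc n" and f = "damp (h n)" and g = "const_bcontfun c" and x = x] by (simp only:)
    then show ?thesis by (simp add: semigroup_0[OF T] mult.commute)
  qed
  have lim2: "?Phi \<longlonglongrightarrow> apply_bcontfun (v t) x"
  proof (rule LIM_zero_cancel, rule Lim_null_comparison)
    have "(\<lambda>n. (4 * K'\<^sup>2 * M * t\<^sup>2) / real (Suc n)) \<longlonglongrightarrow> 0"
      by (rule LIMSEQ_Suc[OF lim_const_over_n])
    then show "(\<lambda>n. (4 * K'\<^sup>2 * M * t\<^sup>2) / real (Suc n)) \<longlonglongrightarrow> 0" .
    have "\<bar>?Phi n - apply_bcontfun (v t) x\<bar> \<le> (4 * K'\<^sup>2 * M * t\<^sup>2) / real (Suc n)" for n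
    proof -
      have "\<bar>?Phi n - apply_bcontfun (v (real (Suc n) * h n)) x\<bar> \<le> real (Suc n) * (4 * K'\<^sup>2 * M * (h n)\<^sup>2)"
        by (rule weighted_steps_close[OF h(1) _ x]) (simp add: init)
      also have "real (Suc n) * (4 * K'\<^sup>2 * M * (h n)\<^sup>2) = (4 * K'\<^sup>2 * M * t\<^sup>2) / real (Suc n)"
        unfolding h_def by (simp add: power2_eq_square field_simps del: of_nat_Suc)
      finally show ?thesis unfolding h(2) .
    qed
    then show "\<forall>\<^sub>F n in sequentially. norm (?Phi n - apply_bcontfun (v t) x) \<le> (4 * K'\<^sup>2 * M * t\<^sup>2) / real (Suc n)"
      by simp
  qed
  show "apply_bcontfun (v t) x = c * (\<integral>\<omega>. exp (- (LBINT s. indicator {0<..t} s * apply_bcontfun V (X s \<omega>))) \<partial>P x)"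
    using LIMSEQ_unique[OF lim2] lim1 unfolding eq I_def by blast
qed

end

end

section \<open>Total occupation times\<close>

lemma exp_neg_nonneg: "0 \<le> exp_neg a" and exp_neg_le_1: "exp_neg a \<le> 1"
  by (auto simp: exp_neg_def)

lemma exp_neg_add: "exp_neg (a + b) = exp_neg a * exp_neg b"
  by (auto simp: exp_neg_def enn2real_plus less_top exp_add[symmetric] ennreal_add_eq_top)

lemma exp_tendsto_exp_neg:
  assumes lim: "(\<lambda>n. ennreal (a n)) \<longlonglongrightarrow> J" and pos: "\<And>n. 0 \<le> a n"
  shows "(\<lambda>n. exp (- a n)) \<longlonglongrightarrow> exp_neg J"
proof (cases "J = \<infinity>")
  case False
  then have "(\<lambda>n. enn2real (ennreal (a n))) \<longlonglongrightarrow> enn2real J"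
    using lim by (intro tendsto_enn2real) (auto simp: less_top)
  then have "a \<longlonglongrightarrow> enn2real J" using pos by simp
  then show ?thesis using False by (auto simp: exp_neg_def intro!: tendsto_intros)
next
  case True
  have "filterlim a at_top sequentially"
    unfolding filterlim_at_top_ge[of _ _ 0]
  proof (intro allI impI)
    fix Z :: real assume "0 \<le> Z"
    then have "\<forall>\<^sub>F n in sequentially. ennreal Z < ennreal (a n)"
      using lim True by (simp add: tendsto_top_iff_ennreal infinity_ennreal_def)
    then show "\<forall>\<^sub>F n in sequentially. Z \<le> a n"
      by (rule eventually_mono) (use pos \<open>0 \<le> Z\<close> in \<open>auto simp: ennreal_less_iff\<close>)
  qed
  then have "filterlim (\<lambda>n. - a n) at_bot sequentially" by (simp add: filterlim_uminus_at_bot)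
  then have "(\<lambda>n. exp (- a n)) \<longlonglongrightarrow> 0" by (rule filterlim_compose[OF exp_at_bot])
  then show ?thesis using True by (simp add: exp_neg_def)
qed

text \<open>The truncated time integrals increase to the total one, which may be infinite.\<close>

lemma exp_time_integral_tendsto:
  fixes F :: "real \<Rightarrow> real"
  assumes cont: "\<And>s. 0 \<le> s \<Longrightarrow> (F \<longlongrightarrow> F s) (at_right s)" and F: "\<And>s. 0 \<le> F s" "\<And>s. F s \<le> B" and \<kappa>: "0 \<le> \<kappa>"
  shows "((\<lambda>t. exp (- (LBINT s. indicator {0<..t} s * (\<kappa> * F s)))) \<longlongrightarrow>
      exp_neg (ennreal \<kappa> * (\<integral>\<^sup>+ s\<in>{0..}. ennreal (F s) \<partial>lborel))) at_top"
    and "(\<lambda>s. ennreal (F s) * indicator {0..} s) \<in> borel_measurable lborel"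
    and "mono (\<lambda>t. LBINT s. indicator {0<..t} s * (\<kappa> * F s))"
proof -
  define I where "I t = (LBINT s. indicator {0<..t} s * (\<kappa> * F s))" for t
  have B: "0 \<le> B" using F[of 0] by linarith
  have Fmeas: "(\<lambda>s. indicator {0<..t} s * F s) \<in> borel_measurable borel" for t
  proof (cases "0 < t")
    case True
    then show ?thesis using right_riemann_sum_tendsto(2)[OF cont, of B t] F B by (simp add: abs_of_nonneg)
  next
    case False then show ?thesis by simp
  qed
  have int: "integrable lborel (\<lambda>s. indicator {0<..t} s * (\<kappa> * F s))" for t
  proof (rule Bochner_Integration.integrable_bound)
    show "integrable lborel (\<lambda>s. indicator {0<..t} s * (\<kappa> * B))"
      by (intro integrable_mult_left integrable_real_indicator) (simp, cases "0 \<le> t", auto)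
    have "(\<lambda>s. \<kappa> * (indicator {0<..t} s * F s)) \<in> borel_measurable lborel" using Fmeas[of t] by simp
    then show "(\<lambda>s. indicator {0<..t} s * (\<kappa> * F s)) \<in> borel_measurable lborel" by (simp add: mult.left_commute)
    show "AE s in lborel. norm (indicator {0<..t} s * (\<kappa> * F s)) \<le> norm (indicator {0<..t} s * (\<kappa> * B))"
      using F \<kappa> B by (auto simp: indicator_def abs_mult intro!: mult_left_mono)
  qed
  have I_nonneg: "0 \<le> I t" for t unfolding I_def using F \<kappa> by (intro Bochner_Integration.integral_nonneg) auto
  have I_mono: "mono I"
    unfolding I_def
  proof (rule monoI)
    fix r t :: real assume "r \<le> t"
    then show "(LBINT s. indicator {0<..r} s * (\<kappa> * F s)) \<le> (LBINT s. indicator {0<..t} s * (\<kappa> * F s))"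
      using F \<kappa> by (intro Bochner_Integration.integral_mono int) (auto simp: indicator_def)
  qed
  then show "mono (\<lambda>t. LBINT s. indicator {0<..t} s * (\<kappa> * F s))" unfolding I_def .
  have lim_ind: "(\<lambda>n. indicator {0<..real n} s * F s) \<longlonglongrightarrow> indicator {0<..} s * F s" for s
  proof (rule tendsto_eventually)
    obtain N where "s \<le> real N" using real_arch_simple by blast
    then show "\<forall>\<^sub>F n in sequentially. indicator {0<..real n} s * F s = indicator {0<..} s * F s"
      by (intro eventually_sequentiallyI[of N]) (auto simp: indicator_def)
  qed
  have meas_pos: "(\<lambda>s. indicator {0<..} s * F s) \<in> borel_measurable borel"
    by (rule borel_measurable_LIMSEQ_real[where u = "\<lambda>n s. indicator {0<..real n} s * F s"]) (rule lim_ind, rule Fmeas)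
  have "(\<lambda>s. indicator {0<..} s * F s + indicator {0} s * F 0) \<in> borel_measurable borel"
    using meas_pos by (intro borel_measurable_add) auto
  then have "(\<lambda>s. ennreal (indicator {0<..} s * F s + indicator {0} s * F 0)) \<in> borel_measurable lborel"
    by simp
  moreover have "(\<lambda>s. ennreal (indicator {0<..} s * F s + indicator {0} s * F 0)) = (\<lambda>s. ennreal (F s) * indicator {0..} s)"
    by (auto simp: indicator_def fun_eq_iff)
  ultimately show meas: "(\<lambda>s. ennreal (F s) * indicator {0..} s) \<in> borel_measurable lborel" by simp
  have J: "ennreal (I t) = (\<integral>\<^sup>+ s. ennreal (indicator {0<..t} s * (\<kappa> * F s)) \<partial>lborel)" for t
    unfolding I_def using F \<kappa> by (intro nn_integral_eq_integral[symmetric] int) auto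
  have "(\<lambda>n. \<integral>\<^sup>+ s. ennreal (indicator {0<..real n} s * (\<kappa> * F s)) \<partial>lborel) \<longlonglongrightarrow> (\<integral>\<^sup>+ s. ennreal (\<kappa> * (indicator {0<..} s * F s)) \<partial>lborel)"
  proof (rule nn_integral_LIMSEQ)
    show "incseq (\<lambda>n s. ennreal (indicator {0<..real n} s * (\<kappa> * F s)))"
      using F \<kappa> by (auto simp: incseq_def le_fun_def indicator_def intro!: ennreal_leI)
    show "(\<lambda>s. ennreal (indicator {0<..real n} s * (\<kappa> * F s))) \<in> borel_measurable lborel" for n
      using borel_measurable_integrable[OF int[of "real n"]] by measurable
    show "(\<lambda>n. ennreal (indicator {0<..real n} s * (\<kappa> * F s))) \<longlonglongrightarrow> ennreal (\<kappa> * (indicator {0<..} s * F s))" for s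
      using tendsto_mult_left[OF lim_ind, of \<kappa> s] by (intro tendsto_ennrealI) (simp add: mult.left_commute)
  qed
  also have "(\<integral>\<^sup>+ s. ennreal (\<kappa> * (indicator {0<..} s * F s)) \<partial>lborel) = (\<integral>\<^sup>+ s. ennreal \<kappa> * (ennreal (F s) * indicator {0..} s) \<partial>lborel)"
  proof (rule nn_integral_cong_AE)
    show "AE s in lborel. ennreal (\<kappa> * (indicator {0<..} s * F s)) = ennreal \<kappa> * (ennreal (F s) * indicator {0..} s)"
      using AE_lborel_singleton[of 0]
    proof eventually_elim
      case (elim s)
      then show ?case using F[of s] \<kappa> by (cases "0 < s") (auto simp: indicator_def ennreal_mult)
    qed
  qed
  also have "\<dots> = ennreal \<kappa> * (\<integral>\<^sup>+ s\<in>{0..}. ennreal (F s) \<partial>lborel)"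
    by (rule nn_integral_cmult[OF meas])
  finally have "(\<lambda>n. ennreal (I (real n))) \<longlonglongrightarrow> ennreal \<kappa> * (\<integral>\<^sup>+ s\<in>{0..}. ennreal (F s) \<partial>lborel)"
    unfolding J .
  from exp_tendsto_exp_neg[OF this I_nonneg]
  have seq: "(\<lambda>n. - exp (- I (real n))) \<longlonglongrightarrow> - exp_neg (ennreal \<kappa> * (\<integral>\<^sup>+ s\<in>{0..}. ennreal (F s) \<partial>lborel))"
    by (rule tendsto_minus)
  have "((\<lambda>t. - exp (- I t)) \<longlongrightarrow> - exp_neg (ennreal \<kappa> * (\<integral>\<^sup>+ s\<in>{0..}. ennreal (F s) \<partial>lborel))) at_top"
    by (rule tendsto_at_topI_sequentially_real[OF _ seq]) (use I_mono in \<open>auto simp: mono_def\<close>)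
  from tendsto_minus[OF this] show "((\<lambda>t. exp (- (LBINT s. indicator {0<..t} s * (\<kappa> * F s)))) \<longlongrightarrow>
      exp_neg (ennreal \<kappa> * (\<integral>\<^sup>+ s\<in>{0..}. ennreal (F s) \<partial>lborel))) at_top"
    by (simp add: I_def)
qed

context
  fixes T :: "real \<Rightarrow> ('s::topological_space \<Rightarrow>\<^sub>C real) \<Rightarrow> ('s \<Rightarrow>\<^sub>C real)"
    and P :: "'s \<Rightarrow> 'w measure" and X :: "real \<Rightarrow> 'w \<Rightarrow> 's"
    and w :: "'s \<Rightarrow> real" and \<kappa> B :: real
  assumes T: "markov_semigroup T" and P: "markov_process T P X"
    and disc: "\<And>B :: 's set. open B"
    and w: "\<And>x. 0 \<le> w x" "\<And>x. w x \<le> B" and \<kappa>: "0 \<le> \<kappa>"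
begin

lemma occupation_right_continuous:
  assumes "\<omega> \<in> space (P x)" "0 \<le> s"
  shows "((\<lambda>s. w (X s \<omega>)) \<longlongrightarrow> w (X s \<omega>)) (at_right s)"
  using process_eventually_stays[OF T P disc assms]
  by (intro tendsto_eventually) (auto elim: eventually_mono)

lemma occupation_time_measurable:
  "\<omega> \<in> space (P x) \<Longrightarrow> (\<lambda>s. ennreal (w (X s \<omega>)) * indicator {0..} s) \<in> borel_measurable lborel"
  by (rule exp_time_integral_tendsto(2)[OF occupation_right_continuous]) (auto intro: w)

abbreviation "occupation_weight t \<omega> \<equiv> exp (- (LBINT s. indicator {0<..t} s * (\<kappa> * w (X s \<omega>))))"
abbreviation "total_weight \<omega> \<equiv> exp_neg (ennreal \<kappa> * (\<integral>\<^sup>+ s\<in>{0..}. ennreal (w (X s \<omega>)) \<partial>lborel))"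

lemma occupation_weight_tendsto:
  "\<omega> \<in> space (P x) \<Longrightarrow> ((\<lambda>t. occupation_weight t \<omega>) \<longlongrightarrow> total_weight \<omega>) at_top"
  by (rule exp_time_integral_tendsto(1)[OF occupation_right_continuous w \<kappa>])

lemma occupation_weight_le_1: "occupation_weight t \<omega> \<le> 1"
  using w \<kappa> by (auto intro!: Bochner_Integration.integral_nonneg)

lemma occupation_weight_measurable: "occupation_weight t \<in> borel_measurable (P x)"
proof (cases "0 < t")
  case False
  then show ?thesis by simp
next
  case True
  have "apply_bcontfun (Bcontfun (\<lambda>x. \<kappa> * w x)) = (\<lambda>x. \<kappa> * w x)"
    by (rule apply_bcontfun_Bcontfun_discrete[OF disc, of _ "\<kappa> * B"]) (use w \<kappa> in \<open>auto simp: abs_mult intro!: mult_left_mono\<close>)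
  then have "(\<lambda>\<omega>. LBINT s. indicator {0<..t} s * (\<kappa> * w (X s \<omega>))) \<in> borel_measurable (P x)"
    using additive_functional_riemann(2)[OF T P disc True, of "Bcontfun (\<lambda>x. \<kappa> * w x)" x] by simp
  then show ?thesis by measurable
qed

lemma total_weight_measurable: "total_weight \<in> borel_measurable (P x)"
proof (rule borel_measurable_LIMSEQ_real[where u = "\<lambda>n. occupation_weight (real (Suc n))"])
  show "occupation_weight (real (Suc n)) \<in> borel_measurable (P x)" for n
    by (rule occupation_weight_measurable)
  fix \<omega> assume \<omega>: "\<omega> \<in> space (P x)"
  have "filterlim (\<lambda>n. real (Suc n)) at_top sequentially"
    using filterlim_Suc filterlim_real_sequentially by (rule filterlim_compose[rotated])
  then show "(\<lambda>n. occupation_weight (real (Suc n)) \<omega>) \<longlonglongrightarrow> total_weight \<omega>"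
    by (rule filterlim_compose[OF occupation_weight_tendsto[OF \<omega>]])
qed

lemma expected_occupation_weight_tendsto:
  "((\<lambda>t. \<integral>\<omega>. occupation_weight t \<omega> \<partial>P x) \<longlongrightarrow> (\<integral>\<omega>. total_weight \<omega> \<partial>P x)) at_top"
proof -
  interpret prob_space "P x" by (rule process_prob_space[OF T P])
  show ?thesis
  proof (rule integral_dominated_convergence_at_top[where w = "\<lambda>_. 1"])
    show "total_weight \<in> borel_measurable (P x)" by (rule total_weight_measurable)
    show "\<forall>\<^sub>F t in at_top. AE \<omega> in P x. norm (occupation_weight t \<omega>) \<le> 1"
      using occupation_weight_le_1 by auto
    show "AE \<omega> in P x. ((\<lambda>t. occupation_weight t \<omega>) \<longlongrightarrow> total_weight \<omega>) at_top"
      by (intro AE_I2 occupation_weight_tendsto)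
  qed (auto simp: occupation_weight_measurable)
qed

end

lemma closed_generator_mem:
  assumes "process_with_generator D L T P X" and "f \<in> D" and "apply_bcontfun g = L (apply_bcontfun f)"
  shows "(f, g) \<in> generator T"
proof -
  have "generator T = closure (operator_graph D L)"
    using assms(1) by (simp add: process_with_generator_def)
  moreover have "(f, g) \<in> operator_graph D L" using assms(2,3) by (simp add: operator_graph_def)
  ultimately show ?thesis using closure_subset by auto
qed

section \<open>Processes with bounded generator\<close>

text \<open>\<open>L\<close> induces a linear operator of norm at most \<open>K\<close> on the bounded functions. It is stated for plain functions
  because the generators of jump processes are given by sums over sites.\<close>

definition bounded_on_functions :: "real \<Rightarrow> (('s \<Rightarrow> real) \<Rightarrow> 's \<Rightarrow> real) \<Rightarrow> bool" where
  "bounded_on_functions K L \<longleftrightarrow>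
     (\<forall>f b x. (\<forall>y. \<bar>f y\<bar> \<le> b) \<longrightarrow> \<bar>L f x\<bar> \<le> K * b) \<and>
     (\<forall>f g r b x. (\<forall>y. \<bar>f y\<bar> \<le> b) \<longrightarrow> (\<forall>y. \<bar>g y\<bar> \<le> b) \<longrightarrow> L (\<lambda>y. f y + r * g y) x = L f x + r * L g x)"

lemma bounded_on_functionsD:
  assumes "bounded_on_functions K L"
  shows "(\<And>y. \<bar>f y\<bar> \<le> b) \<Longrightarrow> \<bar>L f x\<bar> \<le> K * b"
    and "(\<And>y. \<bar>f y\<bar> \<le> b) \<Longrightarrow> (\<And>y. \<bar>g y\<bar> \<le> b) \<Longrightarrow> L (\<lambda>y. f y + r * g y) x = L f x + r * L g x"
  using assms unfolding bounded_on_functions_def by blast+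

lemma bounded_on_functionsI:
  assumes "\<And>f b x. (\<And>y. \<bar>f y\<bar> \<le> b) \<Longrightarrow> \<bar>L f x\<bar> \<le> K * b"
    and "\<And>f g r b x. (\<And>y. \<bar>f y\<bar> \<le> b) \<Longrightarrow> (\<And>y. \<bar>g y\<bar> \<le> b) \<Longrightarrow> L (\<lambda>y. f y + r * g y) x = L f x + r * L g x"
  shows "bounded_on_functions K L"
  unfolding bounded_on_functions_def by (intro conjI allI impI assms) auto

text \<open>On a discrete space the bounded functions form the whole domain, so a bounded generator acts on every function
  and each function may be differentiated along the semigroup.\<close>

lemma bounded_generator:
  fixes L :: "('s::topological_space \<Rightarrow> real) \<Rightarrow> 's \<Rightarrow> real"
  assumes disc: "\<And>B :: 's set. open B" and proc: "process_with_generator UNIV L T P X"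
    and L: "bounded_on_functions K L"
  obtains A where "\<And>f. apply_bcontfun (A f) = L (apply_bcontfun f)" and "linear A" and "\<And>f. norm (A f) \<le> K * norm f"
    and "\<And>f. (f, A f) \<in> generator T"
proof -
  define A where "A f = Bcontfun (L (apply_bcontfun f))" for f
  have A: "apply_bcontfun (A f) = L (apply_bcontfun f)" for f
    unfolding A_def
    by (rule apply_bcontfun_Bcontfun_discrete[OF disc, of _ "K * norm f"]) (rule bounded_on_functionsD(1)[OF L], rule bcontfun_abs_le_norm)
  have lin': "L (\<lambda>y. apply_bcontfun f y + r * apply_bcontfun g y) x = L (apply_bcontfun f) x + r * L (apply_bcontfun g) x" for f g r x
    by (rule bounded_on_functionsD(2)[OF L, of _ "max (norm f) (norm g)"]) (auto intro: le_max_iff_disj[THEN iffD2] bcontfun_abs_le_norm)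
  have L0: "L (\<lambda>y. 0) x = 0" for x
    using lin'[of 0 1 0 x] by simp
  have "linear A"
  proof (rule linearI)
    fix f g show "A (f + g) = A f + A g"
      using lin'[of f 1 g] by (intro bcontfun_eqI) (simp add: A plus_bcontfun.rep_eq)
    fix r show "A (r *\<^sub>R f) = r *\<^sub>R A f"
      using lin'[of 0 r f] L0 by (intro bcontfun_eqI) (simp add: A)
  qed
  moreover have "norm (A f) \<le> K * norm f" for f
    by (rule norm_bound) (simp add: A bounded_on_functionsD(1)[OF L] bcontfun_abs_le_norm)
  moreover have "(f, A f) \<in> generator T" for f
    by (rule closed_generator_mem[OF proc]) (auto simp: A)
  ultimately show thesis using A that by blast
qed

text \<open>The condition on \<open>L (indicator (- W))\<close> says that the process cannot leave \<open>W\<close>.\<close>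

lemma feynman_kac_limit:
  fixes L :: "('s::topological_space \<Rightarrow> real) \<Rightarrow> 's \<Rightarrow> real" and P :: "'s \<Rightarrow> 'w measure"
    and v :: "real \<Rightarrow> 's \<Rightarrow> real"
  assumes disc: "\<And>B :: 's set. open B" and proc: "process_with_generator UNIV L T P X"
    and L: "bounded_on_functions K L"
    and closed: "\<And>x. L (indicator (- W)) x \<le> 0"
    and w: "\<And>x. 0 \<le> w x" "\<And>x. w x \<le> B" and \<kappa>: "0 \<le> \<kappa>"
    and v_bound: "\<And>t x. 0 \<le> t \<Longrightarrow> x \<in> W \<Longrightarrow> \<bar>v t x\<bar> \<le> M"
    and ode: "\<And>t x. 0 \<le> t \<Longrightarrow> x \<in> W \<Longrightarrow> ((\<lambda>t. v t x) has_real_derivative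
        L (\<lambda>y. if y \<in> W then v t y else 0) x - \<kappa> * w x * v t x) (at t within {0..})"
    and init: "\<And>x. x \<in> W \<Longrightarrow> v 0 x = c"
    and x: "x \<in> W"
  shows "0 < t \<Longrightarrow> v t x = c * (\<integral>\<omega>. exp (- (LBINT s. indicator {0<..t} s * (\<kappa> * w (X s \<omega>)))) \<partial>P x)"
    and "((\<lambda>t. v t x) \<longlongrightarrow> c * (\<integral>\<omega>. exp_neg (ennreal \<kappa> * (\<integral>\<^sup>+ s\<in>{0..}. ennreal (w (X s \<omega>)) \<partial>lborel)) \<partial>P x)) at_top"
proof -
  have T: "markov_semigroup T" and P: "markov_process T P X"
    using proc by (auto simp: process_with_generator_def)
  obtain A where A: "\<And>f. apply_bcontfun (A f) = L (apply_bcontfun f)" "linear A" "\<And>f. norm (A f) \<le> K * norm f"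
    "\<And>f. (f, A f) \<in> generator T"
    by (rule bounded_generator[OF disc proc L], rule that)
  define V where "V = Bcontfun (\<lambda>x. \<kappa> * w x)"
  have V: "apply_bcontfun V = (\<lambda>x. \<kappa> * w x)"
    unfolding V_def
    by (rule apply_bcontfun_Bcontfun_discrete[OF disc, of _ "\<kappa> * B"]) (use w \<kappa> in \<open>auto simp: abs_mult intro!: mult_left_mono\<close>)
  have M: "0 \<le> M" using v_bound[OF order_refl x] by linarith
  define u where "u t = Bcontfun (\<lambda>x. if x \<in> W then v t x else 0)" for t
  have u: "apply_bcontfun (u t) = (\<lambda>x. if x \<in> W then v t x else 0)" if "0 \<le> t" for t
    unfolding u_def by (rule apply_bcontfun_Bcontfun_discrete[OF disc, of _ M]) (use v_bound[OF that] M in auto)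
  have closedW: "\<bar>apply_bcontfun (T t f) x\<bar> \<le> b"
    if t: "0 \<le> t" and x: "x \<in> W" and fb: "\<And>y. y \<in> W \<Longrightarrow> \<bar>apply_bcontfun f y\<bar> \<le> b" for t f b x
  proof -
    define g where "g = Bcontfun (indicator (- W) :: 's \<Rightarrow> real)"
    have g: "apply_bcontfun g = indicator (- W)"
      unfolding g_def by (rule apply_bcontfun_Bcontfun_discrete[OF disc, of _ 1]) (auto simp: indicator_def)
    have "- apply_bcontfun (T 0 g) x \<le> - apply_bcontfun (T t g) x"
    proof (rule has_derivative_nonneg_imp_le[OF t])
      fix r assume r: "0 \<le> r" "r \<le> t"
      show "((\<lambda>r. - apply_bcontfun (T r g) x) has_real_derivative - apply_bcontfun (T r (A g)) x) (at r within {0..t})"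
        by (intro DERIV_minus DERIV_subset[OF semigroup_has_derivative_at[OF T A(4) r(1)]]) auto
      have "apply_bcontfun (T r (A g)) x \<le> apply_bcontfun (T r (const_bcontfun 0)) x"
        by (rule semigroup_mono[OF T r(1)]) (simp add: A(1) g closed)
      then show "0 \<le> - apply_bcontfun (T r (A g)) x" using semigroup_const[OF T r(1), of 0] by simp
    qed
    then have Tg: "apply_bcontfun (T t g) x \<le> 0" using x by (simp add: semigroup_0[OF T] g)
    have b: "0 \<le> b" using fb[OF x] by linarith
    have dom: "\<bar>apply_bcontfun f y\<bar> \<le> b + norm f * indicator (- W) y" for y
      using fb[of y] bcontfun_abs_le_norm[of f y] b by (cases "y \<in> W") auto
    have "\<bar>apply_bcontfun (T t f) x\<bar> \<le> apply_bcontfun (T t (const_bcontfun b + norm f *\<^sub>R g)) x"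
    proof -
      have "apply_bcontfun (T t f) x \<le> apply_bcontfun (T t (const_bcontfun b + norm f *\<^sub>R g)) x"
        by (rule semigroup_mono[OF T t]) (use dom in \<open>auto simp: g abs_le_iff\<close>)
      moreover have "apply_bcontfun (T t (- f)) x \<le> apply_bcontfun (T t (const_bcontfun b + norm f *\<^sub>R g)) x"
        by (rule semigroup_mono[OF T t]) (use dom in \<open>auto simp: g abs_le_iff\<close>)
      ultimately show ?thesis by (simp add: linear_neg[OF semigroup_linear[OF T t]])
    qed
    also have "\<dots> = b + norm f * apply_bcontfun (T t g) x"
      using semigroup_linear[OF T t] by (simp add: linear_add linear_scale semigroup_const[OF T t])
    also have "\<dots> \<le> b" using Tg mult_left_mono[OF Tg, of "norm f"] by simp
    finally show ?thesis .
  qed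
  have ode': "((\<lambda>t. apply_bcontfun (u t) x) has_real_derivative
        apply_bcontfun (A (u t)) x - apply_bcontfun V x * apply_bcontfun (u t) x) (at t within {0..})"
    if "0 \<le> t" "x \<in> W" for t x
  proof (rule has_field_derivative_transform_within[OF _ zero_less_one])
    show "((\<lambda>t. v t x) has_real_derivative
        apply_bcontfun (A (u t)) x - apply_bcontfun V x * apply_bcontfun (u t) x) (at t within {0..})"
      using ode[OF that] that by (simp add: A(1) V u)
  qed (use that in \<open>auto simp: u\<close>)
  have u_norm: "norm (u t) \<le> M" if "0 \<le> t" for t
    by (rule norm_bound) (use v_bound[OF that] M that in \<open>auto simp: u\<close>)
  have fk: "v t x = c * (\<integral>\<omega>. exp (- (LBINT s. indicator {0<..t} s * (\<kappa> * w (X s \<omega>)))) \<partial>P x)" if t: "0 < t" for t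
  proof -
    have "apply_bcontfun (u t) x = c * (\<integral>\<omega>. exp (- (LBINT s. indicator {0<..t} s * apply_bcontfun V (X s \<omega>))) \<partial>P x)"
      by (rule feynman_kac[OF T A(2,3,4) disc closedW _ u_norm _ ode' P _ x t]) (use w \<kappa> init in \<open>auto simp: V u\<close>)
    then show ?thesis using t x by (simp add: u V)
  qed
  then show "0 < t \<Longrightarrow> v t x = c * (\<integral>\<omega>. exp (- (LBINT s. indicator {0<..t} s * (\<kappa> * w (X s \<omega>)))) \<partial>P x)" .
  have "((\<lambda>t. c * (\<integral>\<omega>. exp (- (LBINT s. indicator {0<..t} s * (\<kappa> * w (X s \<omega>)))) \<partial>P x)) \<longlongrightarrow>
      c * (\<integral>\<omega>. exp_neg (ennreal \<kappa> * (\<integral>\<^sup>+ s\<in>{0..}. ennreal (w (X s \<omega>)) \<partial>lborel)) \<partial>P x)) at_top"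
    by (intro tendsto_mult_left expected_occupation_weight_tendsto[OF T P disc w \<kappa>])
  then show "((\<lambda>t. v t x) \<longlongrightarrow> c * (\<integral>\<omega>. exp_neg (ennreal \<kappa> * (\<integral>\<^sup>+ s\<in>{0..}. ennreal (w (X s \<omega>)) \<partial>lborel)) \<partial>P x)) at_top"
    by (rule Lim_transform_eventually) (use fk in \<open>auto intro!: eventually_mono[OF eventually_gt_at_top[of 0]]\<close>)
qed

section \<open>Jump rates\<close>

lemma rates_bound:
  assumes "irreducible_symmetric_rates p"
  obtains C where "0 \<le> C" and "\<And>x. p x summable_on UNIV" and "\<And>x. (\<Sum>\<^sub>\<infinity>y. p x y) \<le> C"
proof -
  have "\<exists>C. \<forall>x. p x summable_on UNIV \<and> (\<Sum>\<^sub>\<infinity>y. p x y) \<le> C"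
    using assms unfolding irreducible_symmetric_rates_def by simp
  then obtain C where C: "\<And>x. p x summable_on UNIV" "\<And>x. (\<Sum>\<^sub>\<infinity>y. p x y) \<le> C"
    by blast
  have "0 \<le> (\<Sum>\<^sub>\<infinity>y. p undefined y)"
    using assms by (intro infsum_nonneg) (auto simp: irreducible_symmetric_rates_def)
  then have "0 \<le> C" using C(2)[of undefined] by linarith
  then show ?thesis using C that by blast
qed

lemma weighted_sum_summable:
  fixes q g :: "'i \<Rightarrow> real"
  assumes q: "\<And>y. 0 \<le> q y" "q summable_on S" and g: "\<And>y. y \<in> S \<Longrightarrow> \<bar>g y\<bar> \<le> b"
  shows "(\<lambda>y. q y * g y) summable_on S" and "\<bar>\<Sum>\<^sub>\<infinity>y\<in>S. q y * g y\<bar> \<le> (\<Sum>\<^sub>\<infinity>y\<in>S. q y) * b"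
proof -
  have le: "norm (q y * g y) \<le> q y * b" if "y \<in> S" for y
    using q(1)[of y] g[OF that] by (simp add: abs_mult mult_left_mono)
  have sb: "(\<lambda>y. q y * b) summable_on S" by (rule summable_on_cmult_left[OF q(2)])
  have abs: "(\<lambda>y. norm (q y * g y)) summable_on S"
    using le by (rule Infinite_Sum.abs_summable_on_comparison_test'[OF sb])
  then show "(\<lambda>y. q y * g y) summable_on S" by (rule abs_summable_summable)
  have "\<bar>\<Sum>\<^sub>\<infinity>y\<in>S. q y * g y\<bar> \<le> (\<Sum>\<^sub>\<infinity>y\<in>S. norm (q y * g y))"
    using norm_infsum_bound[OF abs] by simp
  also have "\<dots> \<le> (\<Sum>\<^sub>\<infinity>y\<in>S. q y * b)" by (rule infsum_mono[OF abs sb le])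
  also have "\<dots> = (\<Sum>\<^sub>\<infinity>y\<in>S. q y) * b" by (rule infsum_cmult_left[OF q(2)])
  finally show "\<bar>\<Sum>\<^sub>\<infinity>y\<in>S. q y * g y\<bar> \<le> (\<Sum>\<^sub>\<infinity>y\<in>S. q y) * b" .
qed

lemma weighted_sum_linear:
  fixes q g :: "'i \<Rightarrow> real"
  assumes q: "\<And>y. 0 \<le> q y" "q summable_on S" and f: "\<And>y. y \<in> S \<Longrightarrow> \<bar>f y\<bar> \<le> b" and g: "\<And>y. y \<in> S \<Longrightarrow> \<bar>g y\<bar> \<le> b"
  shows "(\<Sum>\<^sub>\<infinity>y\<in>S. q y * (f y + r * g y)) = (\<Sum>\<^sub>\<infinity>y\<in>S. q y * f y) + r * (\<Sum>\<^sub>\<infinity>y\<in>S. q y * g y)"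
proof -
  have "(\<Sum>\<^sub>\<infinity>y\<in>S. q y * (f y + r * g y)) = (\<Sum>\<^sub>\<infinity>y\<in>S. q y * f y + r * (q y * g y))"
    by (simp add: algebra_simps)
  also have "\<dots> = (\<Sum>\<^sub>\<infinity>y\<in>S. q y * f y) + (\<Sum>\<^sub>\<infinity>y\<in>S. r * (q y * g y))"
    by (intro infsum_add summable_on_cmult_right weighted_sum_summable(1)[OF q f] weighted_sum_summable(1)[OF q g])
  also have "(\<Sum>\<^sub>\<infinity>y\<in>S. r * (q y * g y)) = r * (\<Sum>\<^sub>\<infinity>y\<in>S. q y * g y)"
    by (rule infsum_cmult_right')
  finally show ?thesis .
qed

lemma weighted_sum_tendsto:
  fixes q :: "'i \<Rightarrow> real" and g :: "real \<Rightarrow> 'i \<Rightarrow> real"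
  assumes q: "\<And>y. 0 \<le> q y" "q summable_on UNIV" and g: "\<And>t y. 0 \<le> t \<Longrightarrow> \<bar>g t y\<bar> \<le> b"
    and lim: "\<And>y. ((\<lambda>t. g t y) \<longlongrightarrow> g' y) at_top"
  shows "((\<lambda>t. \<Sum>\<^sub>\<infinity>y. q y * g t y) \<longlongrightarrow> (\<Sum>\<^sub>\<infinity>y. q y * g' y)) at_top"
proof -
  have g': "\<bar>g' y\<bar> \<le> b" for y
    by (rule tendsto_upperbound[OF tendsto_rabs[OF lim[of y]]])
       (use g in \<open>auto intro!: eventually_mono[OF eventually_ge_at_top[of 0]]\<close>)
  have as: "Infinite_Set_Sum.abs_summable_on (\<lambda>y. q y * f y) UNIV" if "\<And>y. \<bar>f y\<bar> \<le> b" for f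
    unfolding abs_summable_equivalent[symmetric]
    by (rule Infinite_Sum.abs_summable_on_comparison_test'[OF summable_on_cmult_left[OF q(2), of b]])
       (use q(1) that in \<open>auto simp: abs_mult intro!: mult_left_mono\<close>)
  have eq: "(\<Sum>\<^sub>\<infinity>y. q y * f y) = (\<integral>y. q y * f y \<partial>count_space UNIV)" if "\<And>y. \<bar>f y\<bar> \<le> b" for f
    using infsetsum_infsum[OF as[OF that]] by (simp add: infsetsum_def)
  have "0 \<le> b" using g[of 0 undefined] by linarith
  have "((\<lambda>t. \<integral>y. q y * g t y \<partial>count_space UNIV) \<longlongrightarrow> (\<integral>y. q y * g' y \<partial>count_space UNIV)) at_top"
  proof (rule integral_dominated_convergence_at_top[where w = "\<lambda>y. q y * b"])
    show "integrable (count_space UNIV) (\<lambda>y. q y * b)"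
      using as[of "\<lambda>_. b"] \<open>0 \<le> b\<close> by (simp add: abs_summable_on_def)
    show "\<forall>\<^sub>F t in at_top. AE y in count_space UNIV. norm (q y * g t y) \<le> q y * b"
      by (rule eventually_mono[OF eventually_ge_at_top[of 0]]) (use q(1) g in \<open>auto simp: abs_mult intro!: mult_left_mono\<close>)
    show "AE y in count_space UNIV. ((\<lambda>t. q y * g t y) \<longlongrightarrow> q y * g' y) at_top"
      by (intro AE_I2 tendsto_mult_left lim)
  qed auto
  then have "((\<lambda>t. \<integral>y. q y * g t y \<partial>count_space UNIV) \<longlongrightarrow> (\<Sum>\<^sub>\<infinity>y. q y * g' y)) at_top"
    unfolding eq[OF g'] .
  then show ?thesis
    by (rule Lim_transform_eventually) (use eq g in \<open>auto intro!: eventually_mono[OF eventually_ge_at_top[of 0]]\<close>)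
qed

lemma rw_gen_bounded:
  fixes p :: "'a \<Rightarrow> 'a \<Rightarrow> real"
  assumes p: "irreducible_symmetric_rates p"
  obtains K where "bounded_on_functions K (rw_gen p)"
proof -
  obtain C where C: "0 \<le> C" "\<And>x. p x summable_on UNIV" "\<And>x. (\<Sum>\<^sub>\<infinity>y. p x y) \<le> C"
    by (rule rates_bound[OF p]) blast
  have pos: "0 \<le> p x y" for x y using p by (auto simp: irreducible_symmetric_rates_def)
  have dif: "\<bar>f y - f x\<bar> \<le> 2 * b" if "\<And>y. \<bar>f y\<bar> \<le> b" for f :: "'a \<Rightarrow> real" and b x y
    using that[of x] that[of y] by linarith
  show thesis
  proof (rule that[of "2 * C"], rule bounded_on_functionsI)
    fix f :: "'a \<Rightarrow> real" and b and x :: 'a assume f: "\<And>y. \<bar>f y\<bar> \<le> b"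
    have "\<bar>rw_gen p f x\<bar> \<le> (\<Sum>\<^sub>\<infinity>y. p x y) * (2 * b)"
      unfolding rw_gen_def by (rule weighted_sum_summable[OF pos C(2)]) (rule dif[OF f])
    also have "\<dots> \<le> C * (2 * b)" using f[of undefined] C by (intro mult_right_mono) auto
    finally show "\<bar>rw_gen p f x\<bar> \<le> 2 * C * b" by simp
  next
    fix f g :: "'a \<Rightarrow> real" and r b and x :: 'a assume f: "\<And>y. \<bar>f y\<bar> \<le> b" and g: "\<And>y. \<bar>g y\<bar> \<le> b"
    have "rw_gen p (\<lambda>y. f y + r * g y) x = (\<Sum>\<^sub>\<infinity>y. p x y * ((f y - f x) + r * (g y - g x)))"
      unfolding rw_gen_def by (simp add: algebra_simps)
    also have "\<dots> = rw_gen p f x + r * rw_gen p g x"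
      unfolding rw_gen_def by (rule weighted_sum_linear[OF pos C(2) dif[OF f] dif[OF g]])
    finally show "rw_gen p (\<lambda>y. f y + r * g y) x = rw_gen p f x + r * rw_gen p g x" .
  qed
qed

lemma sep2_gen_bounded:
  fixes p :: "'a \<Rightarrow> 'a \<Rightarrow> real"
  assumes p: "irreducible_symmetric_rates p"
  obtains K where "bounded_on_functions K (sep2_gen p)"
proof -
  obtain C where C: "0 \<le> C" "\<And>x. p x summable_on UNIV" "\<And>x. (\<Sum>\<^sub>\<infinity>y. p x y) \<le> C"
    by (rule rates_bound[OF p]) blast
  have pos: "0 \<le> p x y" for x y using p by (auto simp: irreducible_symmetric_rates_def)
  have dif: "\<bar>of_bool Q * (f y - f x)\<bar> \<le> 2 * b" if "\<And>y. \<bar>f y\<bar> \<le> b" for f :: "'a \<times> 'a \<Rightarrow> real" and b x y Q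
    using that[of x] that[of y] by (cases Q) auto
  show thesis
  proof (rule that[of "4 * C"], rule bounded_on_functionsI)
    fix f :: "'a \<times> 'a \<Rightarrow> real" and b and z :: "'a \<times> 'a" assume f: "\<And>y. \<bar>f y\<bar> \<le> b"
    obtain x y :: 'a where z: "z = (x, y)" by (rule prod.exhaust[of z])
    have "\<bar>\<Sum>\<^sub>\<infinity>v. p x v * (of_bool (v \<noteq> y) * (f (v, y) - f (x, y)))\<bar> \<le> (\<Sum>\<^sub>\<infinity>v. p x v) * (2 * b)"
      by (rule weighted_sum_summable[OF pos C(2)]) (rule dif[OF f])
    also have "\<dots> \<le> C * (2 * b)" using f[of undefined] C by (intro mult_right_mono) auto
    finally have 1: "\<bar>\<Sum>\<^sub>\<infinity>v. p x v * (of_bool (v \<noteq> y) * (f (v, y) - f (x, y)))\<bar> \<le> C * (2 * b)" .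
    have "\<bar>\<Sum>\<^sub>\<infinity>v. p y v * (of_bool (v \<noteq> x) * (f (x, v) - f (x, y)))\<bar> \<le> (\<Sum>\<^sub>\<infinity>v. p y v) * (2 * b)"
      by (rule weighted_sum_summable[OF pos C(2)]) (rule dif[OF f])
    also have "\<dots> \<le> C * (2 * b)" using f[of undefined] C by (intro mult_right_mono) auto
    finally have 2: "\<bar>\<Sum>\<^sub>\<infinity>v. p y v * (of_bool (v \<noteq> x) * (f (x, v) - f (x, y)))\<bar> \<le> C * (2 * b)" .
    show "\<bar>sep2_gen p f z\<bar> \<le> 4 * C * b"
      using 1 2 unfolding z sep2_gen_def prod.case mult.assoc by linarith
  next
    fix f g :: "'a \<times> 'a \<Rightarrow> real" and r b and z :: "'a \<times> 'a" assume f: "\<And>y. \<bar>f y\<bar> \<le> b" and g: "\<And>y. \<bar>g y\<bar> \<le> b"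
    obtain x y :: 'a where z: "z = (x, y)" by (rule prod.exhaust[of z])
    have 1: "(\<Sum>\<^sub>\<infinity>v. p x v * (of_bool (v \<noteq> y) * (f (v, y) - f (x, y)) + r * (of_bool (v \<noteq> y) * (g (v, y) - g (x, y)))))
       = (\<Sum>\<^sub>\<infinity>v. p x v * (of_bool (v \<noteq> y) * (f (v, y) - f (x, y)))) + r * (\<Sum>\<^sub>\<infinity>v. p x v * (of_bool (v \<noteq> y) * (g (v, y) - g (x, y))))"
      by (rule weighted_sum_linear[OF pos C(2) dif[OF f] dif[OF g]])
    have 2: "(\<Sum>\<^sub>\<infinity>v. p y v * (of_bool (v \<noteq> x) * (f (x, v) - f (x, y)) + r * (of_bool (v \<noteq> x) * (g (x, v) - g (x, y)))))
       = (\<Sum>\<^sub>\<infinity>v. p y v * (of_bool (v \<noteq> x) * (f (x, v) - f (x, y)))) + r * (\<Sum>\<^sub>\<infinity>v. p y v * (of_bool (v \<noteq> x) * (g (x, v) - g (x, y))))"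
      by (rule weighted_sum_linear[OF pos C(2) dif[OF f] dif[OF g]])
    have 3: "of_bool Q * (a + r * a' - (c + r * c')) = of_bool Q * (a - c) + r * (of_bool Q * (a' - c'))" for Q and a a' c c' :: real
      by (simp add: algebra_simps)
    show "sep2_gen p (\<lambda>y. f y + r * g y) z = sep2_gen p f z + r * sep2_gen p g z"
      unfolding z sep2_gen_def prod.case mult.assoc 3 1 2 by (simp add: algebra_simps)
  qed
qed

section \<open>Recurrence kills the walk\<close>

text \<open>Otherwise the function would change by about \<open>d\<close> over every late unit interval.\<close>

lemma convergent_derivative_limit_zero:
  fixes f f' :: "real \<Rightarrow> real"
  assumes der: "\<And>t. 0 \<le> t \<Longrightarrow> (f has_real_derivative f' t) (at t within {0..})"
    and f: "(f \<longlongrightarrow> l) at_top" and f': "(f' \<longlongrightarrow> d) at_top"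
  shows "d = 0"
proof (rule ccontr)
  assume "d \<noteq> 0"
  then have "0 < \<bar>d\<bar> / 2" by simp
  then have "\<forall>\<^sub>F t in at_top. dist (f' t) d < \<bar>d\<bar> / 2 \<and> dist (f t) l < \<bar>d\<bar> / 8 \<and> 0 \<le> t"
    using tendstoD[OF f', of "\<bar>d\<bar> / 2"] tendstoD[OF f, of "\<bar>d\<bar> / 8"] \<open>d \<noteq> 0\<close>
    by (intro eventually_conj eventually_ge_at_top) auto
  then obtain N where N: "\<And>t. N \<le> t \<Longrightarrow> dist (f' t) d < \<bar>d\<bar> / 2 \<and> dist (f t) l < \<bar>d\<bar> / 8 \<and> 0 \<le> t"
    unfolding eventually_at_top_linorder by blast
  have N0: "0 \<le> N" using N by blast
  have "\<bar>(f (N + 1) - d * 1) - (f (N + 0) - d * 0)\<bar> \<le> \<bar>d\<bar> / 2 * 1"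
  proof (rule derivative_bound_imp_increment_bound[of 1])
    fix u :: real assume u: "0 \<le> u" "u \<le> 1"
    have "(f has_real_derivative f' (N + u)) (at (N + u) within (\<lambda>u. N + u) ` {0..1})"
      by (rule DERIV_subset[OF der]) (use u N0 in auto)
    moreover have "((\<lambda>u. N + u) has_real_derivative 0 + 1) (at u within {0..1})"
      by (intro DERIV_add DERIV_const DERIV_ident)
    ultimately have "(f \<circ> (\<lambda>u. N + u) has_real_derivative f' (N + u) * (0 + 1)) (at u within {0..1})"
      by (rule DERIV_image_chain)
    then have "((\<lambda>u. f (N + u)) has_real_derivative f' (N + u)) (at u within {0..1})" by (simp add: o_def)
    then show "((\<lambda>u. f (N + u) - d * u) has_real_derivative f' (N + u) - d * 1) (at u within {0..1})"
      by (intro DERIV_diff DERIV_cmult DERIV_ident)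
    show "\<bar>f' (N + u) - d * 1\<bar> \<le> \<bar>d\<bar> / 2" using N[of "N + u"] u by (simp add: dist_real_def)
  qed simp
  moreover have "\<bar>f (N + 1) - l\<bar> < \<bar>d\<bar> / 8" "\<bar>f N - l\<bar> < \<bar>d\<bar> / 8"
    using N[of N] N[of "N + 1"] by (auto simp: dist_real_def)
  ultimately show False using \<open>d \<noteq> 0\<close> by (simp add: abs_if split: if_splits)
qed

text \<open>First-hit decomposition along the grid: once at \<open>a\<close>, the walk is still at \<open>a\<close> with probability at
  least \<open>c\<close> at the end of the unit interval.\<close>

lemma grid_hit_bound:
  fixes T :: "real \<Rightarrow> ('s::topological_space \<Rightarrow>\<^sub>C real) \<Rightarrow> ('s \<Rightarrow>\<^sub>C real)"
  assumes T: "markov_semigroup T"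
    and e: "\<And>x. apply_bcontfun e x = of_bool (x = a)" and f: "\<And>x. apply_bcontfun f x = 1 - of_bool (x = a)"
    and stay: "\<And>t. 0 \<le> t \<Longrightarrow> t \<le> 1 \<Longrightarrow> c \<le> apply_bcontfun (T t e) a"
    and h: "0 \<le> h" and n: "real n * h \<le> 1"
  shows "c * (1 - apply_bcontfun ((weighted_step (T h) f ^^ n) (const_bcontfun 1)) x) \<le> apply_bcontfun (T (real n * h) e) x"
  using n
proof (induction n arbitrary: x)
  case 0
  then show ?case using e by (simp add: semigroup_0[OF T])
next
  case (Suc n)
  let ?g = "(weighted_step (T h) f ^^ n) (const_bcontfun 1)"
  have n: "real n * h \<le> 1" using Suc.prems h by (simp add: algebra_simps)
  have "c *\<^sub>R (const_bcontfun 1 - weighted_step (T h) f ?g) = T h (c *\<^sub>R (const_bcontfun 1 - bmult f ?g))"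
    using semigroup_linear[OF T h] semigroup_one[OF T h] by (simp add: linear_scale linear_diff weighted_step_def)
  moreover have "c * (1 - apply_bcontfun (weighted_step (T h) f ?g) x) = apply_bcontfun (c *\<^sub>R (const_bcontfun 1 - weighted_step (T h) f ?g)) x"
    by simp
  ultimately have "c * (1 - apply_bcontfun (weighted_step (T h) f ?g) x) = apply_bcontfun (T h (c *\<^sub>R (const_bcontfun 1 - bmult f ?g))) x"
    by (simp only:)
  also have "\<dots> \<le> apply_bcontfun (T h (T (real n * h) e)) x"
  proof (rule semigroup_mono[OF T h])
    fix y
    show "apply_bcontfun (c *\<^sub>R (const_bcontfun 1 - bmult f ?g)) y \<le> apply_bcontfun (T (real n * h) e) y"
      using Suc.IH[OF n, of y] stay[of "real n * h"] n h by (cases "y = a") (auto simp: f)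
  qed
  also have "T h (T (real n * h) e) = T (real (Suc n) * h) e"
    using semigroup_add[OF T h, of "real n * h" e] h by (simp add: algebra_simps)
  finally show ?case by simp
qed

text \<open>A visit lasts for a while to the right, so it is seen on every grid with a point there. Dyadic grids are
  nested, which makes the events of a visit seen on the grid increasing.\<close>

lemma dyadic_grid_point:
  fixes s \<epsilon> :: real
  assumes "real k \<le> s" "s < real k + 1" "0 < \<epsilon>"
  obtains m i where "1 \<le> i" "i \<le> 2 ^ m" "s < real k + real i / 2 ^ m" "real k + real i / 2 ^ m < s + \<epsilon>"
proof -
  obtain m where "(1 / 2 :: real) ^ m < \<epsilon>" using real_arch_pow_inv[OF assms(3), of "1/2"] by auto
  then have m: "1 / 2 ^ m < \<epsilon>" by (simp add: power_divide)
  define i where "i = nat (\<lfloor>(s - real k) * 2 ^ m\<rfloor> + 1)"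
  have fl0: "0 \<le> \<lfloor>(s - real k) * 2 ^ m\<rfloor>" using assms by simp
  then have i: "real i = of_int \<lfloor>(s - real k) * 2 ^ m\<rfloor> + 1" by (simp add: i_def)
  have "(s - real k) * 2 ^ m < 1 * 2 ^ m" using assms by (intro mult_strict_right_mono) auto
  then have "\<lfloor>(s - real k) * 2 ^ m\<rfloor> < 2 ^ m" by (simp add: floor_less_iff)
  then have "\<lfloor>(s - real k) * 2 ^ m\<rfloor> + 1 \<le> 2 ^ m" by linarith
  then have "nat (\<lfloor>(s - real k) * 2 ^ m\<rfloor> + 1) \<le> nat (2 ^ m)" by (rule nat_mono)
  then have i2: "i \<le> 2 ^ m" by (simp add: i_def nat_power_eq)
  have lo: "(s - real k) * 2 ^ m < real i" and hi: "real i \<le> (s - real k) * 2 ^ m + 1"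
    unfolding i by linarith+
  show thesis
  proof (rule that[of i m])
    show "1 \<le> i" using fl0 by (simp add: i_def le_nat_iff)
    show "s < real k + real i / 2 ^ m" using lo by (simp add: field_simps)
    have "real i / 2 ^ m \<le> ((s - real k) * 2 ^ m + 1) / 2 ^ m" using hi by (intro divide_right_mono) auto
    also have "\<dots> = s - real k + 1 / 2 ^ m" by (simp add: add_divide_distrib)
    finally show "real k + real i / 2 ^ m < s + \<epsilon>" using m by linarith
  qed (rule i2)
qed

text \<open>Visits in the unit interval after \<open>k\<close> have probability at most \<open>T (k + 1) e x / c\<close>, so summability
  of the latter leaves only finitely many visited unit intervals by the Borel--Cantelli lemma.\<close>

lemma summable_imp_bounded_visits:
  fixes T :: "real \<Rightarrow> ('s::topological_space \<Rightarrow>\<^sub>C real) \<Rightarrow> ('s \<Rightarrow>\<^sub>C real)" and P :: "'s \<Rightarrow> 'w measure"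
  assumes disc: "\<And>B :: 's set. open B" and T: "markov_semigroup T" and P: "markov_process T P X"
    and e: "\<And>x. apply_bcontfun e x = of_bool (x = a)"
    and stay: "\<And>t. 0 \<le> t \<Longrightarrow> t \<le> 1 \<Longrightarrow> c \<le> apply_bcontfun (T t e) a" and c: "0 < c"
    and sum: "summable (\<lambda>k. apply_bcontfun (T (real k) e) x)"
  shows "AE \<omega> in P x. bdd_above {t. 0 \<le> t \<and> X t \<omega> = a}"
proof -
  interpret prob_space "P x" by (rule process_prob_space[OF T P])
  define f where "f = const_bcontfun 1 - e"
  have f: "apply_bcontfun f y = 1 - of_bool (y = a)" for y by (simp add: f_def e)
  define R where "R k m = {\<omega> \<in> space (P x). \<exists>i\<in>{1..2 ^ m}. X (real k + real i * (1 / 2 ^ m)) \<omega> = a}" for k m :: nat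
  have Rprod: "indicator (R k m) \<omega> = 1 - (\<Prod>i\<in>{1..2 ^ m}. apply_bcontfun f (X (real k + real i * (1 / 2 ^ m)) \<omega>))"
    if "\<omega> \<in> space (P x)" for k m \<omega>
  proof (cases "\<omega> \<in> R k m")
    case True
    then have "(\<Prod>i\<in>{1..2 ^ m}. apply_bcontfun f (X (real k + real i * (1 / 2 ^ m)) \<omega>)) = 0"
      unfolding R_def by (intro prod_zero) (auto simp: f)
    then show ?thesis using True by simp
  next
    case False
    then have "(\<Prod>i\<in>{1..2 ^ m}. apply_bcontfun f (X (real k + real i * (1 / 2 ^ m)) \<omega>)) = 1"
      using that unfolding R_def by (intro prod.neutral) (auto simp: f)
    then show ?thesis using False by simp
  qed
  have Rm: "R k m \<in> sets (P x)" for k m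
  proof -
    have "R k m = (\<Union>i\<in>{1..2 ^ m}. X (real k + real i * (1 / 2 ^ m)) -` {a} \<inter> space (P x))"
      unfolding R_def by auto
    also have "\<dots> \<in> sets (P x)"
      by (intro sets.finite_UN measurable_sets[OF process_measurable[OF T P]]) (auto simp: borel_open disc)
    finally show ?thesis .
  qed
  have Rp: "c * prob (R k m) \<le> apply_bcontfun (T (real (Suc k)) e) x" for k m
  proof -
    let ?h = "1 / 2 ^ m :: real"
    let ?g = "(weighted_step (T ?h) f ^^ (2 ^ m)) (const_bcontfun 1)"
    have fle: "\<bar>apply_bcontfun f y\<bar> \<le> 1" for y by (simp add: f)
    have "prob (R k m) = (\<integral>\<omega>. indicator (R k m) \<omega> \<partial>P x)" using Rm by simp
    also have "\<dots> = (\<integral>\<omega>. 1 - (\<Prod>i\<in>{1..2 ^ m}. apply_bcontfun f (X (real k + real i * ?h) \<omega>)) \<partial>P x)"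
      by (rule Bochner_Integration.integral_cong[OF refl]) (rule Rprod)
    also have "\<dots> = 1 - (\<integral>\<omega>. (\<Prod>i\<in>{1..2 ^ m}. apply_bcontfun f (X (real k + real i * ?h) \<omega>)) \<partial>P x)"
    proof (subst Bochner_Integration.integral_diff)
      show "integrable (P x) (\<lambda>\<omega>. \<Prod>i\<in>{1..2 ^ m}. apply_bcontfun f (X (real k + real i * ?h) \<omega>))"
      proof (rule integrable_const_bound[where B = 1])
        show "AE \<omega> in P x. norm (\<Prod>i\<in>{1..2 ^ m}. apply_bcontfun f (X (real k + real i * ?h) \<omega>)) \<le> 1"
          by (intro AE_I2) (auto simp: abs_prod intro!: prod_le_1 fle)
        show "(\<lambda>\<omega>. \<Prod>i\<in>{1..2 ^ m}. apply_bcontfun f (X (real k + real i * ?h) \<omega>)) \<in> borel_measurable (P x)"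
          by (intro borel_measurable_prod process_fun_measurable[OF T P]) auto
      qed
    qed (auto simp: prob_space)
    also have "(\<integral>\<omega>. (\<Prod>i\<in>{1..2 ^ m}. apply_bcontfun f (X (real k + real i * ?h) \<omega>)) \<partial>P x) = apply_bcontfun (T (real k) ?g) x"
      using expectation_prod_eq_weighted_steps[OF T P, where s = "real k" and h = ?h and n = "2 ^ m" and f = f and g = "const_bcontfun 1" and x = x] by simp
    finally have "c * prob (R k m) = c * (1 - apply_bcontfun (T (real k) ?g) x)" by simp
    also have "\<dots> = apply_bcontfun (T (real k) (c *\<^sub>R (const_bcontfun 1 - ?g))) x"
      using semigroup_linear[OF T, of "real k"] semigroup_one[OF T, of "real k"] by (simp add: linear_scale linear_diff)
    also have "\<dots> \<le> apply_bcontfun (T (real k) (T 1 e)) x"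
    proof (rule semigroup_mono[OF T])
      fix y
      show "apply_bcontfun (c *\<^sub>R (const_bcontfun 1 - ?g)) y \<le> apply_bcontfun (T 1 e) y"
        using grid_hit_bound[OF T e f stay, of ?h "2 ^ m" y] by simp
    qed simp
    also have "T (real k) (T 1 e) = T (real (Suc k)) e"
      using semigroup_add[OF T, of "real k" 1 e] by (simp add: add.commute)
    finally show ?thesis .
  qed
  define H where "H k = (\<Union>m. R k m)" for k
  have Hm: "H k \<in> sets (P x)" for k unfolding H_def using Rm by auto
  have "incseq (R k)" for k
  proof (rule incseq_SucI, rule subsetI)
    fix m \<omega> assume "\<omega> \<in> R k m"
    then obtain i where i: "\<omega> \<in> space (P x)" "i \<in> {1..2 ^ m}" "X (real k + real i * (1 / 2 ^ m)) \<omega> = a"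
      unfolding R_def by auto
    then have "2 * i \<in> {1..2 ^ Suc m}" "X (real k + real (2 * i) * (1 / 2 ^ Suc m)) \<omega> = a" by auto
    then show "\<omega> \<in> R k (Suc m)" unfolding R_def using i(1) by blast
  qed
  then have lim: "(\<lambda>m. prob (R k m)) \<longlonglongrightarrow> prob (H k)" for k
    unfolding H_def using Rm by (intro finite_Lim_measure_incseq) auto
  have Hp: "prob (H k) \<le> (1 / c) * apply_bcontfun (T (real (Suc k)) e) x" for k
    by (rule LIMSEQ_le_const2[OF lim]) (use Rp c in \<open>auto simp: field_simps simp del: of_nat_Suc\<close>)
  have "summable (\<lambda>k. prob (H k))"
  proof (rule summable_comparison_test)
    show "summable (\<lambda>k. (1 / c) * apply_bcontfun (T (real (Suc k)) e) x)"
      using sum by (intro summable_mult) (subst summable_Suc_iff)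
    show "\<exists>N. \<forall>k\<ge>N. norm (prob (H k)) \<le> (1 / c) * apply_bcontfun (T (real (Suc k)) e) x"
      using Hp by (simp only: real_norm_def abs_of_nonneg measure_nonneg) blast
  qed
  then have "AE \<omega> in P x. eventually (\<lambda>k. \<omega> \<in> space (P x) - H k) sequentially"
    by (intro borel_cantelli_AE1 Hm) (auto simp: less_top[symmetric])
  then show ?thesis
  proof (rule AE_mp, intro AE_I2 impI)
    fix \<omega> assume \<omega>: "\<omega> \<in> space (P x)" and "eventually (\<lambda>k. \<omega> \<in> space (P x) - H k) sequentially"
    then obtain N where N: "\<And>k. N \<le> k \<Longrightarrow> \<omega> \<notin> H k" by (auto simp: eventually_sequentially)
    show "bdd_above {t. 0 \<le> t \<and> X t \<omega> = a}"
    proof (rule bdd_aboveI[where M = "real N"], rule ccontr)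
      fix s assume s: "s \<in> {t. 0 \<le> t \<and> X t \<omega> = a}" and "\<not> s \<le> real N"
      define k where "k = nat \<lfloor>s\<rfloor>"
      have k: "real k \<le> s" "s < real k + 1" "N \<le> k"
        using s \<open>\<not> s \<le> real N\<close> by (auto simp: k_def le_nat_iff le_floor_iff)
      obtain b where b: "s < b" "\<And>u. s < u \<Longrightarrow> u < b \<Longrightarrow> X u \<omega> = X s \<omega>"
        using process_eventually_stays[OF T P disc \<omega>, of s] s
        unfolding eventually_at_right[OF less_add_one[of s]] by auto
      obtain m i where mi: "1 \<le> i" "i \<le> 2 ^ m" "s < real k + real i / 2 ^ m" "real k + real i / 2 ^ m < s + (b - s)"
        by (rule dyadic_grid_point[OF k(1,2), of "b - s"]) (use b(1) in simp, rule that)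
      then have "X (real k + real i * (1 / 2 ^ m)) \<omega> = a" using b(2)[of "real k + real i / 2 ^ m"] s by simp
      then have "\<omega> \<in> R k m" unfolding R_def using \<omega> mi(1,2) by auto
      then have "\<omega> \<in> H k" unfolding H_def by blast
      then show False using N k(3) by blast
    qed
  qed
qed

text \<open>The limit \<open>h\<close> of the survival probabilities satisfies \<open>L h = \<kappa> h(a) 1\<^sub>a\<close>. If \<open>h(a) > 0\<close>, then
  \<open>T\<^sub>1 h - h\<close> dominates a multiple of \<open>1\<^sub>a\<close>; summing its shifts, the expected number of integer times spent
  at \<open>a\<close> is finite, which recurrence excludes. So \<open>h\<close> vanishes at \<open>a\<close>, and being harmonic and nonnegative it
  vanishes at every site that can be reached from \<open>a\<close>.\<close>

theorem recurrent_imp_killed: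
  fixes p :: "'v::discrete_topology \<Rightarrow> 'v \<Rightarrow> real" and P :: "'v \<Rightarrow> 'w measure" and \<phi> :: "real \<Rightarrow> 'v \<Rightarrow> real"
  assumes p: "irreducible_symmetric_rates p"
    and proc: "process_with_generator UNIV (rw_gen p) T P X" and rec: "recurrent P X"
    and \<kappa>: "0 < \<kappa>" and bd: "\<And>t x. 0 \<le> t \<Longrightarrow> \<bar>\<phi> t x\<bar> \<le> 1" and init: "\<And>x. \<phi> 0 x = 1"
    and ode: "\<And>t x. 0 \<le> t \<Longrightarrow> ((\<lambda>t. \<phi> t x) has_real_derivative
        rw_gen p (\<phi> t) x - \<kappa> * of_bool (x = a) * \<phi> t x) (at t within {0..})"
  shows "((\<lambda>t. \<phi> t x) \<longlongrightarrow> 0) at_top"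
proof -
  have disc: "open B" for B :: "'v set" by (rule discrete_topology_class.open_discrete)
  have T: "markov_semigroup T" and P: "markov_process T P X"
    using proc by (auto simp: process_with_generator_def)
  have pos: "0 \<le> p x y" for x y using p by (auto simp: irreducible_symmetric_rates_def)
  obtain C where C: "0 \<le> C" "\<And>x. p x summable_on UNIV" "\<And>x. (\<Sum>\<^sub>\<infinity>y. p x y) \<le> C"
    by (rule rates_bound[OF p]) blast
  obtain K where K: "bounded_on_functions K (rw_gen p)"
    by (rule rw_gen_bounded[OF p])
  obtain A where A: "\<And>f. apply_bcontfun (A f) = rw_gen p (apply_bcontfun f)" "\<And>f. (f, A f) \<in> generator T"
    by (rule bounded_generator[OF disc proc K], rule that)
  define h where "h x = (\<integral>\<omega>. exp_neg (ennreal \<kappa> * (\<integral>\<^sup>+ s\<in>{0..}. ennreal (of_bool (X s \<omega> = a)) \<partial>lborel)) \<partial>P x)" for x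
  have lim: "((\<lambda>t. \<phi> t x) \<longlongrightarrow> h x) at_top" for x
  proof -
    have "((\<lambda>t. \<phi> t x) \<longlongrightarrow> 1 * (\<integral>\<omega>. exp_neg (ennreal \<kappa> * (\<integral>\<^sup>+ s\<in>{0..}. ennreal (of_bool (X s \<omega> = a)) \<partial>lborel)) \<partial>P x)) at_top"
    proof (rule feynman_kac_limit(2)[OF disc proc K, where W = UNIV and B = 1 and M = 1])
      show "rw_gen p (indicator (- UNIV)) x \<le> 0" for x by (simp add: rw_gen_def)
    qed (use \<kappa> bd init ode in auto)
    then show ?thesis by (simp add: h_def)
  qed
  have h0: "0 \<le> h x" for x unfolding h_def by (intro Bochner_Integration.integral_nonneg exp_neg_nonneg)
  have h1: "h x \<le> 1" for x
    by (rule tendsto_upperbound[OF lim]) (use bd in \<open>auto simp: abs_le_iff intro!: eventually_mono[OF eventually_ge_at_top[of 0]]\<close>)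
  have Lh: "rw_gen p h x = \<kappa> * of_bool (x = a) * h x" for x
  proof -
    have "((\<lambda>t. rw_gen p (\<phi> t) x) \<longlongrightarrow> rw_gen p h x) at_top"
      unfolding rw_gen_def
    proof (rule weighted_sum_tendsto[OF pos C(2), where b = 2])
      fix t :: real and y assume "0 \<le> t"
      then show "\<bar>\<phi> t y - \<phi> t x\<bar> \<le> 2" using bd[of t y] bd[of t x] by linarith
    qed (intro tendsto_diff lim)
    then have "((\<lambda>t. rw_gen p (\<phi> t) x - \<kappa> * of_bool (x = a) * \<phi> t x) \<longlongrightarrow> rw_gen p h x - \<kappa> * of_bool (x = a) * h x) at_top"
      by (intro tendsto_diff tendsto_mult_left lim)
    from convergent_derivative_limit_zero[OF ode lim this] show ?thesis by simp
  qed
  have "h a = 0"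
  proof (rule ccontr)
    assume "h a \<noteq> 0"
    then have ha: "0 < h a" using h0[of a] by linarith
    define hb where "hb = Bcontfun h"
    have hb: "apply_bcontfun hb = h"
      unfolding hb_def by (rule apply_bcontfun_Bcontfun_discrete[OF disc, of _ 1]) (use h0 h1 in auto)
    define e where "e = Bcontfun (\<lambda>x. of_bool (x = a) :: real)"
    have e: "apply_bcontfun e x = of_bool (x = a)" for x
      unfolding e_def by (subst apply_bcontfun_Bcontfun_discrete[OF disc, of _ 1]) auto
    have Ahb: "A hb = (\<kappa> * h a) *\<^sub>R e"
      by (rule bcontfun_eqI) (auto simp: A(1) hb Lh e)
    have Ae: "- \<bar>K\<bar> * apply_bcontfun e x \<le> apply_bcontfun (A e) x" for x
    proof (cases "x = a")
      case True
      have "\<bar>rw_gen p (apply_bcontfun e) x\<bar> \<le> K * 1" by (rule bounded_on_functionsD(1)[OF K]) (simp add: e)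
      then show ?thesis using True by (simp add: A(1) e)
    next
      case False
      have "0 \<le> rw_gen p (apply_bcontfun e) x"
        unfolding rw_gen_def using False pos by (intro infsum_nonneg) (simp add: e)
      then show ?thesis using False by (simp add: A(1) e)
    qed
    have Tder: "((\<lambda>t. apply_bcontfun (T t f) x) has_real_derivative apply_bcontfun (T u (A f)) x) (at u within {0..r})"
      if "0 \<le> u" for u r f x
      by (rule DERIV_subset[OF semigroup_has_derivative_at[OF T A(2) that]]) auto
    have stay: "exp (- \<bar>K\<bar>) \<le> apply_bcontfun (T t e) a" if t: "0 \<le> t" "t \<le> 1" for t
    proof -
      have "exp (\<bar>K\<bar> * 0) * apply_bcontfun (T 0 e) a \<le> exp (\<bar>K\<bar> * t) * apply_bcontfun (T t e) a"
      proof (rule has_derivative_nonneg_imp_le[OF t(1)])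
        fix u assume u: "0 \<le> u" "u \<le> t"
        have "((\<lambda>u. exp (\<bar>K\<bar> * u)) has_real_derivative exp (\<bar>K\<bar> * u) * \<bar>K\<bar>) (at u within {0..t})"
          by (auto intro!: derivative_eq_intros)
        from DERIV_mult[OF this Tder[OF u(1), of e a t]]
        show "((\<lambda>u. exp (\<bar>K\<bar> * u) * apply_bcontfun (T u e) a) has_real_derivative
          exp (\<bar>K\<bar> * u) * (\<bar>K\<bar> * apply_bcontfun (T u e) a + apply_bcontfun (T u (A e)) a)) (at u within {0..t})"
          by (simp add: algebra_simps)
        have "apply_bcontfun (T u ((- \<bar>K\<bar>) *\<^sub>R e)) a \<le> apply_bcontfun (T u (A e)) a"
          by (rule semigroup_mono[OF T u(1)]) (use Ae in simp)
        then have "- \<bar>K\<bar> * apply_bcontfun (T u e) a \<le> apply_bcontfun (T u (A e)) a"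
          by (simp only: linear_scale[OF semigroup_linear[OF T u(1)]] scaleR_bcontfun.rep_eq real_scaleR_def)
        then show "0 \<le> exp (\<bar>K\<bar> * u) * (\<bar>K\<bar> * apply_bcontfun (T u e) a + apply_bcontfun (T u (A e)) a)"
          by (intro mult_nonneg_nonneg) auto
      qed
      then have "1 \<le> exp (\<bar>K\<bar> * t) * apply_bcontfun (T t e) a" by (simp add: semigroup_0[OF T] e)
      also have "\<dots> \<le> exp \<bar>K\<bar> * apply_bcontfun (T t e) a"
        using t semigroup_pos[OF T t(1), of e a] by (intro mult_right_mono) (auto simp: e mult_left_le)
      finally show ?thesis by (simp add: exp_minus field_simps)
    qed
    define \<delta> where "\<delta> = \<kappa> * h a * exp (- \<bar>K\<bar>)"
    have \<delta>: "0 < \<delta>" using \<kappa> ha by (simp add: \<delta>_def)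
    have step: "apply_bcontfun (\<delta> *\<^sub>R e) y \<le> apply_bcontfun (T 1 hb - hb) y" for y
    proof -
      have "apply_bcontfun (T 0 hb) y - \<delta> * of_bool (y = a) * 0 \<le> apply_bcontfun (T 1 hb) y - \<delta> * of_bool (y = a) * 1"
      proof (rule has_derivative_nonneg_imp_le[of 0 1 "\<lambda>u. apply_bcontfun (T u hb) y - \<delta> * of_bool (y = a) * u"])
        fix u :: real assume u: "0 \<le> u" "u \<le> 1"
        show "((\<lambda>u. apply_bcontfun (T u hb) y - \<delta> * of_bool (y = a) * u) has_real_derivative
          apply_bcontfun (T u (A hb)) y - \<delta> * of_bool (y = a) * 1) (at u within {0..1})"
          by (intro DERIV_diff Tder u DERIV_cmult DERIV_ident)
        have eq: "apply_bcontfun (T u (A hb)) y = \<kappa> * h a * apply_bcontfun (T u e) y"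
          unfolding Ahb by (simp add: linear_scale[OF semigroup_linear[OF T u(1)]])
        have "exp (- \<bar>K\<bar>) * of_bool (y = a) \<le> apply_bcontfun (T u e) y"
          using stay[OF u] semigroup_pos[OF T u(1), of e y] by (cases "y = a") (auto simp: e)
        then have "\<kappa> * h a * (exp (- \<bar>K\<bar>) * of_bool (y = a)) \<le> \<kappa> * h a * apply_bcontfun (T u e) y"
          using \<kappa> ha by (intro mult_left_mono) auto
        then show "0 \<le> apply_bcontfun (T u (A hb)) y - \<delta> * of_bool (y = a) * 1"
          unfolding eq \<delta>_def by (simp add: mult.assoc)
      qed simp
      then show ?thesis by (simp add: semigroup_0[OF T] e)
    qed
    have "summable (\<lambda>k. apply_bcontfun (T (real k) e) a)"
    proof (rule summableI_nonneg_bounded[where x = "1 / \<delta>"])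
      show "0 \<le> apply_bcontfun (T (real k) e) a" for k by (rule semigroup_pos[OF T]) (auto simp: e)
      show "(\<Sum>k<n. apply_bcontfun (T (real k) e) a) \<le> 1 / \<delta>" for n
      proof -
        have "\<delta> * apply_bcontfun (T (real k) e) a \<le> apply_bcontfun (T (real (Suc k)) hb) a - apply_bcontfun (T (real k) hb) a" for k
        proof -
          have "apply_bcontfun (T (real k) (\<delta> *\<^sub>R e)) a \<le> apply_bcontfun (T (real k) (T 1 hb - hb)) a"
            by (rule semigroup_mono[OF T _ step]) simp
          moreover have "T (real k) (T 1 hb) = T (real (Suc k)) hb"
            using semigroup_add[OF T, of "real k" 1 hb] by (simp add: add.commute)
          ultimately show ?thesis
            using semigroup_linear[OF T, of "real k"] by (simp add: linear_scale linear_diff)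
        qed
        then have "(\<Sum>k<n. \<delta> * apply_bcontfun (T (real k) e) a) \<le> (\<Sum>k<n. apply_bcontfun (T (real (Suc k)) hb) a - apply_bcontfun (T (real k) hb) a)"
          by (rule sum_mono)
        also have "\<dots> = apply_bcontfun (T (real n) hb) a - apply_bcontfun (T (real 0) hb) a"
          by (rule sum_lessThan_telescope)
        also have "\<dots> \<le> 1"
        proof -
          have "\<bar>apply_bcontfun (T (real n) hb) a\<bar> \<le> 1"
            by (rule semigroup_abs_le[OF T]) (use h0 h1 in \<open>simp_all add: hb\<close>)
          then have "apply_bcontfun (T (real n) hb) a - h a \<le> 1" using h0[of a] by linarith
          then show ?thesis by (simp add: semigroup_0[OF T] hb)
        qed
        finally show ?thesis using \<delta> by (simp add: sum_distrib_left[symmetric] field_simps)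
      qed
    qed
    then have "AE \<omega> in P a. bdd_above {t. 0 \<le> t \<and> X t \<omega> = a}"
      by (intro summable_imp_bounded_visits[OF disc T P e stay]) auto
    moreover have "AE \<omega> in P a. \<not> bdd_above {t. 0 \<le> t \<and> X t \<omega> = a}"
      using rec by (auto simp: recurrent_def)
    ultimately have "AE \<omega> in P a. False" by eventually_elim simp
    then show False using prob_space.AE_False[OF process_prob_space[OF T P]] by simp
  qed
  have spread: "h y = 0" if "h x = 0" "0 < rate_power p n x y" for n x y
    using that
  proof (induction n arbitrary: x)
    case 0
    then show ?case by (simp split: if_splits)
  next
    case (Suc n)
    have rp: "0 \<le> rate_power p m z w" for m z w
      by (induction m arbitrary: z) (auto intro!: infsum_nonneg mult_nonneg_nonneg pos)
    have "\<exists>z. p x z * rate_power p n z y \<noteq> 0"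
    proof (rule ccontr)
      assume "\<nexists>z. p x z * rate_power p n z y \<noteq> 0"
      then have "(\<Sum>\<^sub>\<infinity>z. p x z * rate_power p n z y) = 0" by (intro infsum_0) blast
      then show False using Suc.prems(2) by simp
    qed
    then obtain z where z: "p x z \<noteq> 0" "rate_power p n z y \<noteq> 0" by auto
    have "(\<Sum>\<^sub>\<infinity>y. p x y * h y) = 0"
      using Lh[of x] Suc.prems(1) by (simp add: rw_gen_def)
    moreover have "(\<Sum>y\<in>{z}. p x y * h y) \<le> (\<Sum>\<^sub>\<infinity>y. p x y * h y)"
      by (rule finite_sum_le_infsum) (use weighted_sum_summable(1)[OF pos C(2), of h 1] h0 h1 pos in auto)
    ultimately have "p x z * h z \<le> 0" by simp
    then have "h z = 0" using z(1) pos[of x z] h0[of z] by (simp add: mult_le_0_iff)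
    then show ?case using Suc.IH[of z] z(2) rp[of n z y] by simp
  qed
  have "\<exists>n\<ge>1. 0 < rate_power p n a x" using p by (simp add: irreducible_symmetric_rates_def)
  then have "h x = 0" using spread[OF \<open>h a = 0\<close>] by blast
  then show ?thesis using lim[of x] by simp
qed

section \<open>Measures on the configuration space\<close>

lemma compact_configs: "compact (UNIV :: 'v config set)"
proof -
  have "compact_space (product_topology (\<lambda>_::'v. euclidean :: bool topology) UNIV)"
    unfolding compact_space_product_topology
    using finite_imp_compact[of "UNIV :: bool set"] by (auto simp: compact_space_def)
  then have "compact_space (euclidean :: 'v config topology)" by (simp only: euclidean_product_topology)
  then show ?thesis by (simp add: compact_space_def)
qed

lemma open_agreeing: "finite A \<Longrightarrow> open {\<eta> :: 'v config. \<forall>x\<in>A. \<eta> x = \<xi> x}"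
proof -
  assume A: "finite A"
  have "open {\<eta> :: 'v config. \<eta> x = \<xi> x}" for x
  proof -
    have "open ((\<lambda>\<eta> :: 'v config. \<eta> x) -` {\<xi> x})"
      by (rule open_vimage[OF discrete_topology_class.open_discrete continuous_on_product_coordinates])
    then show ?thesis by (simp add: vimage_def)
  qed
  then have "open (\<Inter>x\<in>A. {\<eta> :: 'v config. \<eta> x = \<xi> x})" using A by (intro open_INT) auto
  moreover have "(\<Inter>x\<in>A. {\<eta> :: 'v config. \<eta> x = \<xi> x}) = {\<eta>. \<forall>x\<in>A. \<eta> x = \<xi> x}" by auto
  ultimately show ?thesis by simp
qed

lemma open_contains_agreeing:
  fixes U :: "'v config set"
  assumes "open U" "\<xi> \<in> U"
  obtains A where "finite A" "{\<eta>. \<forall>x\<in>A. \<eta> x = \<xi> x} \<subseteq> U"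
proof -
  have "openin (product_topology (\<lambda>_. euclidean) UNIV) U" using assms(1) by (simp add: open_fun_def)
  from product_topology_open_contains_basis[OF this assms(2)]
  obtain B where B: "\<xi> \<in> (\<Pi>\<^sub>E i\<in>UNIV. B i)" "finite {i. B i \<noteq> UNIV}" "(\<Pi>\<^sub>E i\<in>UNIV. B i) \<subseteq> U"
    by auto
  show thesis
  proof (rule that[OF B(2)])
    show "{\<eta>. \<forall>x\<in>{i. B i \<noteq> UNIV}. \<eta> x = \<xi> x} \<subseteq> U"
    proof
      fix \<eta> assume \<eta>: "\<eta> \<in> {\<eta>. \<forall>x\<in>{i. B i \<noteq> UNIV}. \<eta> x = \<xi> x}"
      have "\<eta> i \<in> B i" for i using \<eta> B(1) by (cases "B i = UNIV") auto
      then show "\<eta> \<in> U" using B(3) by auto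
    qed
  qed
qed

text \<open>By compactness finitely many cylinders suffice on which \<open>f\<close> varies little. Switching off all sites outside
  their coordinates then changes \<open>f\<close> only little and makes it local.\<close>

lemma closure_local_functions: "closure (local_functions :: ('v config \<Rightarrow>\<^sub>C real) set) = UNIV"
proof -
  have "\<exists>g\<in>local_functions. dist g f < e" if e: "0 < e" for f :: "'v config \<Rightarrow>\<^sub>C real" and e
  proof -
    have "\<exists>A. finite A \<and> (\<forall>\<eta>. (\<forall>x\<in>A. \<eta> x = \<xi> x) \<longrightarrow> dist (apply_bcontfun f \<eta>) (apply_bcontfun f \<xi>) < e / 4)" for \<xi>
    proof -
      have "open (apply_bcontfun f -` ball (apply_bcontfun f \<xi>) (e / 4))"
        by (rule open_vimage) auto
      moreover have "\<xi> \<in> apply_bcontfun f -` ball (apply_bcontfun f \<xi>) (e / 4)" using e by simp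
      ultimately obtain A where A: "finite A" "{\<eta>. \<forall>x\<in>A. \<eta> x = \<xi> x} \<subseteq> apply_bcontfun f -` ball (apply_bcontfun f \<xi>) (e / 4)"
        by (rule open_contains_agreeing)
      show ?thesis
      proof (intro exI[of _ A] conjI allI impI A(1))
        fix \<eta> assume "\<forall>x\<in>A. \<eta> x = \<xi> x"
        then have "\<eta> \<in> apply_bcontfun f -` ball (apply_bcontfun f \<xi>) (e / 4)" using A(2) by blast
        then show "dist (apply_bcontfun f \<eta>) (apply_bcontfun f \<xi>) < e / 4" by (simp add: dist_commute)
      qed
    qed
    then obtain A where A: "\<And>\<xi>. finite (A \<xi>)"
      and osc: "\<And>\<xi> \<eta>. (\<forall>x\<in>A \<xi>. \<eta> x = \<xi> x) \<Longrightarrow> dist (apply_bcontfun f \<eta>) (apply_bcontfun f \<xi>) < e / 4"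
      by metis
    have cover: "UNIV \<subseteq> (\<Union>\<xi>\<in>UNIV. {\<eta>. \<forall>x\<in>A \<xi>. \<eta> x = \<xi> x})" by blast
    have op: "open {\<eta>. \<forall>x\<in>A \<xi>. \<eta> x = \<xi> x}" for \<xi> by (rule open_agreeing[OF A])
    obtain F where F: "finite F" "UNIV \<subseteq> (\<Union>\<xi>\<in>F. {\<eta>. \<forall>x\<in>A \<xi>. \<eta> x = \<xi> x})"
      by (rule compactE_image[OF compact_configs, of UNIV "\<lambda>\<xi>. {\<eta>. \<forall>x\<in>A \<xi>. \<eta> x = \<xi> x}", OF op cover])
    define B where "B = (\<Union>\<xi>\<in>F. A \<xi>)"
    have B: "finite B" using F(1) A by (auto simp: B_def)
    define r where "r \<eta> x = (x \<in> B \<and> \<eta> x)" for \<eta> :: "'v config" and x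
    have r_cont: "continuous_on UNIV r"
    proof (rule continuous_on_coordinatewise_then_product)
      fix x
      show "continuous_on UNIV (\<lambda>\<eta>. r \<eta> x)"
        by (cases "x \<in> B") (simp_all add: r_def)
    qed
    define g where "g = Bcontfun (\<lambda>\<eta>. apply_bcontfun f (r \<eta>))"
    have g: "apply_bcontfun g \<eta> = apply_bcontfun f (r \<eta>)" for \<eta>
    proof -
      have "(\<lambda>\<eta>. apply_bcontfun f (r \<eta>)) \<in> bcontfun"
      proof (rule bcontfun_normI)
        show "continuous_on UNIV (\<lambda>\<eta>. apply_bcontfun f (r \<eta>))"
          by (rule continuous_on_compose2[OF _ r_cont]) auto
        show "norm (apply_bcontfun f (r \<eta>)) \<le> norm f" for \<eta> by (rule norm_bounded)
      qed
      then show ?thesis by (simp add: g_def Bcontfun_inverse)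
    qed
    have "g \<in> local_functions"
      unfolding local_functions_def
    proof (intro CollectI exI[of _ B] conjI allI impI B)
      fix \<eta> \<xi> :: "'v config" assume "\<forall>x\<in>B. \<eta> x = \<xi> x"
      then have "r \<eta> = r \<xi>" by (auto simp: r_def fun_eq_iff)
      then show "apply_bcontfun g \<eta> = apply_bcontfun g \<xi>" by (simp add: g)
    qed
    moreover have "dist g f \<le> e / 2"
    proof (rule dist_bound)
      fix \<eta>
      obtain \<xi> where \<xi>: "\<xi> \<in> F" "\<forall>x\<in>A \<xi>. \<eta> x = \<xi> x" using F(2) by auto
      then have "\<forall>x\<in>A \<xi>. r \<eta> x = \<xi> x" by (auto simp: r_def B_def)
      from osc[OF this] osc[OF \<xi>(2)]
      show "dist (apply_bcontfun g \<eta>) (apply_bcontfun f \<eta>) \<le> e / 2"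
        unfolding g dist_real_def by linarith
    qed
    ultimately show ?thesis using e by (intro bexI[of _ g]) auto
  qed
  then show ?thesis by (auto simp: closure_approachable)
qed

definition centred_prod :: "real \<Rightarrow> 'v set \<Rightarrow> 'v config \<Rightarrow>\<^sub>C real" where
  "centred_prod r A = Bcontfun (\<lambda>\<eta>. \<Prod>x\<in>A. occ x \<eta> - r)"

lemma continuous_occ: "continuous_on UNIV (occ x)"
proof -
  have "continuous_on UNIV (of_bool :: bool \<Rightarrow> real)"
    by (auto simp: continuous_on_open_vimage intro: discrete_topology_class.open_discrete)
  then show ?thesis unfolding occ_def
    by (rule continuous_on_compose2[OF _ continuous_on_product_coordinates]) auto
qed

lemma occ_bounds: "0 \<le> occ x \<eta>" "occ x \<eta> \<le> 1" and occ_eq_0_or_1: "occ x \<eta> = 0 \<or> occ x \<eta> = 1"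
  by (auto simp: occ_def)

lemma apply_centred_prod [simp]: "apply_bcontfun (centred_prod r A) \<eta> = (\<Prod>x\<in>A. occ x \<eta> - r)"
proof -
  have "(\<lambda>\<eta>. \<Prod>x\<in>A. occ x \<eta> - r) \<in> bcontfun"
  proof (rule bcontfun_normI)
    show "continuous_on UNIV (\<lambda>\<eta>. \<Prod>x\<in>A. occ x \<eta> - r)"
      by (intro continuous_on_prod continuous_on_diff continuous_occ continuous_on_const)
    show "norm (\<Prod>x\<in>A. occ x \<eta> - r) \<le> (\<Prod>x\<in>A. 1 + \<bar>r\<bar>)" for \<eta>
      unfolding prod_norm[symmetric]
    proof (rule prod_mono)
      fix x show "0 \<le> norm (occ x \<eta> - r) \<and> norm (occ x \<eta> - r) \<le> 1 + \<bar>r\<bar>"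
        using occ_bounds[of x \<eta>] by (auto simp: abs_le_iff)
    qed
  qed
  then show ?thesis by (simp add: centred_prod_def Bcontfun_inverse)
qed

lemma centred_prod_abs_le:
  assumes "0 \<le> r" "r \<le> 1"
  shows "\<bar>\<Prod>x\<in>A. occ x \<eta> - r\<bar> \<le> 1"
  unfolding abs_prod
proof (rule prod_le_1)
  fix x show "0 \<le> \<bar>occ x \<eta> - r\<bar> \<and> \<bar>occ x \<eta> - r\<bar> \<le> 1"
    using occ_bounds[of x \<eta>] assms by (auto simp: abs_le_iff)
qed

lemma bcontfun_sum_apply: "apply_bcontfun (\<Sum>i\<in>I. f i) x = (\<Sum>i\<in>I. apply_bcontfun (f i) x)"
  for f :: "'i \<Rightarrow> 's::topological_space \<Rightarrow>\<^sub>C real"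
  by (induction I rule: infinite_finite_induct) auto

text \<open>A function of the coordinates in \<open>A\<close> is a combination of indicators of patterns on \<open>A\<close>, and each of
  these is a product of affine functions of the centred coordinates.\<close>

lemma local_function_in_span:
  assumes "f \<in> local_functions"
  shows "f \<in> span {centred_prod r A | A. finite A}"
proof -
  obtain A where A: "finite A" and loc: "\<And>\<eta> \<xi>. (\<forall>x\<in>A. \<eta> x = \<xi> x) \<Longrightarrow> apply_bcontfun f \<eta> = apply_bcontfun f \<xi>"
    using assms unfolding local_functions_def by auto
  define \<alpha> \<beta> where "\<alpha> B x = (if x \<in> B then r else 1 - r)" and "\<beta> B x = (if x \<in> B then 1 else - 1 :: real)" for B :: "'a set" and x
  have pattern: "(\<Sum>X\<in>Pow A. (\<Prod>x\<in>X. \<beta> B x) * (\<Prod>x\<in>A - X. \<alpha> B x) * (\<Prod>x\<in>X. occ x \<eta> - r))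
      = of_bool (\<forall>x\<in>A. \<eta> x = (x \<in> B))" for B \<eta>
  proof -
    have "(\<Sum>X\<in>Pow A. (\<Prod>x\<in>X. \<beta> B x) * (\<Prod>x\<in>A - X. \<alpha> B x) * (\<Prod>x\<in>X. occ x \<eta> - r))
        = (\<Sum>X\<in>Pow A. (\<Prod>x\<in>X. \<beta> B x * (occ x \<eta> - r)) * (\<Prod>x\<in>A - X. \<alpha> B x))"
      by (simp add: prod.distrib mult_ac)
    also have "\<dots> = (\<Prod>x\<in>A. \<beta> B x * (occ x \<eta> - r) + \<alpha> B x)" by (rule prod_add[OF A, symmetric])
    also have "\<dots> = (\<Prod>x\<in>A. of_bool (\<eta> x = (x \<in> B)))"
      by (intro prod.cong refl) (auto simp: \<alpha>_def \<beta>_def occ_def)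
    also have "\<dots> = of_bool (\<forall>x\<in>A. \<eta> x = (x \<in> B))"
      using A by (induction A rule: finite_induct) auto
    finally show ?thesis .
  qed
  define g where "g = (\<Sum>B\<in>Pow A. apply_bcontfun f (\<lambda>x. x \<in> B) *\<^sub>R
      (\<Sum>X\<in>Pow A. ((\<Prod>x\<in>X. \<beta> B x) * (\<Prod>x\<in>A - X. \<alpha> B x)) *\<^sub>R centred_prod r X))"
  have "f = g"
  proof (rule bcontfun_eqI)
    fix \<eta> :: "'a config"
    define B where "B = {x \<in> A. \<eta> x}"
    have "apply_bcontfun g \<eta> = (\<Sum>B\<in>Pow A. apply_bcontfun f (\<lambda>x. x \<in> B) * of_bool (\<forall>x\<in>A. \<eta> x = (x \<in> B)))"
      unfolding g_def pattern[symmetric] by (simp add: bcontfun_sum_apply)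
    also have "\<dots> = (\<Sum>C\<in>Pow A. if B = C then apply_bcontfun f (\<lambda>x. x \<in> C) else 0)"
      by (intro sum.cong refl) (auto simp: B_def)
    also have "\<dots> = apply_bcontfun f (\<lambda>x. x \<in> B)"
      using A by (subst sum.delta') (auto simp: B_def)
    also have "\<dots> = apply_bcontfun f \<eta>" by (rule loc) (auto simp: B_def)
    finally show "apply_bcontfun f \<eta> = apply_bcontfun g \<eta>" ..
  qed
  moreover have "g \<in> span {centred_prod r A | A. finite A}"
    unfolding g_def using A
    by (intro span_sum span_scale span_base) (auto intro: finite_subset)
  ultimately show ?thesis by simp
qed

text \<open>The form in which density is used: a closed linear property of functions needs to be checked on products of
  centred coordinates only.\<close>

lemma closed_subspace_centred_prods:
  assumes "subspace S" "closed S" and "\<And>A. finite A \<Longrightarrow> centred_prod r A \<in> S"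
  shows "S = UNIV"
proof -
  have "span {centred_prod r A | A. finite A} \<subseteq> S"
    by (rule span_minimal) (use assms in auto)
  then have "local_functions \<subseteq> S" using local_function_in_span by blast
  then have "closure local_functions \<subseteq> S" by (rule closure_minimal[OF _ assms(2)])
  then show ?thesis unfolding closure_local_functions by (rule subset_antisym[OF subset_UNIV])
qed

lemma bounded_linear_eq_on_centred_prods:
  fixes l l' :: "('v config \<Rightarrow>\<^sub>C real) \<Rightarrow> real"
  assumes l: "bounded_linear l" and l': "bounded_linear l'"
    and eq: "\<And>A. finite A \<Longrightarrow> l (centred_prod r A) = l' (centred_prod r A)"
  shows "l f = l' f"
proof -
  have d: "bounded_linear (\<lambda>f. l f - l' f)" by (rule bounded_linear_sub[OF l l'])
  have "{f. l f - l' f = 0} = UNIV"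
  proof (rule closed_subspace_centred_prods)
    show "subspace {f. l f - l' f = 0}"
      using bounded_linear.linear[OF d] by (rule linear_subspace_kernel)
    show "closed {f. l f - l' f = 0}"
      by (intro closed_Collect_eq continuous_on_const linear_continuous_on d)
  qed (use eq in auto)
  then show ?thesis by auto
qed

definition all_occupied_on :: "'v set \<Rightarrow> 'v config set" where
  "all_occupied_on A = {\<eta>. \<forall>x\<in>A. \<eta> x}"

lemma indicator_all_occupied_on: "finite A \<Longrightarrow> indicator (all_occupied_on A) \<eta> = apply_bcontfun (centred_prod 0 A) \<eta>"
  by (induction A rule: finite_induct) (auto simp: all_occupied_on_def indicator_def occ_def)

text \<open>An open set is a countable union of cylinders that prescribe finitely many sites, because there are only
  countably many of these. The generator chosen here is a \<open>\<pi>\<close>-system whose indicators are the products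
  \<open>centred_prod 0 A\<close>.\<close>

lemma sets_borel_configs:
  "sets (borel :: ('v::countable) config measure) = sigma_sets UNIV {all_occupied_on A | A. finite A}"
proof -
  let ?E = "{all_occupied_on A | A :: 'v set. finite A}"
  interpret S: sigma_algebra UNIV "sigma_sets UNIV ?E" by (rule sigma_algebra_sigma_sets) auto
  have coord: "{\<eta> :: 'v config. \<eta> i \<in> B} \<in> sigma_sets UNIV ?E" for i B
  proof -
    have "all_occupied_on {i} \<in> sigma_sets UNIV ?E" by (intro sigma_sets.Basic) auto
    then have T: "{\<eta> :: 'v config. \<eta> i} \<in> sigma_sets UNIV ?E" by (simp add: all_occupied_on_def)
    then have F: "UNIV - {\<eta> :: 'v config. \<eta> i} \<in> sigma_sets UNIV ?E" by (rule S.compl_sets)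
    have "{\<eta> :: 'v config. \<eta> i \<in> B} = (if True \<in> B then {\<eta>. \<eta> i} else {}) \<union> (if False \<in> B then UNIV - {\<eta>. \<eta> i} else {})"
      by (auto split: if_splits) (metis (full_types))+
    also have "\<dots> \<in> sigma_sets UNIV ?E" using T F by (auto split: if_splits)
    finally show ?thesis .
  qed
  have pattern: "{\<eta> :: 'v config. \<forall>x\<in>A. \<eta> x = (x \<in> B)} \<in> sigma_sets UNIV ?E" if "finite A" for A B
    using that
  proof (induction A rule: finite_induct)
    case empty
    then show ?case using S.top by simp
  next
    case (insert a A)
    have "{\<eta> :: 'v config. \<forall>x\<in>insert a A. \<eta> x = (x \<in> B)} = {\<eta>. \<eta> a \<in> {a \<in> B}} \<inter> {\<eta>. \<forall>x\<in>A. \<eta> x = (x \<in> B)}"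
      by auto
    then show ?case using S.Int[OF coord[of a "{a \<in> B}"] insert.IH] by (simp only:)
  qed
  have 1: "sets (borel :: 'v config measure) \<subseteq> sigma_sets UNIV ?E"
    unfolding borel_def
  proof (subst sets_measure_of, simp, rule S.sigma_sets_subset, rule subsetI)
    fix U :: "'v config set" assume "U \<in> Collect open"
    then have U: "open U" by simp
    define I where "I = {AB :: 'v set \<times> 'v set. finite (fst AB) \<and> finite (snd AB) \<and> {\<eta>. \<forall>x\<in>fst AB. \<eta> x = (x \<in> snd AB)} \<subseteq> U}"
    have "I \<subseteq> Collect finite \<times> Collect finite" by (auto simp: I_def)
    moreover have "countable (Collect finite \<times> Collect finite :: ('v set \<times> 'v set) set)"
      by (intro countable_SIGMA countable_Collect_finite)
    ultimately have I: "countable I" by (rule countable_subset)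
    have "U = (\<Union>AB\<in>I. {\<eta>. \<forall>x\<in>fst AB. \<eta> x = (x \<in> snd AB)})"
    proof (intro subset_antisym subsetI)
      fix \<xi> assume "\<xi> \<in> U"
      then obtain A where A: "finite A" "{\<eta>. \<forall>x\<in>A. \<eta> x = \<xi> x} \<subseteq> U" by (rule open_contains_agreeing[OF U])
      then have "(A, {x \<in> A. \<xi> x}) \<in> I" by (auto simp: I_def)
      then show "\<xi> \<in> (\<Union>AB\<in>I. {\<eta>. \<forall>x\<in>fst AB. \<eta> x = (x \<in> snd AB)})" by force
    qed (auto simp: I_def)
    also have "\<dots> \<in> sigma_sets UNIV ?E"
      by (rule S.countable_UN''[OF I pattern]) (auto simp: I_def)
    finally show "U \<in> sigma_sets UNIV ?E" .
  qed
  have "open (all_occupied_on A)" if "finite A" for A :: "'v set"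
    using open_agreeing[OF that, of "\<lambda>_. True"] by (simp add: all_occupied_on_def)
  then have "?E \<subseteq> sets borel" by auto
  then have "sigma_sets UNIV ?E \<subseteq> sets (borel :: 'v config measure)"
    using sets.sigma_sets_subset[of ?E borel] by simp
  then show ?thesis using 1 by (rule subset_antisym[rotated])
qed

lemma sets_PiM_configs:
  fixes M :: "'v::countable \<Rightarrow> bool measure"
  assumes "\<And>i. sets (M i) = UNIV"
  shows "sets (Pi\<^sub>M UNIV M) = sets borel"
proof (rule subset_antisym)
  have sp: "space (M i) = UNIV" for i using sets.sets_into_space[of UNIV "M i"] assms by auto
  have "open {\<eta> :: 'v config. \<eta> i \<in> B}" for i B
  proof -
    have "open ((\<lambda>\<eta> :: 'v config. \<eta> i) -` B)"
      by (rule open_vimage[OF discrete_topology_class.open_discrete continuous_on_product_coordinates])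
    then show ?thesis by (simp add: vimage_def)
  qed
  then have "{{f :: 'v config. f i \<in> B} | i B. i \<in> UNIV \<and> B \<in> sets (M i)} \<subseteq> sets borel" by auto
  then have "sigma_sets UNIV {{f :: 'v config. f i \<in> B} | i B. i \<in> UNIV \<and> B \<in> sets (M i)} \<subseteq> sets borel"
    using sets.sigma_sets_subset[of _ "borel :: 'v config measure"] by simp
  then show "sets (Pi\<^sub>M UNIV M) \<subseteq> sets borel"
    by (simp add: sets_PiM_single sp PiE_UNIV_domain)
  have "all_occupied_on A \<in> sets (Pi\<^sub>M UNIV M)" if "finite A" for A
    using that
  proof (induction A rule: finite_induct)
    case empty
    then show ?case using sets.top[of "Pi\<^sub>M UNIV M"] by (simp add: all_occupied_on_def space_PiM sp PiE_UNIV_domain)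
  next
    case (insert a A)
    have "(\<lambda>\<eta>. \<eta> a) -` {True} \<inter> space (Pi\<^sub>M UNIV M) \<in> sets (Pi\<^sub>M UNIV M)"
      by (rule measurable_sets[OF measurable_component_singleton]) (auto simp: assms)
    then have "{\<eta>. \<eta> a} \<in> sets (Pi\<^sub>M UNIV M)" by (simp add: vimage_def space_PiM sp PiE_UNIV_domain)
    moreover have "all_occupied_on (insert a A) = {\<eta>. \<eta> a} \<inter> all_occupied_on A" by (auto simp: all_occupied_on_def)
    ultimately show ?case using insert.IH by simp
  qed
  then have "{all_occupied_on A | A :: 'v set. finite A} \<subseteq> sets (Pi\<^sub>M UNIV M)" by auto
  then have "sigma_sets (space (Pi\<^sub>M UNIV M)) {all_occupied_on A | A :: 'v set. finite A} \<subseteq> sets (Pi\<^sub>M UNIV M)"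
    by (rule sets.sigma_sets_subset)
  then show "sets borel \<subseteq> sets (Pi\<^sub>M UNIV M)"
    unfolding sets_borel_configs by (simp add: space_PiM sp PiE_UNIV_domain)
qed

lemma borel_prob_eqI:
  fixes m m' :: "('v::countable) config measure"
  assumes m: "borel_prob m" and m': "borel_prob m'"
    and eq: "\<And>f :: 'v config \<Rightarrow>\<^sub>C real. (\<integral>\<eta>. apply_bcontfun f \<eta> \<partial>m) = (\<integral>\<eta>. apply_bcontfun f \<eta> \<partial>m')"
  shows "m = m'"
proof -
  interpret m: prob_space m using m by (simp add: borel_prob_def)
  interpret m': prob_space m' using m' by (simp add: borel_prob_def)
  show ?thesis
  proof (rule measure_eqI_generator_eq[where E = "{all_occupied_on A | A :: 'v set. finite A}" and \<Omega> = UNIV and A = "\<lambda>_. UNIV"])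
    have "all_occupied_on A \<inter> all_occupied_on B = all_occupied_on (A \<union> B)" for A B :: "'v set"
      by (auto simp: all_occupied_on_def)
    then show "Int_stable {all_occupied_on A | A :: 'v set. finite A}"
      by (auto intro!: Int_stableI)
    show "sets m = sigma_sets UNIV {all_occupied_on A | A :: 'v set. finite A}"
      "sets m' = sigma_sets UNIV {all_occupied_on A | A :: 'v set. finite A}"
      using m m' sets_borel_configs by (auto simp: borel_prob_def)
    have "all_occupied_on {} = (UNIV :: 'v config set)" by (simp add: all_occupied_on_def)
    then show "range (\<lambda>_. UNIV) \<subseteq> {all_occupied_on A | A :: 'v set. finite A}" by auto
    fix Y assume "Y \<in> {all_occupied_on A | A :: 'v set. finite A}"
    then obtain A :: "'v set" where A: "finite A" "Y = all_occupied_on A" by auto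
    have Y: "Y \<in> sigma_sets UNIV {all_occupied_on A | A :: 'v set. finite A}" using A by (intro sigma_sets.Basic) auto
    then have Y: "Y \<in> sets m" "Y \<in> sets m'"
      using m m' sets_borel_configs by (auto simp: borel_prob_def)
    have "measure m Y = (\<integral>\<eta>. indicator Y \<eta> \<partial>m)" "measure m' Y = (\<integral>\<eta>. indicator Y \<eta> \<partial>m')" using Y by simp_all
    then have "measure m Y = measure m' Y"
      using eq[of "centred_prod 0 A"] A by (simp only: indicator_all_occupied_on)
    then show "emeasure m Y = emeasure m' Y" by (simp add: m.emeasure_eq_measure m'.emeasure_eq_measure)
  qed auto
qed

text \<open>On a compact space with a base of clopen sets the Riesz representation needs no regularity argument:
  by compactness a positive functional is automatically continuous at the empty set on the clopen algebra.\<close>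

lemma riesz_configs:
  fixes l :: "(('v::countable) config \<Rightarrow>\<^sub>C real) \<Rightarrow> real"
  assumes l: "linear l" and pos: "\<And>f. (\<And>\<eta>. 0 \<le> apply_bcontfun f \<eta>) \<Longrightarrow> 0 \<le> l f" and one: "l (const_bcontfun 1) = 1"
  obtains m where "borel_prob m" and "\<And>f. (\<integral>\<eta>. apply_bcontfun f \<eta> \<partial>m) = l f"
proof -
  define M where "M = {S :: 'v config set. open S \<and> closed S}"
  define ind where "ind S = Bcontfun (indicator S :: 'v config \<Rightarrow> real)" for S
  have ind: "apply_bcontfun (ind S) = indicator S" if "S \<in> M" for S
  proof -
    have "indicator S \<in> (bcontfun :: ('v config \<Rightarrow> real) set)"
    proof (rule bcontfun_normI[where b = 1])
      have "continuous_on (S \<union> - S) (indicator S :: 'v config \<Rightarrow> real)"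
      proof (rule continuous_on_open_Un)
        show "continuous_on S (indicator S :: 'v config \<Rightarrow> real)"
          by (rule continuous_on_eq[OF continuous_on_const[of _ 1]]) simp
        show "continuous_on (- S) (indicator S :: 'v config \<Rightarrow> real)"
          by (rule continuous_on_eq[OF continuous_on_const[of _ 0]]) simp
      qed (use that in \<open>auto simp: M_def\<close>)
      then show "continuous_on UNIV (indicator S :: 'v config \<Rightarrow> real)" by simp
    qed (auto simp: indicator_def)
    then show ?thesis by (simp add: ind_def Bcontfun_inverse)
  qed
  define \<mu> where "\<mu> S = ennreal (l (ind S))" for S
  have l_ind: "0 \<le> l (ind S)" if "S \<in> M" for S by (rule pos) (simp add: ind[OF that])
  interpret A: algebra UNIV M
    by (rule algebra_iff_Un[THEN iffD2]) (auto simp: M_def Compl_eq_Diff_UNIV[symmetric])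
  have ind0: "ind {} = 0" by (rule bcontfun_eqI) (simp add: ind[OF A.empty_sets])
  have "\<exists>\<nu>. (\<forall>s\<in>M. \<nu> s = \<mu> s) \<and> measure_space UNIV (sigma_sets UNIV M) \<nu>"
  proof (rule A.caratheodory_empty_continuous)
    show "positive M \<mu>"
      by (simp add: positive_def \<mu>_def ind0 linear_0[OF l])
    show "additive M \<mu>"
    proof (unfold additive_def, intro ballI impI)
      fix S R assume SR: "S \<in> M" "R \<in> M" "S \<inter> R = {}"
      have "S \<union> R \<in> M" using SR by auto
      then have "ind (S \<union> R) = ind S + ind R"
        using SR by (intro bcontfun_eqI) (auto simp: ind indicator_def)
      then show "\<mu> (S \<union> R) = \<mu> S + \<mu> R" using SR l_ind by (simp add: \<mu>_def linear_add[OF l])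
    qed
    show "\<mu> S \<noteq> \<infinity>" for S by (simp add: \<mu>_def)
    fix S :: "nat \<Rightarrow> 'v config set" assume S: "range S \<subseteq> M" "decseq S" "(\<Inter>i. S i) = {}"
    have "UNIV \<subseteq> (\<Union>i\<in>UNIV. - S i)" using S(3) by auto
    moreover have "open (- S i)" for i using S(1) by (auto simp: M_def)
    ultimately obtain I where I: "finite I" "UNIV \<subseteq> (\<Union>i\<in>I. - S i)"
      using compactE_image[OF compact_configs, of UNIV "\<lambda>i. - S i"] by metis
    obtain N where N: "\<And>i. i \<in> I \<Longrightarrow> i \<le> N" using I(1) by (meson finite_nat_set_iff_bounded_le)
    have "S n = {}" if "N \<le> n" for n
    proof -
      have "S n \<subseteq> S i" if "i \<in> I" for i using N[OF that] \<open>N \<le> n\<close> S(2) by (auto simp: decseq_def)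
      then show ?thesis using I(2) by blast
    qed
    then have "\<forall>\<^sub>F n in sequentially. \<mu> (S n) = 0"
      by (intro eventually_sequentiallyI[of N]) (simp add: \<mu>_def ind0 linear_0[OF l])
    then show "(\<lambda>i. \<mu> (S i)) \<longlonglongrightarrow> 0" by (rule tendsto_eventually)
  qed
  then obtain \<nu> where \<nu>: "\<And>s. s \<in> M \<Longrightarrow> \<nu> s = \<mu> s" "measure_space UNIV (sigma_sets UNIV M) \<nu>" by auto
  define m where "m = measure_of UNIV (sigma_sets UNIV M) \<nu>"
  have sets_m: "sets m = sigma_sets UNIV M" by (simp add: m_def sets_measure_of sigma_sets_sigma_sets_eq)
  have em: "emeasure m S = \<mu> S" if "S \<in> M" for S
  proof -
    have "emeasure m S = \<nu> S"
      unfolding m_def by (rule emeasure_measure_of_sigma) (use \<nu>(2) that in \<open>auto simp: measure_space_def\<close>)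
    then show ?thesis using \<nu>(1)[OF that] by simp
  qed
  have occ_M: "all_occupied_on A \<in> M" if "finite A" for A :: "'v set"
  proof -
    have "closed (all_occupied_on A)"
    proof -
      have "open (- {\<eta> :: 'v config. \<eta> x})" for x
        using open_agreeing[of "{x}" "\<lambda>_. False"] by (simp add: Collect_neg_eq[symmetric])
      then have "closed (\<Inter>x\<in>A. {\<eta> :: 'v config. \<eta> x})" by (intro closed_INT) (simp add: closed_def)
      moreover have "(\<Inter>x\<in>A. {\<eta> :: 'v config. \<eta> x}) = all_occupied_on A" by (auto simp: all_occupied_on_def)
      ultimately show ?thesis by simp
    qed
    then show ?thesis using open_agreeing[OF that, of "\<lambda>_. True"] by (simp add: M_def all_occupied_on_def)
  qed
  have "sets m = sets borel"
  proof (rule subset_antisym)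
    have "M \<subseteq> sets borel" by (auto simp: M_def)
    then show "sets m \<subseteq> sets borel" unfolding sets_m using sets.sigma_sets_subset[of M borel] by simp
    show "sets borel \<subseteq> sets m"
      unfolding sets_m sets_borel_configs by (rule sigma_sets_mono') (use occ_M in auto)
  qed
  moreover have "prob_space m"
  proof (rule prob_spaceI)
    have "ind UNIV = const_bcontfun 1" by (rule bcontfun_eqI) (simp add: ind[OF A.top])
    then show "emeasure m (space m) = 1"
      using em[OF A.top] one by (simp add: m_def \<mu>_def space_measure_of_conv)
  qed
  ultimately have m: "borel_prob m" by (simp add: borel_prob_def)
  interpret prob_space m using \<open>prob_space m\<close> .
  have lb: "bounded_linear l"
  proof (rule bounded_linear.intro[OF l], unfold bounded_linear_axioms_def, intro exI allI)
    fix f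
    have c: "l (const_bcontfun b) = b" for b
    proof -
      have "const_bcontfun b = b *\<^sub>R (const_bcontfun 1 :: 'v config \<Rightarrow>\<^sub>C real)" by (rule bcontfun_eqI) simp
      then show ?thesis using one by (simp add: linear_scale[OF l])
    qed
    have "0 \<le> l (const_bcontfun (norm f) - f)" "0 \<le> l (const_bcontfun (norm f) + f)"
      using bcontfun_abs_le_norm[of f] by (intro pos; simp add: abs_le_iff add_nonneg_nonneg minus_le_iff; smt (verit))+
    then show "norm (l f) \<le> norm f * 1"
      by (simp add: linear_diff[OF l] linear_add[OF l] c abs_le_iff)
  qed
  show thesis
  proof (rule that[OF m])
    fix f
    show "(\<integral>\<eta>. apply_bcontfun f \<eta> \<partial>m) = l f"
    proof (rule bounded_linear_eq_on_centred_prods[OF bounded_linear_integral_bcontfun(1)[OF m] lb, where r = 0])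
      fix A :: "'v set" assume A: "finite A"
      have AM: "all_occupied_on A \<in> M" by (rule occ_M[OF A])
      have eq: "ind (all_occupied_on A) = centred_prod 0 A"
        by (rule bcontfun_eqI) (simp only: ind[OF AM] indicator_all_occupied_on[OF A])
      have "(\<integral>\<eta>. apply_bcontfun (centred_prod 0 A) \<eta> \<partial>m) = measure m (all_occupied_on A)"
      proof -
        have "all_occupied_on A \<in> sets m" unfolding sets_m using AM by (rule sigma_sets.Basic)
        then show ?thesis by (simp only: indicator_all_occupied_on[OF A, symmetric]) simp
      qed
      also have "\<dots> = l (centred_prod 0 A)"
        using em[OF AM] l_ind[OF AM] by (simp add: measure_def \<mu>_def eq)
      finally show "(\<integral>\<eta>. apply_bcontfun (centred_prod 0 A) \<eta> \<partial>m) = l (centred_prod 0 A)" .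
    qed
  qed
qed

section \<open>Evolution of measures\<close>

lemma bounded_linear_integral_semigroup:
  fixes m :: "'s::topological_space measure"
  assumes T: "markov_semigroup T" and m: "borel_prob m" and t: "0 \<le> t"
  shows "bounded_linear (\<lambda>f. \<integral>\<eta>. apply_bcontfun (T t f) \<eta> \<partial>m)"
  using bounded_linear_compose[OF bounded_linear_integral_bcontfun(1)[OF m] semigroup_bounded_linear[OF T t]] .

text \<open>The definite description in \<open>evolve\<close> is meaningful: existence is the Riesz representation of a positive
  normalised functional, uniqueness holds since continuous functions determine the measure.\<close>

lemma evolve_integral:
  fixes m :: "('v::countable) config measure"
  assumes T: "markov_semigroup T" and m: "borel_prob m" and t: "0 \<le> t"
  shows "borel_prob (evolve m T t)"
    and "(\<integral>\<eta>. apply_bcontfun f \<eta> \<partial>evolve m T t) = (\<integral>\<eta>. apply_bcontfun (T t f) \<eta> \<partial>m)"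
proof -
  interpret prob_space m using m by (simp add: borel_prob_def)
  define Q where "Q m' \<longleftrightarrow> borel_prob m' \<and> (\<forall>f. (\<integral>x. apply_bcontfun f x \<partial>m') = (\<integral>x. apply_bcontfun (T t f) x \<partial>m))" for m'
  obtain m' where m': "borel_prob m'" "\<And>f. (\<integral>\<eta>. apply_bcontfun f \<eta> \<partial>m') = (\<integral>\<eta>. apply_bcontfun (T t f) \<eta> \<partial>m)"
  proof (rule riesz_configs)
    show "linear (\<lambda>f. \<integral>\<eta>. apply_bcontfun (T t f) \<eta> \<partial>m)"
      by (rule bounded_linear.linear[OF bounded_linear_integral_semigroup[OF T m t]])
    show "0 \<le> (\<integral>\<eta>. apply_bcontfun (T t f) \<eta> \<partial>m)" if "\<And>\<eta>. 0 \<le> apply_bcontfun f \<eta>" for f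
      by (intro Bochner_Integration.integral_nonneg semigroup_pos[OF T t] that)
    show "(\<integral>\<eta>. apply_bcontfun (T t (const_bcontfun 1)) \<eta> \<partial>m) = 1"
      by (simp add: semigroup_one[OF T t] prob_space)
  qed blast
  have "Q (THE m'. Q m')"
  proof (rule theI)
    show "Q m'" using m' by (simp add: Q_def)
    fix m'' assume "Q m''"
    then show "m'' = m'" using m' by (intro borel_prob_eqI) (auto simp: Q_def)
  qed
  then have "Q (evolve m T t)" by (simp add: evolve_def Q_def)
  then show "borel_prob (evolve m T t)"
    and "(\<integral>\<eta>. apply_bcontfun f \<eta> \<partial>evolve m T t) = (\<integral>\<eta>. apply_bcontfun (T t f) \<eta> \<partial>m)"
    by (auto simp: Q_def)
qed

lemma weak_limit_evolve_iff:
  fixes m m' :: "('v::countable) config measure"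
  assumes T: "markov_semigroup T" and m: "borel_prob m"
  shows "weak_limit (evolve m T) m' \<longleftrightarrow> borel_prob m' \<and>
    (\<forall>f. ((\<lambda>t. \<integral>\<eta>. apply_bcontfun (T t f) \<eta> \<partial>m) \<longlongrightarrow> (\<integral>\<eta>. apply_bcontfun f \<eta> \<partial>m')) at_top)"
proof -
  have "((\<lambda>t. \<integral>\<eta>. apply_bcontfun f \<eta> \<partial>evolve m T t) \<longlongrightarrow> l) at_top \<longleftrightarrow>
      ((\<lambda>t. \<integral>\<eta>. apply_bcontfun (T t f) \<eta> \<partial>m) \<longlongrightarrow> l) at_top" for f l
    by (rule filterlim_cong[OF refl refl])
       (use evolve_integral(2)[OF T m] in \<open>auto intro!: eventually_mono[OF eventually_ge_at_top[of 0]]\<close>)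
  then show ?thesis by (simp add: weak_limit_def)
qed

text \<open>Functionals of norm at most one are equicontinuous, so convergence carries over to limits in norm. Convergence
  on products of centred coordinates will therefore suffice.\<close>

lemma convergent_functionals_closed_subspace:
  fixes l :: "real \<Rightarrow> ('s::topological_space \<Rightarrow>\<^sub>C real) \<Rightarrow> real"
  assumes lin: "\<And>t. 0 \<le> t \<Longrightarrow> linear (l t)" and bd: "\<And>t f. 0 \<le> t \<Longrightarrow> \<bar>l t f\<bar> \<le> norm f"
  shows "subspace {f. \<exists>c. ((\<lambda>t. l t f) \<longlongrightarrow> c) at_top}" and "closed {f. \<exists>c. ((\<lambda>t. l t f) \<longlongrightarrow> c) at_top}"
proof -
  have ev: "\<forall>\<^sub>F t :: real in at_top. 0 \<le> t" by (rule eventually_ge_at_top)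
  show "subspace {f. \<exists>c. ((\<lambda>t. l t f) \<longlongrightarrow> c) at_top}"
  proof (rule subspaceI; clarify)
    have "((\<lambda>t. l t 0) \<longlongrightarrow> 0) at_top"
      by (rule tendsto_eventually) (rule eventually_mono[OF ev], simp add: linear_0[OF lin])
    then show "\<exists>c. ((\<lambda>t. l t 0) \<longlongrightarrow> c) at_top" by blast
    fix f g c d assume f: "((\<lambda>t. l t f) \<longlongrightarrow> c) at_top" and g: "((\<lambda>t. l t g) \<longlongrightarrow> d) at_top"
    have "((\<lambda>t. l t (f + g)) \<longlongrightarrow> c + d) at_top"
      by (rule Lim_transform_eventually[OF tendsto_add[OF f g]]) (rule eventually_mono[OF ev], simp add: linear_add[OF lin])
    then show "\<exists>c. ((\<lambda>t. l t (f + g)) \<longlongrightarrow> c) at_top" by blast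
  next
    fix r f c assume f: "((\<lambda>t. l t f) \<longlongrightarrow> c) at_top"
    have "((\<lambda>t. l t (r *\<^sub>R f)) \<longlongrightarrow> r * c) at_top"
      by (rule Lim_transform_eventually[OF tendsto_mult_left[OF f]]) (rule eventually_mono[OF ev], simp add: linear_scale[OF lin])
    then show "\<exists>c. ((\<lambda>t. l t (r *\<^sub>R f)) \<longlongrightarrow> c) at_top" by blast
  qed
  show "closed {f. \<exists>c. ((\<lambda>t. l t f) \<longlongrightarrow> c) at_top}"
    unfolding closed_sequential_limits
  proof (intro allI impI, elim conjE)
    fix g f assume g: "\<forall>n. g n \<in> {f. \<exists>c. ((\<lambda>t. l t f) \<longlongrightarrow> c) at_top}" and gf: "g \<longlonglongrightarrow> f"
    from g obtain c where c: "\<And>n. ((\<lambda>t. l t (g n)) \<longlongrightarrow> c n) at_top" by simp metis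
    have dif: "\<bar>l t (g n) - l t f\<bar> \<le> dist (g n) f" if "0 \<le> t" for t n f
      using bd[OF that, of "g n - f"] by (simp add: linear_diff[OF lin[OF that]] dist_norm)
    have cd: "\<bar>c m - c n\<bar> \<le> dist (g n) (g m)" for m n
    proof (rule tendsto_upperbound[OF tendsto_rabs[OF tendsto_diff[OF c c]]])
      show "\<forall>\<^sub>F t in at_top. \<bar>l t (g m) - l t (g n)\<bar> \<le> dist (g n) (g m)"
        using ev by eventually_elim (use dif[of _ n "g m"] in \<open>simp add: abs_minus_commute\<close>)
    qed simp
    have "Cauchy c"
    proof (rule metric_CauchyI)
      fix e :: real assume "0 < e"
      obtain N where "\<And>m n. N \<le> m \<Longrightarrow> N \<le> n \<Longrightarrow> dist (g m) (g n) < e"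
        using metric_CauchyD[OF LIMSEQ_imp_Cauchy[OF gf] \<open>0 < e\<close>] by blast
      then have "dist (c m) (c n) < e" if "N \<le> m" "N \<le> n" for m n
        using cd[of m n] that by (force simp: dist_real_def)
      then show "\<exists>N. \<forall>m\<ge>N. \<forall>n\<ge>N. dist (c m) (c n) < e" by blast
    qed
    then obtain c' where c': "c \<longlonglongrightarrow> c'" by (auto simp: Cauchy_convergent_iff convergent_def)
    have "((\<lambda>t. l t f) \<longlongrightarrow> c') at_top"
    proof (rule tendstoI)
      fix e :: real assume e: "0 < e"
      have "\<forall>\<^sub>F n in sequentially. dist (g n) f < e / 3 \<and> dist (c n) c' < e / 3"
        using tendstoD[OF gf, of "e / 3"] tendstoD[OF c', of "e / 3"] e by (intro eventually_conj) auto
      then obtain n where n: "dist (g n) f < e / 3" "dist (c n) c' < e / 3"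
        by (auto simp: eventually_sequentially)
      have "\<forall>\<^sub>F t in at_top. dist (l t (g n)) (c n) < e / 3" using tendstoD[OF c, of "e / 3"] e by simp
      then show "\<forall>\<^sub>F t in at_top. dist (l t f) c' < e"
        using ev
      proof eventually_elim
        case (elim t)
        then show ?case using dif[of t n f] n unfolding dist_real_def by linarith
      qed
    qed
    then show "f \<in> {f. \<exists>c. ((\<lambda>t. l t f) \<longlongrightarrow> c) at_top}" by auto
  qed
qed

text \<open>The limits of the integrals form again a positive normalised linear functional.\<close>

lemma weak_limit_evolve_exists:
  fixes m :: "('v::countable) config measure"
  assumes T: "markov_semigroup T" and m: "borel_prob m"
    and conv: "\<And>A. finite A \<Longrightarrow> \<exists>c. ((\<lambda>t. \<integral>\<eta>. apply_bcontfun (T t (centred_prod r A)) \<eta> \<partial>m) \<longlongrightarrow> c) at_top"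
  shows "\<exists>m'. weak_limit (evolve m T) m'"
proof -
  interpret prob_space m using m by (simp add: borel_prob_def)
  define l where "l t f = (\<integral>\<eta>. apply_bcontfun (T t f) \<eta> \<partial>m)" for t f
  have lin: "linear (l t)" if "0 \<le> t" for t
    unfolding l_def by (rule bounded_linear.linear[OF bounded_linear_integral_semigroup[OF T m that]])
  have bd: "\<bar>l t f\<bar> \<le> norm f" if "0 \<le> t" for t f
  proof -
    have "\<bar>l t f\<bar> \<le> (\<integral>\<eta>. norm f \<partial>m)"
      unfolding l_def
      by (rule order_trans[OF integral_abs_bound], rule Bochner_Integration.integral_mono)
         (auto intro!: integrable_abs bounded_linear_integral_bcontfun(2)[OF m] semigroup_abs_le[OF T that] bcontfun_abs_le_norm)
    then show ?thesis by (simp add: prob_space)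
  qed
  have "{f. \<exists>c. ((\<lambda>t. l t f) \<longlongrightarrow> c) at_top} = UNIV"
    by (rule closed_subspace_centred_prods[OF convergent_functionals_closed_subspace[of l, OF lin bd]])
       (use conv in \<open>auto simp: l_def\<close>)
  then have "\<forall>f. \<exists>c. ((\<lambda>t. l t f) \<longlongrightarrow> c) at_top" by auto
  then obtain L where L: "\<And>f. ((\<lambda>t. l t f) \<longlongrightarrow> L f) at_top" by metis
  have ev: "\<forall>\<^sub>F t :: real in at_top. 0 \<le> t" by (rule eventually_ge_at_top)
  obtain m' where m': "borel_prob m'" "\<And>f. (\<integral>\<eta>. apply_bcontfun f \<eta> \<partial>m') = L f"
  proof (rule riesz_configs)
    show "linear L"
    proof (rule linearI)
      fix f g
      have "((\<lambda>t. l t (f + g)) \<longlongrightarrow> L f + L g) at_top"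
        by (rule Lim_transform_eventually[OF tendsto_add[OF L L]]) (rule eventually_mono[OF ev], simp add: linear_add[OF lin])
      then show "L (f + g) = L f + L g" by (rule tendsto_unique[OF trivial_limit_at_top_linorder L])
      fix c
      have "((\<lambda>t. l t (c *\<^sub>R f)) \<longlongrightarrow> c *\<^sub>R L f) at_top"
        by (rule Lim_transform_eventually[OF tendsto_scaleR[OF tendsto_const L]]) (rule eventually_mono[OF ev], simp add: linear_scale[OF lin])
      then show "L (c *\<^sub>R f) = c *\<^sub>R L f" by (rule tendsto_unique[OF trivial_limit_at_top_linorder L])
    qed
    show "0 \<le> L f" if "\<And>\<eta>. 0 \<le> apply_bcontfun f \<eta>" for f
    proof (rule tendsto_lowerbound[OF L])
      show "\<forall>\<^sub>F t in at_top. 0 \<le> l t f"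
        using ev by eventually_elim (auto simp: l_def intro!: Bochner_Integration.integral_nonneg semigroup_pos[OF T] that)
    qed simp
    have "((\<lambda>t. l t (const_bcontfun 1)) \<longlongrightarrow> 1) at_top"
      by (rule tendsto_eventually) (rule eventually_mono[OF ev], simp add: l_def semigroup_one[OF T] prob_space)
    then show "L (const_bcontfun 1) = 1" by (rule tendsto_unique[OF trivial_limit_at_top_linorder L])
  qed blast
  then have "weak_limit (evolve m T) m'"
    using L by (simp add: weak_limit_evolve_iff[OF T m] l_def)
  then show ?thesis ..
qed

lemma weak_limit_evolveI:
  fixes m m' :: "('v::countable) config measure"
  assumes T: "markov_semigroup T" and m: "borel_prob m" and m': "borel_prob m'"
    and conv: "\<And>A. finite A \<Longrightarrow> ((\<lambda>t. \<integral>\<eta>. apply_bcontfun (T t (centred_prod r A)) \<eta> \<partial>m) \<longlongrightarrow>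
        (\<integral>\<eta>. apply_bcontfun (centred_prod r A) \<eta> \<partial>m')) at_top"
  shows "weak_limit (evolve m T) m'"
proof -
  obtain m'' where m'': "weak_limit (evolve m T) m''"
    using weak_limit_evolve_exists[OF T m, of r] conv by blast
  then have lim: "borel_prob m''" "\<And>f. ((\<lambda>t. \<integral>\<eta>. apply_bcontfun (T t f) \<eta> \<partial>m) \<longlongrightarrow> (\<integral>\<eta>. apply_bcontfun f \<eta> \<partial>m'')) at_top"
    by (auto simp: weak_limit_evolve_iff[OF T m])
  have "m'' = m'"
  proof (rule borel_prob_eqI[OF lim(1) m'])
    show "(\<integral>\<eta>. apply_bcontfun f \<eta> \<partial>m'') = (\<integral>\<eta>. apply_bcontfun f \<eta> \<partial>m')" for f :: "'v config \<Rightarrow>\<^sub>C real"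
      using bounded_linear_eq_on_centred_prods[OF bounded_linear_integral_bcontfun(1)[OF lim(1)] bounded_linear_integral_bcontfun(1)[OF m'], of r f]
        tendsto_unique[OF trivial_limit_at_top_linorder lim(2) conv] by blast
  qed
  then show ?thesis using m'' by simp
qed

section \<open>Duality\<close>

text \<open>Unlabelled exclusion particles are described by the set of their positions.\<close>

definition exch_gen :: "('v \<Rightarrow> 'v \<Rightarrow> real) \<Rightarrow> ('v set \<Rightarrow> real) \<Rightarrow> 'v set \<Rightarrow> real" where
  "exch_gen p f A = (\<Sum>x\<in>A. \<Sum>\<^sub>\<infinity>y. p x y * (of_bool (y \<notin> A) * (f (insert y (A - {x})) - f A)))"

text \<open>The Weierstrass test bounds the tails of the series in the supremum norm; norm convergence is what lets
  bounded functionals be applied term by term.\<close>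

lemma bcontfun_has_sum:
  fixes f :: "'i \<Rightarrow> 's::topological_space \<Rightarrow>\<^sub>C real"
  assumes bd: "\<And>i s. i \<in> I \<Longrightarrow> \<bar>apply_bcontfun (f i) s\<bar> \<le> M i" and M: "M summable_on I"
  obtains g where "(f has_sum g) I" and "\<And>s. apply_bcontfun g s = (\<Sum>\<^sub>\<infinity>i\<in>I. apply_bcontfun (f i) s)"
proof -
  have "uniform_limit UNIV (\<lambda>X s. \<Sum>i\<in>X. apply_bcontfun (f i) s) (\<lambda>s. \<Sum>\<^sub>\<infinity>i\<in>I. apply_bcontfun (f i) s) (finite_subsets_at_top I)"
    by (rule Weierstrass_m_test_general[OF _ M]) (use bd in auto)
  moreover have "(\<lambda>X s. \<Sum>i\<in>X. apply_bcontfun (f i) s) = (\<lambda>X. apply_bcontfun (\<Sum>i\<in>X. f i))"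
    by (intro ext) (simp add: bcontfun_sum_apply)
  ultimately have "uniform_limit UNIV (\<lambda>X. apply_bcontfun (\<Sum>i\<in>X. f i)) (\<lambda>s. \<Sum>\<^sub>\<infinity>i\<in>I. apply_bcontfun (f i) s) (finite_subsets_at_top I)"
    by (simp only:)
  then obtain g where g: "(\<lambda>s. \<Sum>\<^sub>\<infinity>i\<in>I. apply_bcontfun (f i) s) = apply_bcontfun g"
      "((\<lambda>X. \<Sum>i\<in>X. f i) \<longlongrightarrow> g) (finite_subsets_at_top I)"
    by (rule uniform_limit_bcontfunE) simp
  show thesis
  proof (rule that)
    show "(f has_sum g) I" using g(2) by (simp add: has_sum_def)
    show "apply_bcontfun g s = (\<Sum>\<^sub>\<infinity>i\<in>I. apply_bcontfun (f i) s)" for s using g(1) by metis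
  qed
qed

context
  fixes p :: "'v \<Rightarrow> 'v \<Rightarrow> real"
  assumes p: "irreducible_symmetric_rates p"
begin

lemma rates_nonneg: "0 \<le> p x y" and rates_sym: "p x y = p y x" and rates_summable: "p x summable_on UNIV"
  using p by (auto simp: irreducible_symmetric_rates_def)

lemma pair_sum:
  assumes "finite A" and g: "\<And>x y. \<bar>g x y\<bar> \<le> b"
  shows "((\<lambda>(x, y). of_bool (x \<in> A) * (p x y * g x y)) has_sum (\<Sum>x\<in>A. \<Sum>\<^sub>\<infinity>y. p x y * g x y)) UNIV"
  using assms(1)
proof (induction A rule: finite_induct)
  case empty
  have "(\<lambda>(x, y). of_bool (x \<in> {}) * (p x y * g x y)) = (\<lambda>_. 0 :: real)" by auto
  then show ?case by simp
next
  case (insert a A)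
  have "((\<lambda>y. p a y * g a y) has_sum (\<Sum>\<^sub>\<infinity>y. p a y * g a y)) UNIV"
    by (rule has_sum_infsum[OF weighted_sum_summable(1)[OF rates_nonneg rates_summable g]])
  then have "((\<lambda>(x, y). of_bool (x = a) * (p x y * g x y)) has_sum (\<Sum>\<^sub>\<infinity>y. p a y * g a y)) (Pair a ` UNIV)"
    by (subst has_sum_reindex) (auto simp: inj_on_def o_def)
  then have 1: "((\<lambda>(x, y). of_bool (x = a) * (p x y * g x y)) has_sum (\<Sum>\<^sub>\<infinity>y. p a y * g a y)) UNIV"
    by (subst has_sum_cong_neutral[where T = "Pair a ` UNIV" and g = "\<lambda>(x, y). of_bool (x = a) * (p x y * g x y)"]) auto
  have eq: "(\<lambda>(x, y). of_bool (x \<in> insert a A) * (p x y * g x y)) =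
      (\<lambda>xy. (case xy of (x, y) \<Rightarrow> of_bool (x = a) * (p x y * g x y)) + (case xy of (x, y) \<Rightarrow> of_bool (x \<in> A) * (p x y * g x y)))"
    using insert.hyps by (auto simp: fun_eq_iff)
  show ?case unfolding eq using has_sum_add[OF 1 insert.IH] insert.hyps by simp
qed

text \<open>A move exchanges the contents of the two sites. If both or none of them lie in \<open>A\<close>, the product is unchanged;
  if exactly one does, the exchange can be carried out in the index set instead.\<close>

lemma centred_prod_move:
  assumes A: "finite A" and xy: "\<eta> x" "\<not> \<eta> y"
  shows "(\<Prod>z\<in>A. occ z (move x y \<eta>) - r) - (\<Prod>z\<in>A. occ z \<eta> - r) =
    of_bool (x \<in> A \<and> y \<notin> A) * ((\<Prod>z\<in>insert y (A - {x}). occ z \<eta> - r) - (\<Prod>z\<in>A. occ z \<eta> - r))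
    + of_bool (y \<in> A \<and> x \<notin> A) * ((\<Prod>z\<in>insert x (A - {y}). occ z \<eta> - r) - (\<Prod>z\<in>A. occ z \<eta> - r))"
proof -
  have ne: "x \<noteq> y" using xy by auto
  define B where "B = A - {x, y}"
  have B: "finite B" "x \<notin> B" "y \<notin> B" using A by (auto simp: B_def)
  have m: "occ z (move x y \<eta>) = (if z = x then 0 else if z = y then 1 else occ z \<eta>)" for z
    using xy ne by (auto simp: occ_def move_def)
  have mB: "(\<Prod>z\<in>B. occ z (move x y \<eta>) - r) = (\<Prod>z\<in>B. occ z \<eta> - r)"
    using B by (intro prod.cong refl) (auto simp: m)
  have o: "occ x \<eta> = 1" "occ y \<eta> = 0" using xy by (auto simp: occ_def)
  consider "x \<in> A" "y \<in> A" "A = insert x (insert y B)" | "x \<in> A" "y \<notin> A" "A = insert x B" "insert y (A - {x}) = insert y B"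
    | "x \<notin> A" "y \<in> A" "A = insert y B" "insert x (A - {y}) = insert x B" | "x \<notin> A" "y \<notin> A" "A = B"
    unfolding B_def by blast
  then show ?thesis
  proof cases
    case 1
    have "(\<Prod>z\<in>A. occ z (move x y \<eta>) - r) = (\<Prod>z\<in>A. occ z \<eta> - r)"
      unfolding 1(3) using B ne by (simp add: mB) (simp add: m o)
    then show ?thesis using 1 by simp
  next
    case 2
    have "(\<Prod>z\<in>A. occ z (move x y \<eta>) - r) = (\<Prod>z\<in>insert y (A - {x}). occ z \<eta> - r)"
      unfolding 2(4) unfolding 2(3) using B ne by (simp add: mB) (simp add: m o)
    then show ?thesis using 2 by simp
  next
    case 3
    have "(\<Prod>z\<in>A. occ z (move x y \<eta>) - r) = (\<Prod>z\<in>insert x (A - {y}). occ z \<eta> - r)"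
      unfolding 3(4) unfolding 3(3) using B ne by (simp add: mB) (simp add: m o)
    then show ?thesis using 3 by simp
  next
    case 4
    then show ?thesis using mB by simp
  qed
qed

text \<open>Exchanging the contents of \<open>x\<close> and \<open>y\<close> in the configuration or in the index set has the same effect on
  the product. A pair with different contents is exchanged by exactly one of the moves \<open>x \<rightarrow> y\<close> and \<open>y \<rightarrow> x\<close>, and
  symmetry of \<open>p\<close> lets both carry the same rate. At the origin the flips have drift
  \<open>lam (1 - \<eta>) - mu \<eta> = - (lam + mu) (\<eta> - r)\<close>.\<close>

lemma source_sink_gen_centred_prod:
  assumes A: "finite A" and r: "0 \<le> r" "r \<le> 1" and lam: "lam = (lam + mu) * r"
  shows "source_sink_gen p orig lam mu (\<lambda>\<eta>. \<Prod>z\<in>A. occ z \<eta> - r) \<eta> =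
     (\<Sum>x\<in>A. \<Sum>\<^sub>\<infinity>y. p x y * (of_bool (y \<notin> A) * ((\<Prod>z\<in>insert y (A - {x}). occ z \<eta> - r) - (\<Prod>z\<in>A. occ z \<eta> - r))))
     - (lam + mu) * of_bool (orig \<in> A) * (\<Prod>z\<in>A. occ z \<eta> - r)"
proof -
  define D where "D B = (\<Prod>z\<in>B. occ z \<eta> - r)" for B
  have D: "\<bar>D B\<bar> \<le> 1" for B unfolding D_def by (rule centred_prod_abs_le[OF r])
  define d where "d x y = of_bool (y \<notin> A) * (D (insert y (A - {x})) - D A)" for x y
  have d: "\<bar>d x y\<bar> \<le> 2" for x y
    using D[of "insert y (A - {x})"] D[of A] by (auto simp: d_def abs_le_iff)
  define u where "u x y = occ x \<eta> * (1 - occ y \<eta>)" for x y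
  have u: "u x y = 0 \<or> u x y = 1" for x y using occ_eq_0_or_1[of x \<eta>] occ_eq_0_or_1[of y \<eta>] by (auto simp: u_def)
  have ud: "\<bar>u x y * d x' y'\<bar> \<le> 2" for x y x' y' using u[of x y] d[of x' y'] by auto
  have sum1: "((\<lambda>(x, y). of_bool (x \<in> A) * (p x y * (u x y * d x y))) has_sum (\<Sum>x\<in>A. \<Sum>\<^sub>\<infinity>y. p x y * (u x y * d x y))) UNIV"
    by (rule pair_sum[OF A ud])
  have "((\<lambda>(x, y). of_bool (x \<in> A) * (p x y * (u y x * d x y))) has_sum (\<Sum>x\<in>A. \<Sum>\<^sub>\<infinity>y. p x y * (u y x * d x y))) UNIV"
    by (rule pair_sum[OF A ud])
  then have sum2: "((\<lambda>xy. case prod.swap xy of (x, y) \<Rightarrow> of_bool (x \<in> A) * (p x y * (u y x * d x y))) has_sum (\<Sum>x\<in>A. \<Sum>\<^sub>\<infinity>y. p x y * (u y x * d x y))) UNIV"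
    by (subst has_sum_reindex_bij_betw[where B = UNIV]) (auto intro: bij_swap)
  have term_eq: "p x y * occ x \<eta> * (1 - occ y \<eta>) * ((\<Prod>z\<in>A. occ z (move x y \<eta>) - r) - (\<Prod>z\<in>A. occ z \<eta> - r))
      = of_bool (x \<in> A) * (p x y * (u x y * d x y)) + of_bool (y \<in> A) * (p y x * (u x y * d y x))" for x y
  proof (cases "\<eta> x \<and> \<not> \<eta> y")
    case True
    then have "u x y = 1" by (simp add: u_def occ_def)
    then show ?thesis
      using centred_prod_move[OF A, of \<eta> x y r] True rates_sym[of x y]
      by (auto simp: d_def D_def occ_def algebra_simps)
  next
    case False
    then have "u x y = 0" by (auto simp: u_def occ_def)
    then show ?thesis using False by (auto simp: occ_def)
  qed
  have sum_eq: "(\<lambda>(x, y). p x y * occ x \<eta> * (1 - occ y \<eta>) * ((\<Prod>z\<in>A. occ z (move x y \<eta>) - r) - (\<Prod>z\<in>A. occ z \<eta> - r)))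
      = (\<lambda>xy. (case xy of (x, y) \<Rightarrow> of_bool (x \<in> A) * (p x y * (u x y * d x y)))
          + (case prod.swap xy of (x, y) \<Rightarrow> of_bool (x \<in> A) * (p x y * (u y x * d x y))))"
    by (rule ext) (simp only: split_paired_all prod.case swap_simp term_eq)
  have "((\<lambda>(x, y). p x y * occ x \<eta> * (1 - occ y \<eta>) * ((\<Prod>z\<in>A. occ z (move x y \<eta>) - r) - (\<Prod>z\<in>A. occ z \<eta> - r))) has_sum
      ((\<Sum>x\<in>A. \<Sum>\<^sub>\<infinity>y. p x y * (u x y * d x y)) + (\<Sum>x\<in>A. \<Sum>\<^sub>\<infinity>y. p x y * (u y x * d x y)))) UNIV"
    unfolding sum_eq by (rule has_sum_add[OF sum1 sum2])
  then have "(\<Sum>\<^sub>\<infinity>(x, y). p x y * occ x \<eta> * (1 - occ y \<eta>) * ((\<Prod>z\<in>A. occ z (move x y \<eta>) - r) - (\<Prod>z\<in>A. occ z \<eta> - r)))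
      = (\<Sum>x\<in>A. \<Sum>\<^sub>\<infinity>y. p x y * (u x y * d x y)) + (\<Sum>x\<in>A. \<Sum>\<^sub>\<infinity>y. p x y * (u y x * d x y))"
    by (rule infsumI)
  also have "\<dots> = (\<Sum>x\<in>A. (\<Sum>\<^sub>\<infinity>y. p x y * (u x y * d x y)) + 1 * (\<Sum>\<^sub>\<infinity>y. p x y * (u y x * d x y)))"
    by (simp add: sum.distrib)
  also have "\<dots> = (\<Sum>x\<in>A. \<Sum>\<^sub>\<infinity>y. p x y * d x y)"
  proof (intro sum.cong refl)
    fix x assume x: "x \<in> A"
    have same: "d x y = 0" if "\<eta> x = \<eta> y" for y
    proof (cases "y \<in> A")
      case False
      have "D A = (occ x \<eta> - r) * D (A - {x})" unfolding D_def by (rule prod.remove[OF A x])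
      moreover have "D (insert y (A - {x})) = (occ y \<eta> - r) * D (A - {x})"
        unfolding D_def using A False by (intro prod.insert) auto
      ultimately show ?thesis using that by (simp add: d_def occ_def)
    qed (simp add: d_def)
    have "u x y * d x y + 1 * (u y x * d x y) = d x y" for y
      using same[of y] by (cases "\<eta> x"; cases "\<eta> y") (auto simp: u_def occ_def)
    then show "(\<Sum>\<^sub>\<infinity>y. p x y * (u x y * d x y)) + 1 * (\<Sum>\<^sub>\<infinity>y. p x y * (u y x * d x y)) = (\<Sum>\<^sub>\<infinity>y. p x y * d x y)"
      using weighted_sum_linear[of "p x" UNIV "\<lambda>y. u x y * d x y" 2 "\<lambda>y. u y x * d x y" 1, OF rates_nonneg rates_summable ud ud] by simp
  qed
  finally have bulk: "(\<Sum>\<^sub>\<infinity>(x, y). p x y * occ x \<eta> * (1 - occ y \<eta>) * ((\<Prod>z\<in>A. occ z (move x y \<eta>) - r) - (\<Prod>z\<in>A. occ z \<eta> - r)))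
      = (\<Sum>x\<in>A. \<Sum>\<^sub>\<infinity>y. p x y * d x y)" .
  have flip: "lam * (1 - occ orig \<eta>) * ((\<Prod>z\<in>A. occ z (flip orig \<eta>) - r) - D A) + mu * occ orig \<eta> * ((\<Prod>z\<in>A. occ z (flip orig \<eta>) - r) - D A)
      = - ((lam + mu) * of_bool (orig \<in> A) * D A)"
  proof (cases "orig \<in> A")
    case False
    then have "(\<Prod>z\<in>A. occ z (flip orig \<eta>) - r) = D A"
      unfolding D_def by (intro prod.cong refl) (auto simp: occ_def flip_def)
    then show ?thesis using False by simp
  next
    case True
    have 1: "D A = (occ orig \<eta> - r) * D (A - {orig})" unfolding D_def by (rule prod.remove[OF A True])
    have 2: "(\<Prod>z\<in>A. occ z (flip orig \<eta>) - r) = (1 - occ orig \<eta> - r) * D (A - {orig})"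
    proof -
      have "(\<Prod>z\<in>A. occ z (flip orig \<eta>) - r) = (occ orig (flip orig \<eta>) - r) * (\<Prod>z\<in>A - {orig}. occ z (flip orig \<eta>) - r)"
        by (rule prod.remove[OF A True])
      moreover have "(\<Prod>z\<in>A - {orig}. occ z (flip orig \<eta>) - r) = D (A - {orig})"
        unfolding D_def by (intro prod.cong refl) (auto simp: occ_def flip_def)
      moreover have "occ orig (flip orig \<eta>) = 1 - occ orig \<eta>" by (simp add: occ_def flip_def)
      ultimately show ?thesis by simp
    qed
    have mu: "mu = (lam + mu) * (1 - r)" using lam by (simp add: right_diff_distrib)
    have "lam * (1 - w) * ((1 - w - r) * E - (w - r) * E) + mu * w * ((1 - w - r) * E - (w - r) * E)
        = - ((lam + mu) * ((w - r) * E))" if w: "w = 0 \<or> w = 1" for w E :: real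
      using w
    proof
      assume "w = 0"
      have "lam * E = (lam + mu) * r * E" using lam by (rule arg_cong)
      then show ?thesis using \<open>w = 0\<close> by (simp add: left_diff_distrib[of 1 r E] mult.assoc)
    next
      assume "w = 1"
      have "mu * E = (lam + mu) * (1 - r) * E" using mu by (rule arg_cong)
      moreover have "- r * E - (1 - r) * E = - E" by (simp add: algebra_simps)
      ultimately show ?thesis using \<open>w = 1\<close> by (simp add: mult.assoc)
    qed
    from this[OF occ_eq_0_or_1[of orig \<eta>]] show ?thesis
      unfolding 1 2 using True by simp
  qed
  show ?thesis
    unfolding source_sink_gen_def source_gen_def bulk
    using flip by (simp add: D_def d_def)
qed

end

lemma card_exchange: "finite A \<Longrightarrow> x \<in> A \<Longrightarrow> y \<notin> A \<Longrightarrow> card (insert y (A - {x})) = card A"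
  by (metis DiffD1 card_Suc_Diff1 card_insert_disjoint finite_Diff)

context
  fixes p :: "'v \<Rightarrow> 'v \<Rightarrow> real"
  assumes p: "irreducible_symmetric_rates p"
begin

lemma exch_gen_linear:
  assumes A: "finite A"
    and f: "\<And>B. finite B \<Longrightarrow> card B = card A \<Longrightarrow> \<bar>f B\<bar> \<le> b" and g: "\<And>B. finite B \<Longrightarrow> card B = card A \<Longrightarrow> \<bar>g B\<bar> \<le> b"
  shows "exch_gen p (\<lambda>B. f B + c * g B) A = exch_gen p f A + c * exch_gen p g A"
proof -
  have cd: "card (insert y (A - {x})) = card A" if "x \<in> A" "y \<notin> A" for x y
    using card_exchange[OF A that] .
  have bd: "\<bar>of_bool (y \<notin> A) * (h (insert y (A - {x})) - h A)\<bar> \<le> 2 * b"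
    if "x \<in> A" and h: "\<And>B. finite B \<Longrightarrow> card B = card A \<Longrightarrow> \<bar>h B\<bar> \<le> b" for h x y
  proof (cases "y \<in> A")
    case False
    then show ?thesis
      using h[of "insert y (A - {x})"] h[of A] cd[OF that(1) False] A by (simp add: abs_le_iff)
  next
    case True
    then show ?thesis using h[of A] A by simp
  qed
  have "exch_gen p (\<lambda>B. f B + c * g B) A = (\<Sum>x\<in>A. \<Sum>\<^sub>\<infinity>y. p x y * (of_bool (y \<notin> A) * (f (insert y (A - {x})) - f A)
      + c * (of_bool (y \<notin> A) * (g (insert y (A - {x})) - g A))))"
    unfolding exch_gen_def by (intro sum.cong infsum_cong refl) (simp add: algebra_simps)
  also have "\<dots> = (\<Sum>x\<in>A. (\<Sum>\<^sub>\<infinity>y. p x y * (of_bool (y \<notin> A) * (f (insert y (A - {x})) - f A)))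
      + c * (\<Sum>\<^sub>\<infinity>y. p x y * (of_bool (y \<notin> A) * (g (insert y (A - {x})) - g A))))"
    by (intro sum.cong refl weighted_sum_linear[OF rates_nonneg[OF p] rates_summable[OF p]]) (rule bd, assumption, rule f g; assumption)+
  also have "\<dots> = exch_gen p f A + c * exch_gen p g A"
    by (simp add: exch_gen_def sum.distrib sum_distrib_left)
  finally show ?thesis .
qed

lemma exch_gen_lower_bound:
  fixes C b M :: real
  assumes A: "finite A" and C: "\<And>x. (\<Sum>\<^sub>\<infinity>y. p x y) \<le> C"
    and f: "\<And>B. finite B \<Longrightarrow> card B = card A \<Longrightarrow> \<bar>f B\<bar> \<le> M" and low: "\<And>B. finite B \<Longrightarrow> card B = card A \<Longrightarrow> - b \<le> f B"
  shows "- (real (card A) * C * b) \<le> exch_gen p f A + real (card A) * C * f A"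
proof -
  have "C * (- b - f A) \<le> (\<Sum>\<^sub>\<infinity>y. p x y * (of_bool (y \<notin> A) * (f (insert y (A - {x})) - f A)))" if x: "x \<in> A" for x
  proof -
    have cd: "card (insert y (A - {x})) = card A" if "y \<notin> A" for y
      using card_exchange[OF A x that] .
    have neg: "- b - f A \<le> 0" using low[of A] A by simp
    have "C * (- b - f A) \<le> (\<Sum>\<^sub>\<infinity>y. p x y) * (- b - f A)"
      using C[of x] neg by (rule mult_right_mono_neg)
    also have "\<dots> = (\<Sum>\<^sub>\<infinity>y. p x y * (- b - f A))"
      by (rule infsum_cmult_left[OF rates_summable[OF p], symmetric])
    also have "\<dots> \<le> (\<Sum>\<^sub>\<infinity>y. p x y * (of_bool (y \<notin> A) * (f (insert y (A - {x})) - f A)))"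
    proof (rule infsum_mono)
      show "(\<lambda>y. p x y * (- b - f A)) summable_on UNIV" by (rule summable_on_cmult_left[OF rates_summable[OF p]])
      show "(\<lambda>y. p x y * (of_bool (y \<notin> A) * (f (insert y (A - {x})) - f A))) summable_on UNIV"
      proof (rule weighted_sum_summable(1)[OF rates_nonneg[OF p] rates_summable[OF p]])
        show "\<bar>of_bool (y \<notin> A) * (f (insert y (A - {x})) - f A)\<bar> \<le> 2 * M" for y
          using f[of "insert y (A - {x})"] f[of A] cd[of y] A by (cases "y \<in> A") (auto simp: abs_le_iff)
      qed
      show "p x y * (- b - f A) \<le> p x y * (of_bool (y \<notin> A) * (f (insert y (A - {x})) - f A))" for y
        using low[of "insert y (A - {x})"] cd[of y] A neg by (intro mult_left_mono rates_nonneg[OF p]) (cases "y \<in> A"; simp)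
    qed
    finally show ?thesis .
  qed
  then have "(\<Sum>x\<in>A. C * (- b - f A)) \<le> exch_gen p f A" unfolding exch_gen_def by (rule sum_mono)
  then show ?thesis by (simp add: algebra_simps)
qed

text \<open>On sums over the occupied sites the exclusion rule is invisible: the suppressed jumps inside \<open>A\<close> cancel
  in pairs.\<close>

lemma exch_gen_sum:
  assumes A: "finite A" and \<phi>: "\<And>x. \<bar>\<phi> x\<bar> \<le> b"
  shows "exch_gen p (\<lambda>B. \<Sum>x\<in>B. \<phi> x) A = (\<Sum>x\<in>A. rw_gen p \<phi> x)"
proof -
  have bd: "\<bar>of_bool Q * (\<phi> y - \<phi> x)\<bar> \<le> 2 * b" for Q x y
    using \<phi>[of x] \<phi>[of y] by (cases Q) (auto simp: abs_le_iff)
  have "rw_gen p \<phi> x = (\<Sum>\<^sub>\<infinity>y. p x y * (of_bool (y \<notin> A) * (\<phi> y - \<phi> x))) + (\<Sum>y\<in>A. p x y * (\<phi> y - \<phi> x))" for x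
  proof -
    have "rw_gen p \<phi> x = (\<Sum>\<^sub>\<infinity>y. p x y * (of_bool (y \<notin> A) * (\<phi> y - \<phi> x) + 1 * (of_bool (y \<in> A) * (\<phi> y - \<phi> x))))"
      unfolding rw_gen_def by (intro infsum_cong) auto
    also have "\<dots> = (\<Sum>\<^sub>\<infinity>y. p x y * (of_bool (y \<notin> A) * (\<phi> y - \<phi> x))) + 1 * (\<Sum>\<^sub>\<infinity>y. p x y * (of_bool (y \<in> A) * (\<phi> y - \<phi> x)))"
      by (rule weighted_sum_linear[OF rates_nonneg[OF p] rates_summable[OF p] bd bd])
    also have "(\<Sum>\<^sub>\<infinity>y. p x y * (of_bool (y \<in> A) * (\<phi> y - \<phi> x))) = (\<Sum>\<^sub>\<infinity>y\<in>A. p x y * (\<phi> y - \<phi> x))"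
      by (rule infsum_cong_neutral) auto
    finally show ?thesis using A by simp
  qed
  moreover have "(\<Sum>x\<in>A. \<Sum>y\<in>A. p x y * (\<phi> y - \<phi> x)) = 0"
  proof -
    have "(\<Sum>x\<in>A. \<Sum>y\<in>A. p x y * (\<phi> y - \<phi> x)) = (\<Sum>y\<in>A. \<Sum>x\<in>A. p x y * (\<phi> y - \<phi> x))" by (rule sum.swap)
    also have "\<dots> = (\<Sum>x\<in>A. \<Sum>y\<in>A. - (p x y * (\<phi> y - \<phi> x)))"
      by (intro sum.cong refl) (simp add: rates_sym[OF p] algebra_simps)
    also have "\<dots> = - (\<Sum>x\<in>A. \<Sum>y\<in>A. p x y * (\<phi> y - \<phi> x))" by (simp add: sum_negf)
    finally show ?thesis by simp
  qed
  ultimately have "(\<Sum>x\<in>A. rw_gen p \<phi> x) = (\<Sum>x\<in>A. \<Sum>\<^sub>\<infinity>y. p x y * (of_bool (y \<notin> A) * (\<phi> y - \<phi> x)))"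
    by (simp add: sum.distrib)
  also have "\<dots> = exch_gen p (\<lambda>B. \<Sum>x\<in>B. \<phi> x) A"
    unfolding exch_gen_def
  proof (intro sum.cong infsum_cong refl)
    fix x y assume x: "x \<in> A"
    show "p x y * (of_bool (y \<notin> A) * (\<phi> y - \<phi> x)) = p x y * (of_bool (y \<notin> A) * ((\<Sum>z\<in>insert y (A - {x}). \<phi> z) - (\<Sum>z\<in>A. \<phi> z)))"
    proof (cases "y \<in> A")
      case False
      have "(\<Sum>z\<in>A. \<phi> z) = \<phi> x + (\<Sum>z\<in>A - {x}. \<phi> z)" by (rule sum.remove[OF A x])
      moreover have "(\<Sum>z\<in>insert y (A - {x}). \<phi> z) = \<phi> y + (\<Sum>z\<in>A - {x}. \<phi> z)" using A False by (intro sum.insert) auto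
      ultimately show ?thesis by simp
    qed simp
  qed
  finally show ?thesis ..
qed

text \<open>A nonnegative source term \<open>src\<close> is allowed, so that the lemma also compares solutions of different equations.
  The number \<open>k\<close> of particles is fixed because the total jump rate grows with it.\<close>

lemma exclusion_comparison:
  assumes der: "\<And>t A. 0 \<le> t \<Longrightarrow> finite A \<Longrightarrow> card A = k \<Longrightarrow> ((\<lambda>t. z t A) has_real_derivative
        exch_gen p (z t) A - \<kappa> * of_bool (a \<in> A) * z t A + src t A) (at t within {0..})"
    and src: "\<And>t A. 0 \<le> t \<Longrightarrow> finite A \<Longrightarrow> card A = k \<Longrightarrow> 0 \<le> src t A" and \<kappa>: "0 \<le> \<kappa>"
    and init: "\<And>A. finite A \<Longrightarrow> card A = k \<Longrightarrow> 0 \<le> z 0 A"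
    and bd: "\<And>t A. 0 \<le> t \<Longrightarrow> finite A \<Longrightarrow> card A = k \<Longrightarrow> \<bar>z t A\<bar> \<le> M"
    and t: "0 \<le> t" and A: "finite A" "card A = k"
  shows "0 \<le> z t A"
proof -
  obtain C where C: "0 \<le> C" "\<And>x. (\<Sum>\<^sub>\<infinity>y. p x y) \<le> C" by (rule rates_bound[OF p]) blast
  show ?thesis
  proof (rule ode_positivity_loss[where z = z and t = t and s = A and S = "{A. finite A \<and> card A = k}" and \<kappa> = "real k * C + \<kappa>" and D = "real k * C + \<kappa>"
      and M = M and G = "\<lambda>t A. exch_gen p (z t) A - \<kappa> * of_bool (a \<in> A) * z t A + src t A"])
    fix t b :: real and A :: "'v set" assume t: "0 \<le> t" and A: "A \<in> {A. finite A \<and> card A = k}" and b: "0 \<le> b"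
      and low: "\<And>B. B \<in> {A. finite A \<and> card A = k} \<Longrightarrow> - b \<le> z t B"
    have "- (real (card A) * C * b) \<le> exch_gen p (z t) A + real (card A) * C * z t A"
      by (rule exch_gen_lower_bound) (use A C(2) bd[OF t] low in auto)
    moreover have "- (\<kappa> * b) \<le> \<kappa> * z t A - \<kappa> * of_bool (a \<in> A) * z t A"
      using \<kappa> b mult_left_mono[OF low[OF A], of \<kappa>] by (cases "a \<in> A") (auto simp: algebra_simps)
    moreover have "0 \<le> src t A" using src[OF t] A by simp
    ultimately show "- ((real k * C + \<kappa>) * b) \<le> exch_gen p (z t) A - \<kappa> * of_bool (a \<in> A) * z t A + src t A + (real k * C + \<kappa>) * z t A"
      using A by (simp add: algebra_simps)
  next
    show "- M \<le> z t A" if "0 \<le> t" "A \<in> {A. finite A \<and> card A = k}" for t :: real and A :: "'v set"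
      using bd[of t A] that by (simp add: abs_le_iff)
  qed (use der init t A C \<kappa> in auto)
qed

lemma exch_gen_singleton: "exch_gen p f {x} = rw_gen p (\<lambda>y. f {y}) x"
  unfolding exch_gen_def rw_gen_def by (simp, intro infsum_cong) auto

text \<open>Two exclusion particles may be labelled: functions of the unordered pair are functions of the ordered pair off the
  diagonal, which the labelled particles do not reach.\<close>

lemma exch_gen_pair:
  assumes "x \<noteq> y"
  shows "exch_gen p f {x, y} = sep2_gen p (\<lambda>z. if z \<in> {(x, y). x \<noteq> y} then f {fst z, snd z} else 0) (x, y)"
proof -
  have "{x, y} - {x} = {y}" "{x, y} - {y} = {x}" using assms by auto
  then have "exch_gen p f {x, y} = (\<Sum>\<^sub>\<infinity>v. p x v * (of_bool (v \<notin> {x, y}) * (f {v, y} - f {x, y})))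
      + (\<Sum>\<^sub>\<infinity>v. p y v * (of_bool (v \<notin> {x, y}) * (f {v, x} - f {x, y})))"
    using assms by (simp add: exch_gen_def)
  also have "\<dots> = sep2_gen p (\<lambda>z. if z \<in> {(x, y). x \<noteq> y} then f {fst z, snd z} else 0) (x, y)"
    unfolding sep2_gen_def prod.case using assms
    by (intro arg_cong2[where f = "(+)"] infsum_cong) (auto simp: insert_commute)
  finally show ?thesis .
qed

lemma sep2_gen_keeps_off_diagonal: "sep2_gen p (indicator (- {(x, y). x \<noteq> y})) z \<le> 0"
proof -
  obtain x y where z: "z = (x, y)" by fastforce
  have nonpos: "infsum f UNIV \<le> 0" if "\<And>v. f v \<le> 0" for f :: "'v \<Rightarrow> real"
    using infsum_nonneg[of UNIV "\<lambda>v. - f v"] that by (simp add: infsum_uminus)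
  have "(\<Sum>\<^sub>\<infinity>v. p x v * of_bool (v \<noteq> y) * (indicator (- {(x, y). x \<noteq> y}) (v, y) - indicator (- {(x, y). x \<noteq> y}) (x, y))) \<le> (0 :: real)"
    by (rule nonpos) (use rates_nonneg[OF p] in \<open>auto simp: indicator_def\<close>)
  moreover have "(\<Sum>\<^sub>\<infinity>v. p y v * of_bool (v \<noteq> x) * (indicator (- {(x, y). x \<noteq> y}) (x, v) - indicator (- {(x, y). x \<noteq> y}) (x, y))) \<le> (0 :: real)"
    by (rule nonpos) (use rates_nonneg[OF p] in \<open>auto simp: indicator_def\<close>)
  ultimately show ?thesis unfolding z sep2_gen_def prod.case by linarith
qed

end

lemma centred_prod_local: "finite A \<Longrightarrow> centred_prod r A \<in> local_functions"
  unfolding local_functions_def by (auto intro!: exI[of _ A] prod.cong simp: occ_def)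

lemma open_prod_discrete: "open (B :: ('v::discrete_topology \<times> 'v) set)"
proof -
  have "B = (\<Union>z\<in>B. {fst z} \<times> {snd z})" by auto
  also have "open \<dots>" by (intro open_UN ballI open_Times discrete_topology_class.open_discrete)
  finally show ?thesis .
qed

section \<open>Exclusion with a reservoir\<close>

text \<open>The source corresponds to \<open>mu = 0\<close> and \<open>r = 1\<close>; with a sink, \<open>r\<close> is the reservoir density.\<close>

locale boundary_exclusion =
  fixes p :: "'v::{countable, discrete_topology} \<Rightarrow> 'v \<Rightarrow> real" and orig :: 'v and lam mu r :: real
    and T :: "real \<Rightarrow> ('v config \<Rightarrow>\<^sub>C real) \<Rightarrow> ('v config \<Rightarrow>\<^sub>C real)"
  assumes p: "irreducible_symmetric_rates p"
    and r: "0 \<le> r" "r \<le> 1" and lam: "0 \<le> lam" and mu: "0 \<le> mu" and balance: "lam = (lam + mu) * r"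
    and T: "markov_semigroup T"
    and gen: "\<And>f g. f \<in> local_functions \<Longrightarrow> apply_bcontfun g = source_sink_gen p orig lam mu (apply_bcontfun f) \<Longrightarrow> (f, g) \<in> generator T"
begin

abbreviation \<kappa> where "\<kappa> \<equiv> lam + mu"

text \<open>The functional \<open>l\<close> is an integral against the initial law, or a difference of evaluations.\<close>

lemma dual_equation:
  fixes l :: "('v config \<Rightarrow>\<^sub>C real) \<Rightarrow> real"
  assumes l: "bounded_linear l" and A: "finite A" and t: "0 \<le> t"
  shows "((\<lambda>t. l (T t (centred_prod r A))) has_real_derivative
      exch_gen p (\<lambda>B. l (T t (centred_prod r B))) A - \<kappa> * of_bool (orig \<in> A) * l (T t (centred_prod r A))) (at t within {0..})"
proof -
  let ?D = "centred_prod r"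
  have Db: "\<bar>apply_bcontfun (?D B) \<eta>\<bar> \<le> 1" for B :: "'v set" and \<eta> by (simp add: centred_prod_abs_le[OF r])
  define Q where "Q x g \<longleftrightarrow> ((\<lambda>y. (p x y * of_bool (y \<notin> A)) *\<^sub>R (?D (insert y (A - {x})) - ?D A)) has_sum g) UNIV \<and>
      (\<forall>\<eta>. apply_bcontfun g \<eta> = (\<Sum>\<^sub>\<infinity>y. p x y * (of_bool (y \<notin> A) * (apply_bcontfun (?D (insert y (A - {x}))) \<eta> - apply_bcontfun (?D A) \<eta>))))" for x g
  have "\<exists>g. Q x g" for x
  proof -
    have "\<bar>apply_bcontfun ((p x y * of_bool (y \<notin> A)) *\<^sub>R (?D (insert y (A - {x})) - ?D A)) \<eta>\<bar> \<le> p x y * 2" for y \<eta>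
    proof -
      have "\<bar>of_bool (y \<notin> A) * (apply_bcontfun (?D (insert y (A - {x}))) \<eta> - apply_bcontfun (?D A) \<eta>)\<bar> \<le> 2"
        using Db[of "insert y (A - {x})" \<eta>] Db[of A \<eta>] by (cases "y \<in> A") (auto simp: abs_le_iff)
      from mult_left_mono[OF this rates_nonneg[OF p, of x y]] show ?thesis
        using rates_nonneg[OF p, of x y] by (simp add: abs_mult mult.assoc)
    qed
    from bcontfun_has_sum[OF this summable_on_cmult_left[OF rates_summable[OF p]]]
    obtain g where "((\<lambda>y. (p x y * of_bool (y \<notin> A)) *\<^sub>R (?D (insert y (A - {x})) - ?D A)) has_sum g) UNIV"
      "\<And>\<eta>. apply_bcontfun g \<eta> = (\<Sum>\<^sub>\<infinity>y. apply_bcontfun ((p x y * of_bool (y \<notin> A)) *\<^sub>R (?D (insert y (A - {x})) - ?D A)) \<eta>)"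
      by blast
    then have "Q x g" unfolding Q_def by (simp add: mult.assoc)
    then show ?thesis ..
  qed
  then obtain gx where "\<And>x. Q x (gx x)" by metis
  then have gx: "\<And>x. ((\<lambda>y. (p x y * of_bool (y \<notin> A)) *\<^sub>R (?D (insert y (A - {x})) - ?D A)) has_sum gx x) UNIV"
    "\<And>x \<eta>. apply_bcontfun (gx x) \<eta> = (\<Sum>\<^sub>\<infinity>y. p x y * (of_bool (y \<notin> A) * (apply_bcontfun (?D (insert y (A - {x}))) \<eta> - apply_bcontfun (?D A) \<eta>)))"
    unfolding Q_def by blast+
  define g where "g = (\<Sum>x\<in>A. gx x) - (\<kappa> * of_bool (orig \<in> A)) *\<^sub>R ?D A"
  have "apply_bcontfun g = source_sink_gen p orig lam mu (apply_bcontfun (?D A))"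
  proof -
    have D: "apply_bcontfun (?D A) = (\<lambda>\<eta>. \<Prod>z\<in>A. occ z \<eta> - r)" by (rule ext) simp
    show ?thesis
      unfolding D by (rule ext) (simp add: g_def bcontfun_sum_apply gx(2) source_sink_gen_centred_prod[OF p A r balance])
  qed
  then have gD: "(?D A, g) \<in> generator T" by (rule gen[OF centred_prod_local[OF A]])
  have lT: "bounded_linear (\<lambda>f. l (T t f))"
    using bounded_linear_compose[OF l semigroup_bounded_linear[OF T t]] .
  have lin: "linear (\<lambda>f. l (T t f))" by (rule bounded_linear.linear[OF lT])
  have "l (T t (gx x)) = (\<Sum>\<^sub>\<infinity>y. p x y * (of_bool (y \<notin> A) * (l (T t (?D (insert y (A - {x})))) - l (T t (?D A)))))" for x
  proof (rule infsumI[symmetric])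
    have "((\<lambda>y. l (T t ((p x y * of_bool (y \<notin> A)) *\<^sub>R (?D (insert y (A - {x})) - ?D A)))) has_sum l (T t (gx x))) UNIV"
      by (rule has_sum_bounded_linear[OF lT gx(1)])
    then show "((\<lambda>y. p x y * (of_bool (y \<notin> A) * (l (T t (?D (insert y (A - {x})))) - l (T t (?D A))))) has_sum l (T t (gx x))) UNIV"
      by (simp add: linear_scale[OF lin] linear_diff[OF lin] mult.assoc)
  qed
  then have "l (T t g) = exch_gen p (\<lambda>B. l (T t (?D B))) A - \<kappa> * of_bool (orig \<in> A) * l (T t (?D A))"
    by (simp add: g_def linear_diff[OF lin] linear_sum[OF lin] linear_scale[OF lin] exch_gen_def)
  then show ?thesis using semigroup_has_derivative[OF T gD l t] by simp
qed

lemma semigroup_centred_prod_abs_le: "0 \<le> t \<Longrightarrow> \<bar>apply_bcontfun (T t (centred_prod r A)) \<eta>\<bar> \<le> 1"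
  by (rule semigroup_abs_le[OF T]) (simp_all add: centred_prod_abs_le[OF r])

lemma integral_semigroup_centred_prod_abs_le:
  assumes m: "borel_prob m" and t: "0 \<le> t"
  shows "\<bar>\<integral>\<eta>. apply_bcontfun (T t (centred_prod r A)) \<eta> \<partial>m\<bar> \<le> 1"
proof -
  interpret prob_space m using m by (simp add: borel_prob_def)
  have "\<bar>\<integral>\<eta>. apply_bcontfun (T t (centred_prod r A)) \<eta> \<partial>m\<bar> \<le> (\<integral>\<eta>. 1 \<partial>m)"
    by (rule order_trans[OF integral_abs_bound], rule Bochner_Integration.integral_mono)
       (auto intro!: integrable_abs bounded_linear_integral_bcontfun(2)[OF m] semigroup_centred_prod_abs_le t)
  then show ?thesis by (simp add: prob_space)
qed

text \<open>Let \<open>v\<^sub>t\<close> be the solution and \<open>s\<close> the sign of \<open>c\<close>. The constant \<open>s c\<close> is a supersolution, so \<open>s v\<^sub>h \<le> s v\<^sub>0\<close> for all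
  \<open>h\<close>; by comparison of the two solutions \<open>v\<^sub>t\<close> and \<open>v\<^sub>t\<^sub>+\<^sub>h\<close> this order persists, and \<open>s v\<^sub>t\<close> decreases in \<open>t\<close>.\<close>

lemma constant_start_converges:
  fixes l :: "('v config \<Rightarrow>\<^sub>C real) \<Rightarrow> real"
  assumes l: "bounded_linear l" and bd: "\<And>t A. 0 \<le> t \<Longrightarrow> \<bar>l (T t (centred_prod r A))\<bar> \<le> M"
    and init: "\<And>A. finite A \<Longrightarrow> card A = k \<Longrightarrow> l (centred_prod r A) = c"
    and A: "finite A" "card A = k"
  shows "\<exists>d. ((\<lambda>t. l (T t (centred_prod r A))) \<longlongrightarrow> d) at_top"
proof -
  \<comment> \<open>The initial value \<open>(\<rho> - r)\<^sup>k\<close> of a product measure is negative if \<open>k\<close> is odd and \<open>\<rho> < r\<close>.\<close>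
  define s where "s = (if 0 \<le> c then 1 else - 1 :: real)"
  have s: "s * s = 1" "\<bar>s\<bar> = 1" "0 \<le> s * c" by (auto simp: s_def)
  define v where "v t B = l (T t (centred_prod r B))" for t :: real and B :: "'v set"
  have v: "\<bar>v t B\<bar> \<le> M" if "0 \<le> t" for t B unfolding v_def by (rule bd[OF that])
  have M: "0 \<le> M" using v[OF order_refl, of "{}"] by linarith
  have v0: "v 0 B = c" if "finite B" "card B = k" for B
    using init[OF that] by (simp add: v_def semigroup_0[OF T])
  have ode: "((\<lambda>t. v t B) has_real_derivative exch_gen p (v t) B - \<kappa> * of_bool (orig \<in> B) * v t B) (at t within {0..})"
    if "0 \<le> t" "finite B" for t B
    unfolding v_def by (rule dual_equation[OF l that(2,1)])
  have const: "exch_gen p (\<lambda>B. d) B = 0" for d B by (simp add: exch_gen_def)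
  have upper: "0 \<le> s * (c - v t B)" if t: "0 \<le> t" and B: "finite B" "card B = k" for t B
  proof (rule exclusion_comparison[OF p, where z = "\<lambda>t B. s * (c - v t B)" and \<kappa> = \<kappa> and a = orig
        and src = "\<lambda>t B. \<kappa> * of_bool (orig \<in> B) * (s * c)" and M = "\<bar>c\<bar> + M", OF _ _ _ _ _ t B])
    fix t :: real and B :: "'v set" assume t: "0 \<le> t" and B: "finite B" "card B = k"
    have "exch_gen p (\<lambda>B. s * (c - v t B)) B = exch_gen p (\<lambda>B. s * c + (- s) * v t B) B"
      by (simp add: right_diff_distrib)
    also have "\<dots> = exch_gen p (\<lambda>B. s * c) B + (- s) * exch_gen p (v t) B"
      by (rule exch_gen_linear[OF p B(1), where b = "\<bar>c\<bar> + M"]) (use v[OF t] s M in \<open>auto simp: abs_mult intro: add_increasing2 add_increasing\<close>)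
    finally have e: "exch_gen p (\<lambda>B. s * (c - v t B)) B = - (s * exch_gen p (v t) B)" by (simp add: const)
    have "((\<lambda>t. s * (c - v t B)) has_real_derivative s * (0 - (exch_gen p (v t) B - \<kappa> * of_bool (orig \<in> B) * v t B))) (at t within {0..})"
      by (intro DERIV_cmult DERIV_diff DERIV_const ode t B)
    then show "((\<lambda>t. s * (c - v t B)) has_real_derivative
        exch_gen p (\<lambda>B. s * (c - v t B)) B - \<kappa> * of_bool (orig \<in> B) * (s * (c - v t B)) + \<kappa> * of_bool (orig \<in> B) * (s * c)) (at t within {0..})"
      unfolding e by (simp add: algebra_simps)
    show "\<bar>s * (c - v t B)\<bar> \<le> \<bar>c\<bar> + M" using v[OF t, of B] s(2) by (simp add: abs_mult)
    show "0 \<le> \<kappa> * of_bool (orig \<in> B) * (s * c)" using lam mu s(3) by simp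
  qed (use lam mu v0 in auto)
  have mono: "s * v (t + h) B \<le> s * v t B" if t: "0 \<le> t" and h: "0 \<le> h" and B: "finite B" "card B = k" for t h B
  proof -
    have "0 \<le> s * (v t B - v (t + h) B)"
    proof (rule exclusion_comparison[OF p, where z = "\<lambda>t B. s * (v t B - v (t + h) B)" and \<kappa> = \<kappa> and a = orig
        and src = "\<lambda>t B. 0" and M = "2 * M", OF _ _ _ _ _ t B])
      fix t :: real and B :: "'v set" assume t: "0 \<le> t" and B: "finite B" "card B = k"
      have th: "0 \<le> t + h" using t h by simp
      have e1: "exch_gen p (\<lambda>B. s * (v t B - v (t + h) B)) B = s * exch_gen p (v t) B - s * exch_gen p (v (t + h)) B"
      proof -
        have "exch_gen p (\<lambda>B. s * (v t B - v (t + h) B)) B = exch_gen p (\<lambda>B. s * v t B + (- s) * v (t + h) B) B"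
          by (simp add: right_diff_distrib)
        also have "\<dots> = exch_gen p (\<lambda>B. s * v t B) B + (- s) * exch_gen p (v (t + h)) B"
          by (rule exch_gen_linear[OF p B(1), where b = M]) (use v[OF t] v[OF th] s(2) in \<open>auto simp: abs_mult\<close>)
        also have "exch_gen p (\<lambda>B. s * v t B) B = exch_gen p (\<lambda>B. 0 + s * v t B) B" by simp
        also have "\<dots> = exch_gen p (\<lambda>B. 0) B + s * exch_gen p (v t) B"
          by (rule exch_gen_linear[OF p B(1), where b = M]) (use v[OF t] M in auto)
        finally show ?thesis by (simp add: const)
      qed
      have "((\<lambda>t. v t B) has_real_derivative exch_gen p (v (t + h)) B - \<kappa> * of_bool (orig \<in> B) * v (t + h) B) (at (t + h) within (\<lambda>t. t + h) ` {0..})"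
        by (rule DERIV_subset[OF ode[OF th B(1)]]) (use h in auto)
      moreover have "((\<lambda>t. t + h) has_real_derivative 1 + 0) (at t within {0..})"
        by (intro DERIV_add DERIV_const DERIV_ident)
      ultimately have "((\<lambda>t. v t B) \<circ> (\<lambda>t. t + h) has_real_derivative (exch_gen p (v (t + h)) B - \<kappa> * of_bool (orig \<in> B) * v (t + h) B) * (1 + 0)) (at t within {0..})"
        by (rule DERIV_image_chain)
      then have sh: "((\<lambda>t. v (t + h) B) has_real_derivative exch_gen p (v (t + h)) B - \<kappa> * of_bool (orig \<in> B) * v (t + h) B) (at t within {0..})"
        by (simp add: o_def)
      have "((\<lambda>t. s * (v t B - v (t + h) B)) has_real_derivative s * ((exch_gen p (v t) B - \<kappa> * of_bool (orig \<in> B) * v t B)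
          - (exch_gen p (v (t + h)) B - \<kappa> * of_bool (orig \<in> B) * v (t + h) B))) (at t within {0..})"
        by (intro DERIV_cmult DERIV_diff ode t B sh)
      then show "((\<lambda>t. s * (v t B - v (t + h) B)) has_real_derivative
        exch_gen p (\<lambda>B. s * (v t B - v (t + h) B)) B - \<kappa> * of_bool (orig \<in> B) * (s * (v t B - v (t + h) B)) + 0) (at t within {0..})"
        unfolding e1 by (simp add: algebra_simps)
      show "\<bar>s * (v t B - v (t + h) B)\<bar> \<le> 2 * M"
        using v[OF t, of B] v[OF th, of B] s(2) by (simp add: abs_mult)
    next
      fix B :: "'v set" assume B: "finite B" "card B = k"
      show "0 \<le> s * (v 0 B - v (0 + h) B)" using upper[OF h B] by (simp add: v0[OF B])
    qed (use lam mu in auto)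
    then show ?thesis by (simp add: right_diff_distrib)
  qed
  define f where "f t = - (s * v (max 0 t) A)" for t
  have fm: "mono f"
  proof (rule monoI)
    fix x y :: real assume xy: "x \<le> y"
    show "f x \<le> f y"
      using mono[of "max 0 x" "max 0 y - max 0 x" A] A xy by (simp add: f_def)
  qed
  have "convergent (\<lambda>n. f (real n))"
  proof (rule Bseq_mono_convergent)
    show "Bseq (\<lambda>n. f (real n))"
      by (rule BseqI'[where K = M]) (use v s(2) in \<open>simp add: f_def abs_mult\<close>)
    show "\<forall>m n. m \<le> n \<longrightarrow> f (real m) \<le> f (real n)" using fm by (auto simp: mono_def)
  qed
  then obtain d where "(\<lambda>n. f (real n)) \<longlonglongrightarrow> d" by (auto simp: convergent_def)
  then have "(f \<longlongrightarrow> d) at_top" by (rule tendsto_at_topI_sequentially_real[OF fm])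
  then have "((\<lambda>t. - s * f t) \<longlongrightarrow> - s * d) at_top" by (rule tendsto_mult_left)
  moreover have "\<forall>\<^sub>F t in at_top. - s * f t = v t A"
    by (rule eventually_mono[OF eventually_ge_at_top[of 0]]) (simp add: f_def mult.assoc[symmetric] s(1))
  ultimately have "((\<lambda>t. v t A) \<longlongrightarrow> - s * d) at_top" by (rule Lim_transform_eventually)
  then show ?thesis unfolding v_def by blast
qed

end

section \<open>The functionals of the dual walks\<close>

lemma ennreal_of_bool: "ennreal (of_bool b) = of_bool b"
  by (cases b) auto

text \<open>The exponential of the sum of the two occupation times factorises, and the walks are independent.\<close>

lemma irw_functional_eq_mult:
  fixes p :: "'v::{countable, discrete_topology} \<Rightarrow> 'v \<Rightarrow> real" and P :: "'v \<Rightarrow> 'w measure"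
  assumes proc: "process_with_generator UNIV (rw_gen p) T P X" and \<kappa>: "0 \<le> \<kappa>"
  shows "irw_functional P X a \<kappa> x y = rw_functional P X a \<kappa> x * rw_functional P X a \<kappa> y"
proof -
  have T: "markov_semigroup T" and P: "markov_process T P X"
    using proc by (auto simp: process_with_generator_def)
  have disc: "open B" for B :: "'v set" by (rule discrete_topology_class.open_discrete)
  interpret Px: prob_space "P x" by (rule process_prob_space[OF T P])
  interpret Py: prob_space "P y" by (rule process_prob_space[OF T P])
  interpret pair_prob_space "P x" "P y" ..
  define w where "w \<omega> = exp_neg (ennreal \<kappa> * (\<integral>\<^sup>+ s\<in>{0..}. of_bool (X s \<omega> = a) \<partial>lborel))" for \<omega>
  have w_meas [measurable]: "w \<in> borel_measurable (P z)" for z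
    using total_weight_measurable[OF T P disc, of "\<lambda>z. of_bool (z = a)" 1 \<kappa> z] \<kappa>
    by (simp add: w_def[abs_def] ennreal_of_bool)
  have w_le: "\<bar>w \<omega>\<bar> \<le> 1" for \<omega>
    using exp_neg_nonneg exp_neg_le_1 by (simp add: w_def)
  have time_meas: "(\<lambda>s. of_bool (X s \<omega> = a) * indicator {0..} s :: ennreal) \<in> borel_measurable lborel"
    if "\<omega> \<in> space (P z)" for \<omega> z
    using occupation_time_measurable[OF T P disc, of "\<lambda>z. of_bool (z = a)" 1 \<kappa>, OF _ _ \<kappa> that] by (simp add: ennreal_of_bool)
  have "irw_functional P X a \<kappa> x y = (\<integral>\<omega>. w (fst \<omega>) * w (snd \<omega>) \<partial>(P x \<Otimes>\<^sub>M P y))"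
    unfolding irw_functional_def
  proof (rule Bochner_Integration.integral_cong[OF refl])
    fix \<omega> assume "\<omega> \<in> space (P x \<Otimes>\<^sub>M P y)"
    then have sp: "fst \<omega> \<in> space (P x)" "snd \<omega> \<in> space (P y)" by (auto simp: space_pair_measure)
    have "(\<integral>\<^sup>+ s\<in>{0..}. (of_bool (X s (fst \<omega>) = a) + of_bool (X s (snd \<omega>) = a)) \<partial>lborel)
        = (\<integral>\<^sup>+ s\<in>{0..}. of_bool (X s (fst \<omega>) = a) \<partial>lborel) + (\<integral>\<^sup>+ s\<in>{0..}. of_bool (X s (snd \<omega>) = a) \<partial>lborel)"
      unfolding distrib_right by (rule nn_integral_add[OF time_meas[OF sp(1)] time_meas[OF sp(2)]])
    then show "(case \<omega> of (\<omega>, \<omega>') \<Rightarrow> exp_neg (ennreal \<kappa> * (\<integral>\<^sup>+ s\<in>{0..}. (of_bool (X s \<omega> = a) + of_bool (X s \<omega>' = a)) \<partial>lborel)))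
        = w (fst \<omega>) * w (snd \<omega>)"
      by (simp add: case_prod_beta w_def exp_neg_add[symmetric] distrib_left)
  qed
  also have "\<dots> = (\<integral>\<omega>. (\<integral>\<omega>'. w \<omega> * w \<omega>' \<partial>P y) \<partial>P x)"
  proof -
    have "integrable (P x \<Otimes>\<^sub>M P y) (\<lambda>\<omega>. w (fst \<omega>) * w (snd \<omega>))"
    proof (rule integrable_const_bound[where B = 1])
      have "\<bar>w (fst \<omega>)\<bar> * \<bar>w (snd \<omega>)\<bar> \<le> 1 * 1" for \<omega> by (intro mult_mono w_le) auto
      then show "AE \<omega> in P x \<Otimes>\<^sub>M P y. norm (w (fst \<omega>) * w (snd \<omega>)) \<le> 1" by (simp add: abs_mult)
    qed measurable
    from integral_fst'[OF this] show ?thesis by simp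
  qed
  also have "\<dots> = (\<integral>\<omega>. w \<omega> \<partial>P x) * (\<integral>\<omega>. w \<omega> \<partial>P y)" by simp
  finally show ?thesis by (simp add: rw_functional_def w_def)
qed

section \<open>Product measures\<close>

lemma borel_prob_bernoulli: "borel_prob (bernoulli_measure \<rho> :: ('v::countable) config measure)"
proof -
  interpret product_prob_space "\<lambda>_::'v. measure_pmf (bernoulli_pmf \<rho>)" UNIV ..
  have "prob_space (bernoulli_measure \<rho> :: 'v config measure)" unfolding bernoulli_measure_def by (rule prob_space_axioms)
  then show ?thesis
    unfolding borel_prob_def bernoulli_measure_def by (simp add: sets_PiM_configs)
qed

lemma borel_prob_return: "borel_prob (return borel (\<xi> :: 'v config))"
  by (simp add: borel_prob_def prob_space_return)

lemma integral_return_bcontfun: "(\<integral>\<eta>. apply_bcontfun f \<eta> \<partial>return borel \<xi>) = apply_bcontfun f \<xi>"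
  for f :: "'s::topological_space \<Rightarrow>\<^sub>C real"
  by (rule integral_return) (auto intro: borel_measurable_continuous_onI)

lemma integral_bernoulli_centred_prod:
  fixes A :: "'v::countable set"
  assumes \<rho>: "0 \<le> \<rho>" "\<rho> \<le> 1" and A: "finite A"
  shows "(\<integral>\<eta>. apply_bcontfun (centred_prod r A) \<eta> \<partial>bernoulli_measure \<rho>) = (\<rho> - r) ^ card A"
proof -
  let ?M = "\<lambda>_::'v. measure_pmf (bernoulli_pmf \<rho>)"
  let ?f = "\<lambda>b::bool. of_bool b - r"
  interpret product_prob_space ?M UNIV ..
  have "(\<integral>\<eta>. apply_bcontfun (centred_prod r A) \<eta> \<partial>bernoulli_measure \<rho>) = (\<integral>\<eta>. (\<Prod>x\<in>A. ?f (restrict \<eta> A x)) \<partial>Pi\<^sub>M UNIV ?M)"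
    unfolding bernoulli_measure_def by (intro Bochner_Integration.integral_cong refl) (simp add: occ_def)
  also have "\<dots> = (\<integral>\<eta>. (\<Prod>x\<in>A. ?f (\<eta> x)) \<partial>distr (Pi\<^sub>M UNIV ?M) (Pi\<^sub>M A ?M) (\<lambda>\<eta>. restrict \<eta> A))"
  proof (rule integral_distr[symmetric])
    show "(\<lambda>\<eta>. restrict \<eta> A) \<in> measurable (Pi\<^sub>M UNIV ?M) (Pi\<^sub>M A ?M)"
      by (rule measurable_restrict_subset) simp
    have "(\<lambda>\<eta>. ?f (\<eta> x)) \<in> borel_measurable (Pi\<^sub>M A ?M)" if "x \<in> A" for x
      by (rule measurable_compose[OF measurable_component_singleton[OF that]]) simp
    then show "(\<lambda>\<eta>. \<Prod>x\<in>A. ?f (\<eta> x)) \<in> borel_measurable (Pi\<^sub>M A ?M)" by (rule borel_measurable_prod)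
  qed
  also have "\<dots> = (\<integral>\<eta>. (\<Prod>x\<in>A. ?f (\<eta> x)) \<partial>Pi\<^sub>M A ?M)"
    by (simp add: distr_PiM_restrict_finite[OF A])
  also have "\<dots> = (\<Prod>x\<in>A. \<integral>b. ?f b \<partial>measure_pmf (bernoulli_pmf \<rho>))"
    by (rule product_integral_prod[OF A]) (rule integrable_measure_pmf_finite, simp)
  also have "\<dots> = (\<Prod>x\<in>A. \<rho> - r)" using \<rho> by (simp add: algebra_simps)
  finally show ?thesis by simp
qed

text \<open>Covariances do not change if constants are subtracted.\<close>

lemma covar_occ:
  fixes m :: "'v config measure"
  assumes m: "borel_prob m" and xy: "x \<noteq> y"
  shows "covar m (occ x) (occ y) = (\<integral>\<eta>. apply_bcontfun (centred_prod r {x, y}) \<eta> \<partial>m)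
     - (\<integral>\<eta>. apply_bcontfun (centred_prod r {x}) \<eta> \<partial>m) * (\<integral>\<eta>. apply_bcontfun (centred_prod r {y}) \<eta> \<partial>m)"
proof -
  interpret prob_space m using m by (simp add: borel_prob_def)
  define d where "d z = (\<integral>\<eta>. apply_bcontfun (centred_prod r {z}) \<eta> \<partial>m)" for z
  note int = bounded_linear_integral_bcontfun(2)[OF m]
  have occ: "occ z \<eta> = apply_bcontfun (centred_prod r {z}) \<eta> + r" for z \<eta> by simp
  have mean: "(\<integral>\<eta>. occ z \<eta> \<partial>m) = d z + r" for z
    unfolding occ d_def using int by (simp del: apply_centred_prod add: prob_space)
  have "covar m (occ x) (occ y) = (\<integral>\<eta>. apply_bcontfun (centred_prod r {x, y}) \<eta> - d y * apply_bcontfun (centred_prod r {x}) \<eta>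
      - d x * apply_bcontfun (centred_prod r {y}) \<eta> + d x * d y \<partial>m)"
    unfolding covar_def mean
    by (intro Bochner_Integration.integral_cong refl) (use xy in \<open>simp add: algebra_simps\<close>)
  also have "\<dots> = (\<integral>\<eta>. apply_bcontfun (centred_prod r {x, y}) \<eta> \<partial>m) - d y * d x - d x * d y + d x * d y"
    unfolding d_def using int by (simp del: apply_centred_prod add: prob_space)
  finally show ?thesis by (simp add: d_def)
qed

section \<open>Limits of densities and correlations\<close>

context boundary_exclusion
begin

lemma killing_rate_nonneg: "0 \<le> \<kappa>" using lam mu by simp

lemma single_particle_equation:
  fixes l :: "('v config \<Rightarrow>\<^sub>C real) \<Rightarrow> real"
  assumes l: "bounded_linear l" and t: "0 \<le> t"
  shows "((\<lambda>t. l (T t (centred_prod r {x}))) has_real_derivative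
      rw_gen p (\<lambda>y. l (T t (centred_prod r {y}))) x - \<kappa> * of_bool (x = orig) * l (T t (centred_prod r {x}))) (at t within {0..})"
proof -
  have "of_bool (orig \<in> {x}) = (of_bool (x = orig) :: real)" by auto
  then show ?thesis
    using dual_equation[OF l, of "{x}" t] t by (simp only: exch_gen_singleton[OF p] finite.emptyI finite_insert)
qed

lemma single_particle:
  fixes l :: "('v config \<Rightarrow>\<^sub>C real) \<Rightarrow> real" and P :: "'v \<Rightarrow> 'w measure"
  assumes proc: "process_with_generator UNIV (rw_gen p) TRW P X"
    and l: "bounded_linear l" and bd: "\<And>t A. 0 \<le> t \<Longrightarrow> \<bar>l (T t (centred_prod r A))\<bar> \<le> M"
    and init: "\<And>x. l (centred_prod r {x}) = c"
  shows "0 < t \<Longrightarrow> l (T t (centred_prod r {x})) = c * (\<integral>\<omega>. exp (- (LBINT s. indicator {0<..t} s * (\<kappa> * of_bool (X s \<omega> = orig)))) \<partial>P x)"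
    and "((\<lambda>t. l (T t (centred_prod r {x}))) \<longlongrightarrow> c * rw_functional P X orig \<kappa> x) at_top"
proof -
  obtain K where K: "bounded_on_functions K (rw_gen p)" by (rule rw_gen_bounded[OF p])
  have disc: "open B" for B :: "'v set" by (rule discrete_topology_class.open_discrete)
  have closed: "rw_gen p (indicator (- UNIV)) x \<le> 0" for x by (simp add: rw_gen_def)
  have ode: "((\<lambda>t. l (T t (centred_prod r {x}))) has_real_derivative
      rw_gen p (\<lambda>y. if y \<in> UNIV then l (T t (centred_prod r {y})) else 0) x - \<kappa> * of_bool (x = orig) * l (T t (centred_prod r {x}))) (at t within {0..})"
    if "0 \<le> t" for t x
    using single_particle_equation[OF l that] by simp
  have init': "l (T 0 (centred_prod r {x})) = c" for x by (simp add: semigroup_0[OF T] init)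
  note fk = feynman_kac_limit[OF disc proc K closed, where w = "\<lambda>x. of_bool (x = orig)" and B = 1 and \<kappa> = \<kappa> and M = M and c = c
      and v = "\<lambda>t x. l (T t (centred_prod r {x}))", OF _ _ killing_rate_nonneg bd ode init' UNIV_I]
  show "0 < t \<Longrightarrow> l (T t (centred_prod r {x})) = c * (\<integral>\<omega>. exp (- (LBINT s. indicator {0<..t} s * (\<kappa> * of_bool (X s \<omega> = orig)))) \<partial>P x)"
    by (rule fk(1)) auto
  show "((\<lambda>t. l (T t (centred_prod r {x}))) \<longlongrightarrow> c * rw_functional P X orig \<kappa> x) at_top"
    unfolding rw_functional_def using fk(2)[of x] by (simp add: ennreal_of_bool)
qed

lemma two_particles:
  fixes l :: "('v config \<Rightarrow>\<^sub>C real) \<Rightarrow> real" and P :: "'v \<times> 'v \<Rightarrow> 'w measure"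
  assumes proc: "process_with_generator UNIV (sep2_gen p) TSEP P Z"
    and l: "bounded_linear l" and bd: "\<And>t A. 0 \<le> t \<Longrightarrow> \<bar>l (T t (centred_prod r A))\<bar> \<le> M"
    and init: "\<And>x y. x \<noteq> y \<Longrightarrow> l (centred_prod r {x, y}) = c"
    and xy: "x \<noteq> y"
  shows "((\<lambda>t. l (T t (centred_prod r {x, y}))) \<longlongrightarrow> c * sep2_functional P Z orig \<kappa> x y) at_top"
proof -
  obtain K where K: "bounded_on_functions K (sep2_gen p)" by (rule sep2_gen_bounded[OF p])
  let ?W = "{(x, y). x \<noteq> y} :: ('v \<times> 'v) set"
  let ?v = "\<lambda>t z. l (T t (centred_prod r {fst z, snd z}))"
  let ?w = "\<lambda>z :: 'v \<times> 'v. of_bool (fst z = orig) + of_bool (snd z = orig) :: real"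
  have "((\<lambda>t. ?v t (x, y)) \<longlongrightarrow> c * (\<integral>\<omega>. exp_neg (ennreal \<kappa> * (\<integral>\<^sup>+ s\<in>{0..}. ennreal (?w (Z s \<omega>)) \<partial>lborel)) \<partial>P (x, y))) at_top"
  proof (rule feynman_kac_limit(2)[OF open_prod_discrete proc K sep2_gen_keeps_off_diagonal[OF p], where B = 2 and M = M and v = ?v and w = ?w])
    fix t :: real and z assume t: "0 \<le> t" and z: "z \<in> ?W"
    obtain a b where ab: "z = (a, b)" "a \<noteq> b" using z by auto
    have "of_bool (orig \<in> {a, b}) = ?w z" using ab by auto
    then show "((\<lambda>t. ?v t z) has_real_derivative sep2_gen p (\<lambda>y. if y \<in> ?W then ?v t y else 0) z - \<kappa> * ?w z * ?v t z) (at t within {0..})"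
      using dual_equation[OF l, of "{a, b}" t] t ab(2) unfolding ab(1) by (simp add: exch_gen_pair[OF p ab(2)])
    show "\<bar>?v t z\<bar> \<le> M" by (rule bd[OF t])
  next
    fix z assume "z \<in> ?W"
    then show "?v 0 z = c" using init by (auto simp: semigroup_0[OF T])
  qed (use killing_rate_nonneg xy in auto)
  moreover have "ennreal (?w z) = of_bool (fst z = orig) + of_bool (snd z = orig)" for z
    by (simp add: ennreal_of_bool)
  ultimately show ?thesis unfolding sep2_functional_def by simp
qed

text \<open>The difference of the densities seen from the full and from the empty configuration solves the killed
  walk equation with initial value one. By comparison, the sum of these differences over \<open>A\<close> dominates
  the absolute value of the integral for every initial law.\<close>

lemma recurrent_dual_vanishes:
  fixes P :: "'v \<Rightarrow> 'w measure"
  assumes proc: "process_with_generator UNIV (rw_gen p) TRW P X" and rec: "recurrent P X" and \<kappa>: "0 < \<kappa>"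
    and m: "borel_prob m" and A: "finite A" "A \<noteq> {}"
  shows "((\<lambda>t. \<integral>\<eta>. apply_bcontfun (T t (centred_prod r A)) \<eta> \<partial>m) \<longlongrightarrow> 0) at_top"
proof -
  define l where "l f = apply_bcontfun f (\<lambda>_. True) - apply_bcontfun f (\<lambda>_. False)" for f :: "'v config \<Rightarrow>\<^sub>C real"
  have l: "bounded_linear l"
    unfolding l_def by (intro bounded_linear_sub bounded_linear_apply_bcontfun)
  define \<phi> where "\<phi> t x = l (T t (centred_prod r {x}))" for t x
  have bd2: "\<bar>l (T t (centred_prod r B))\<bar> \<le> 2" if "0 \<le> t" for t B
    using semigroup_centred_prod_abs_le[OF that, of B "\<lambda>_. True"] semigroup_centred_prod_abs_le[OF that, of B "\<lambda>_. False"]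
    unfolding l_def by linarith
  have \<phi>0: "\<phi> 0 x = 1" for x by (simp add: \<phi>_def l_def semigroup_0[OF T] occ_def)
  have \<phi>1: "\<bar>\<phi> t x\<bar> \<le> 1" if t: "0 \<le> t" for t x
  proof -
    have "- r \<le> apply_bcontfun (T t (centred_prod r {x})) \<xi> \<and> apply_bcontfun (T t (centred_prod r {x})) \<xi> \<le> 1 - r" for \<xi>
    proof -
      have "apply_bcontfun (T t (const_bcontfun (- r))) \<xi> \<le> apply_bcontfun (T t (centred_prod r {x})) \<xi>"
        by (rule semigroup_mono[OF T t]) (simp add: occ_bounds)
      moreover have "apply_bcontfun (T t (centred_prod r {x})) \<xi> \<le> apply_bcontfun (T t (const_bcontfun (1 - r))) \<xi>"
        by (rule semigroup_mono[OF T t]) (simp add: occ_bounds)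
      ultimately show ?thesis by (simp add: semigroup_const[OF T t])
    qed
    from this[of "\<lambda>_. True"] this[of "\<lambda>_. False"] show ?thesis
      unfolding \<phi>_def l_def by linarith
  qed
  have init: "l (centred_prod r {x}) = 1" for x using \<phi>0[of x] by (simp add: \<phi>_def semigroup_0[OF T])
  have ode\<phi>: "((\<lambda>t. \<phi> t x) has_real_derivative rw_gen p (\<phi> t) x - \<kappa> * of_bool (x = orig) * \<phi> t x) (at t within {0..})"
    if "0 \<le> t" for t x
    unfolding \<phi>_def by (rule single_particle_equation[OF l that])
  have \<phi>_nonneg: "0 \<le> \<phi> t x" if t: "0 \<le> t" for t x
  proof (cases "t = 0")
    case False
    then have "\<phi> t x = 1 * (\<integral>\<omega>. exp (- (LBINT s. indicator {0<..t} s * (\<kappa> * of_bool (X s \<omega> = orig)))) \<partial>P x)"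
      unfolding \<phi>_def using t by (intro single_particle(1)[OF proc l bd2 init]) auto
    then show ?thesis by simp
  qed (simp add: \<phi>0)
  have \<phi>_lim: "((\<lambda>t. \<phi> t x) \<longlongrightarrow> 0) at_top" for x
    by (rule recurrent_imp_killed[OF p proc rec \<kappa> \<phi>1 \<phi>0 ode\<phi>])
  define v where "v t B = (\<integral>\<eta>. apply_bcontfun (T t (centred_prod r B)) \<eta> \<partial>m)" for t B
  have v: "\<bar>v t B\<bar> \<le> 1" if "0 \<le> t" for t B
    unfolding v_def by (rule integral_semigroup_centred_prod_abs_le[OF m that])
  have odev: "((\<lambda>t. v t B) has_real_derivative exch_gen p (v t) B - \<kappa> * of_bool (orig \<in> B) * v t B) (at t within {0..})"
    if "0 \<le> t" "finite B" for t B
    unfolding v_def by (rule dual_equation[OF bounded_linear_integral_bcontfun(1)[OF m] that(2,1)])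
  define k where "k = card A"
  have k: "1 \<le> k" using A by (simp add: k_def Suc_le_eq card_gt_0_iff)
  have dom: "0 \<le> (\<Sum>x\<in>B. \<phi> t x) + s * v t B" if s: "\<bar>s\<bar> = 1" and t: "0 \<le> t" and B: "finite B" "card B = k" for s t B
  proof (rule exclusion_comparison[OF p, where z = "\<lambda>t B. (\<Sum>x\<in>B. \<phi> t x) + s * v t B" and \<kappa> = \<kappa> and a = orig
        and src = "\<lambda>t B. \<kappa> * (of_bool (orig \<in> B) * (\<Sum>x\<in>B. \<phi> t x) - (\<Sum>x\<in>B. of_bool (x = orig) * \<phi> t x))" and M = "real k + 1", OF _ _ _ _ _ t B])
    fix t :: real and B :: "'v set" assume t: "0 \<le> t" and B: "finite B" "card B = k"
    have sum\<phi>: "\<bar>\<Sum>x\<in>D. \<phi> t x\<bar> \<le> real k" if "finite D" "card D = k" for D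
    proof -
      have "\<bar>\<Sum>x\<in>D. \<phi> t x\<bar> \<le> (\<Sum>x\<in>D. 1)" by (rule order_trans[OF sum_abs]) (intro sum_mono \<phi>1 t)
      then show ?thesis using that by simp
    qed
    have vk: "\<bar>v t D\<bar> \<le> real k" for D using order_trans[OF v[OF t], of "real k"] k by simp
    have "exch_gen p (\<lambda>B. (\<Sum>x\<in>B. \<phi> t x) + s * v t B) B = exch_gen p (\<lambda>B. \<Sum>x\<in>B. \<phi> t x) B + s * exch_gen p (v t) B"
      by (rule exch_gen_linear[OF p B(1), where b = "real k"]) (use sum\<phi> B vk in auto)
    also have "exch_gen p (\<lambda>B. \<Sum>x\<in>B. \<phi> t x) B = (\<Sum>x\<in>B. rw_gen p (\<phi> t) x)"
      by (rule exch_gen_sum[OF p B(1) \<phi>1[OF t]])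
    finally have e: "exch_gen p (\<lambda>B. (\<Sum>x\<in>B. \<phi> t x) + s * v t B) B = (\<Sum>x\<in>B. rw_gen p (\<phi> t) x) + s * exch_gen p (v t) B" .
    have "((\<lambda>t. (\<Sum>x\<in>B. \<phi> t x) + s * v t B) has_real_derivative
        (\<Sum>x\<in>B. rw_gen p (\<phi> t) x - \<kappa> * of_bool (x = orig) * \<phi> t x) + s * (exch_gen p (v t) B - \<kappa> * of_bool (orig \<in> B) * v t B)) (at t within {0..})"
      by (intro DERIV_add DERIV_sum DERIV_cmult ode\<phi> odev t B)
    then show "((\<lambda>t. (\<Sum>x\<in>B. \<phi> t x) + s * v t B) has_real_derivative
        exch_gen p (\<lambda>B. (\<Sum>x\<in>B. \<phi> t x) + s * v t B) B - \<kappa> * of_bool (orig \<in> B) * ((\<Sum>x\<in>B. \<phi> t x) + s * v t B)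
        + \<kappa> * (of_bool (orig \<in> B) * (\<Sum>x\<in>B. \<phi> t x) - (\<Sum>x\<in>B. of_bool (x = orig) * \<phi> t x))) (at t within {0..})"
      unfolding e by (rule DERIV_cong) (simp add: sum_subtractf sum_distrib_left algebra_simps)
    have "(\<Sum>x\<in>B. of_bool (x = orig) * \<phi> t x) \<le> of_bool (orig \<in> B) * (\<Sum>x\<in>B. \<phi> t x)"
    proof (cases "orig \<in> B")
      case True
      then show ?thesis using \<phi>_nonneg[OF t] by (auto intro!: sum_mono)
    next
      case False
      then have "(\<Sum>x\<in>B. of_bool (x = orig) * \<phi> t x) = 0" by (intro sum.neutral) auto
      then show ?thesis using False by simp
    qed
    then show "0 \<le> \<kappa> * (of_bool (orig \<in> B) * (\<Sum>x\<in>B. \<phi> t x) - (\<Sum>x\<in>B. of_bool (x = orig) * \<phi> t x))"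
      using \<kappa> by simp
    have "\<bar>s * v t B\<bar> \<le> 1" using v[OF t, of B] s by (simp add: abs_mult)
    then show "\<bar>(\<Sum>x\<in>B. \<phi> t x) + s * v t B\<bar> \<le> real k + 1"
      using sum\<phi>[OF B] by linarith
  next
    fix B :: "'v set" assume B: "finite B" "card B = k"
    have "\<bar>s * v 0 B\<bar> \<le> 1" using v[of 0 B] s by (simp add: abs_mult)
    then show "0 \<le> (\<Sum>x\<in>B. \<phi> 0 x) + s * v 0 B" using B k by (simp add: \<phi>0)
  qed (use \<kappa> in auto)
  have "((\<lambda>t. \<Sum>x\<in>A. \<phi> t x) \<longlongrightarrow> (\<Sum>x\<in>A. 0)) at_top" by (intro tendsto_sum \<phi>_lim)
  then have lim: "((\<lambda>t. \<Sum>x\<in>A. \<phi> t x) \<longlongrightarrow> 0) at_top" by simp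
  have "((\<lambda>t. v t A) \<longlongrightarrow> 0) at_top"
  proof (rule Lim_null_comparison[OF _ lim])
    show "\<forall>\<^sub>F t in at_top. norm (v t A) \<le> (\<Sum>x\<in>A. \<phi> t x)"
    proof (rule eventually_mono[OF eventually_ge_at_top[of 0]])
      fix t :: real assume t: "0 \<le> t"
      show "norm (v t A) \<le> (\<Sum>x\<in>A. \<phi> t x)"
        using dom[of 1 t A] dom[of "- 1" t A] A t by (simp add: k_def abs_le_iff)
    qed
  qed
  then show ?thesis by (simp add: v_def)
qed

text \<open>The vanishing of the centred products says that under \<open>m'\<close> the sites are independently occupied with probability
  \<open>r\<close>, so this limit is the product measure of density \<open>r\<close>.\<close>

lemma recurrent_weak_limit:
  fixes P :: "'v \<Rightarrow> 'w measure"
  assumes proc: "process_with_generator UNIV (rw_gen p) TRW P X" and rec: "recurrent P X" and \<kappa>: "0 < \<kappa>"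
    and m: "borel_prob m" and m': "borel_prob m'"
    and zero: "\<And>A. finite A \<Longrightarrow> A \<noteq> {} \<Longrightarrow> (\<integral>\<eta>. apply_bcontfun (centred_prod r A) \<eta> \<partial>m') = 0"
  shows "weak_limit (evolve m T) m'"
proof (rule weak_limit_evolveI[OF T m m'])
  fix A :: "'v set" assume A: "finite A"
  interpret m: prob_space m using m by (simp add: borel_prob_def)
  interpret m': prob_space m' using m' by (simp add: borel_prob_def)
  show "((\<lambda>t. \<integral>\<eta>. apply_bcontfun (T t (centred_prod r A)) \<eta> \<partial>m) \<longlongrightarrow> (\<integral>\<eta>. apply_bcontfun (centred_prod r A) \<eta> \<partial>m')) at_top"
  proof (cases "A = {}")
    case True
    have one: "centred_prod r {} = (const_bcontfun 1 :: 'v config \<Rightarrow>\<^sub>C real)" by (rule bcontfun_eqI) simp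
    have "\<forall>\<^sub>F t in at_top. (\<integral>\<eta>. apply_bcontfun (T t (centred_prod r A)) \<eta> \<partial>m) = 1"
      by (rule eventually_mono[OF eventually_ge_at_top[of 0]]) (simp add: True one semigroup_one[OF T] m.prob_space)
    then show ?thesis unfolding True by (intro tendsto_eventually) (simp add: m'.prob_space)
  next
    case False
    then show ?thesis using recurrent_dual_vanishes[OF proc rec \<kappa> m A False] zero[OF A False] by simp
  qed
qed

lemma expected_occupation:
  fixes PE :: "'v config \<Rightarrow> 'c measure"
  assumes P: "markov_process T PE eta" and t: "0 \<le> t"
  shows "integrable (PE \<xi>) (\<lambda>\<omega>. occ x (eta t \<omega>))"
    and "(\<integral>\<omega>. occ x (eta t \<omega>) \<partial>PE \<xi>) = r + apply_bcontfun (T t (centred_prod r {x})) \<xi>"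
proof -
  interpret E: prob_space "PE \<xi>" by (rule process_prob_space[OF T P])
  have int: "integrable (PE \<xi>) (\<lambda>\<omega>. apply_bcontfun (centred_prod r {x}) (eta t \<omega>))"
    by (rule E.integrable_const_bound[where B = "norm (centred_prod r {x})"])
       (use bcontfun_abs_le_norm[of "centred_prod r {x}"] process_fun_measurable[OF T P t] in \<open>simp_all del: apply_centred_prod\<close>)
  have occ: "occ x \<eta> = r + apply_bcontfun (centred_prod r {x}) \<eta>" for \<eta> by simp
  show "integrable (PE \<xi>) (\<lambda>\<omega>. occ x (eta t \<omega>))"
    unfolding occ using int by (simp del: apply_centred_prod)
  show "(\<integral>\<omega>. occ x (eta t \<omega>) \<partial>PE \<xi>) = r + apply_bcontfun (T t (centred_prod r {x})) \<xi>"
    unfolding occ using int expectation_eq_semigroup[OF T P t, where f = "centred_prod r {x}" and x = \<xi>]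
    by (simp del: apply_centred_prod add: E.prob_space)
qed

lemma expected_vacancy:
  fixes PE :: "'v config \<Rightarrow> 'c measure"
  assumes P: "markov_process T PE eta" and m: "borel_prob m" and t: "0 \<le> t"
  shows "(\<integral>\<xi>. (\<integral>\<omega>. 1 - occ x (eta t \<omega>) \<partial>PE \<xi>) \<partial>m) = 1 - (\<integral>\<xi>. (\<integral>\<omega>. occ x (eta t \<omega>) \<partial>PE \<xi>) \<partial>m)"
proof -
  interpret m: prob_space m using m by (simp add: borel_prob_def)
  have "(\<integral>\<omega>. 1 - occ x (eta t \<omega>) \<partial>PE \<xi>) = 1 - (\<integral>\<omega>. occ x (eta t \<omega>) \<partial>PE \<xi>)" for \<xi>
  proof -
    interpret E: prob_space "PE \<xi>" by (rule process_prob_space[OF T P])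
    show ?thesis using expected_occupation(1)[OF P t] by (simp add: E.prob_space)
  qed
  moreover have "integrable m (\<lambda>\<xi>. \<integral>\<omega>. occ x (eta t \<omega>) \<partial>PE \<xi>)"
    unfolding expected_occupation(2)[OF P t] using bounded_linear_integral_bcontfun(2)[OF m] by simp
  ultimately show ?thesis by (simp add: m.prob_space)
qed

lemma bernoulli_limit:
  fixes P :: "'v \<Rightarrow> 'w measure" and PSEP :: "'v \<times> 'v \<Rightarrow> 'b measure" and PE :: "'v config \<Rightarrow> 'c measure"
  assumes proc: "process_with_generator UNIV (rw_gen p) TRW P X"
    and proc2: "process_with_generator UNIV (sep2_gen p) TSEP PSEP Z"
    and procE: "markov_process T PE eta" and \<rho>: "0 \<le> \<rho>" "\<rho> \<le> 1"
  shows "\<exists>m. weak_limit (evolve (bernoulli_measure \<rho>) T) m \<and>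
      (\<forall>x. ((\<lambda>t. \<integral>\<xi>. (\<integral>\<omega>. occ x (eta t \<omega>) \<partial>PE \<xi>) \<partial>bernoulli_measure \<rho>) \<longlongrightarrow> r + (\<rho> - r) * rw_functional P X orig \<kappa> x) at_top) \<and>
      (\<forall>x y. x \<noteq> y \<longrightarrow> covar m (occ x) (occ y) =
        (\<rho> - r)\<^sup>2 * (sep2_functional PSEP Z orig \<kappa> x y - irw_functional P X orig \<kappa> x y))"
proof -
  let ?\<nu> = "bernoulli_measure \<rho> :: 'v config measure"
  have \<nu>: "borel_prob ?\<nu>" by (rule borel_prob_bernoulli)
  interpret \<nu>: prob_space ?\<nu> using \<nu> by (simp add: borel_prob_def)
  define l where "l f = (\<integral>\<eta>. apply_bcontfun f \<eta> \<partial>?\<nu>)" for f :: "'v config \<Rightarrow>\<^sub>C real"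
  have l: "bounded_linear l" unfolding l_def by (rule bounded_linear_integral_bcontfun(1)[OF \<nu>])
  have bd: "\<bar>l (T t (centred_prod r A))\<bar> \<le> 1" if "0 \<le> t" for t A
    unfolding l_def by (rule integral_semigroup_centred_prod_abs_le[OF \<nu> that])
  have init: "l (centred_prod r A) = (\<rho> - r) ^ card A" if "finite A" for A
    unfolding l_def by (rule integral_bernoulli_centred_prod[OF \<rho> that])
  have "\<exists>c. ((\<lambda>t. l (T t (centred_prod r A))) \<longlongrightarrow> c) at_top" if "finite A" for A
    by (rule constant_start_converges[OF l bd _ that refl]) (use init in auto)
  then obtain m where m: "weak_limit (evolve ?\<nu> T) m"
    using weak_limit_evolve_exists[OF T \<nu>] unfolding l_def by blast
  then have bm: "borel_prob m" and lim: "\<And>f. ((\<lambda>t. l (T t f)) \<longlongrightarrow> (\<integral>\<eta>. apply_bcontfun f \<eta> \<partial>m)) at_top"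
    by (auto simp: weak_limit_evolve_iff[OF T \<nu>] l_def)
  have one: "((\<lambda>t. l (T t (centred_prod r {x}))) \<longlongrightarrow> (\<rho> - r) * rw_functional P X orig \<kappa> x) at_top" for x
    by (rule single_particle(2)[OF proc l bd]) (use init in auto)
  have two: "((\<lambda>t. l (T t (centred_prod r {x, y}))) \<longlongrightarrow> (\<rho> - r)\<^sup>2 * sep2_functional PSEP Z orig \<kappa> x y) at_top" if "x \<noteq> y" for x y
    by (rule two_particles[OF proc2 l bd _ that]) (use init in \<open>auto simp: numeral_2_eq_2\<close>)
  have dens: "(\<integral>\<xi>. (\<integral>\<omega>. occ x (eta t \<omega>) \<partial>PE \<xi>) \<partial>?\<nu>) = r + l (T t (centred_prod r {x}))" if t: "0 \<le> t" for t x
    unfolding expected_occupation(2)[OF procE t] l_def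
    using bounded_linear_integral_bcontfun(2)[OF \<nu>] by (simp add: \<nu>.prob_space)
  have lim_dens: "((\<lambda>t. \<integral>\<xi>. (\<integral>\<omega>. occ x (eta t \<omega>) \<partial>PE \<xi>) \<partial>?\<nu>) \<longlongrightarrow> r + (\<rho> - r) * rw_functional P X orig \<kappa> x) at_top" for x
    by (rule Lim_transform_eventually[OF tendsto_add[OF tendsto_const one]])
       (use dens in \<open>auto intro!: eventually_mono[OF eventually_ge_at_top[of 0]]\<close>)
  have cov: "covar m (occ x) (occ y) = (\<rho> - r)\<^sup>2 * (sep2_functional PSEP Z orig \<kappa> x y - irw_functional P X orig \<kappa> x y)"
    if xy: "x \<noteq> y" for x y
  proof -
    have "(\<integral>\<eta>. apply_bcontfun (centred_prod r {z}) \<eta> \<partial>m) = (\<rho> - r) * rw_functional P X orig \<kappa> z" for z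
      by (rule tendsto_unique[OF trivial_limit_at_top_linorder lim one])
    moreover have "(\<integral>\<eta>. apply_bcontfun (centred_prod r {x, y}) \<eta> \<partial>m) = (\<rho> - r)\<^sup>2 * sep2_functional PSEP Z orig \<kappa> x y"
      by (rule tendsto_unique[OF trivial_limit_at_top_linorder lim two[OF xy]])
    ultimately show ?thesis
      unfolding covar_occ[OF bm xy, of r] irw_functional_eq_mult[OF proc killing_rate_nonneg]
      by (simp only:) (simp add: algebra_simps power2_eq_square)
  qed
  show ?thesis using m lim_dens cov by blast
qed

end

lemma boundary_exclusionI:
  assumes "irreducible_symmetric_rates p" "0 \<le> r" "r \<le> 1" "0 \<le> lam" "0 \<le> mu" "lam = (lam + mu) * r"
    and proc: "process_with_generator local_functions (source_sink_gen p orig lam mu) T P X"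
  shows "boundary_exclusion p orig lam mu r T"
proof
  show "markov_semigroup T" using proc by (simp add: process_with_generator_def)
  show "(f, g) \<in> generator T" if "f \<in> local_functions" "apply_bcontfun g = source_sink_gen p orig lam mu (apply_bcontfun f)" for f g
    by (rule closed_generator_mem[OF proc that])
qed (use assms in auto)

text \<open>If \<open>T\<^sub>t f(\<xi>)\<close> converges for every \<open>f\<close>, then \<open>T\<^sub>t T\<^sub>s f(\<xi>) = T\<^sub>t\<^sub>+\<^sub>s f(\<xi>)\<close> has the same limit for \<open>T\<^sub>s f\<close> as for \<open>f\<close>.\<close>

lemma weak_limit_imp_invariant:
  fixes m :: "('v::countable) config measure"
  assumes T: "markov_semigroup T" and lim: "weak_limit (evolve (return borel \<xi>) T) m"
  shows "invariant_prob T m"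
proof -
  have bm: "borel_prob m" and L: "\<And>f. ((\<lambda>t. apply_bcontfun (T t f) \<xi>) \<longlongrightarrow> (\<integral>\<eta>. apply_bcontfun f \<eta> \<partial>m)) at_top"
    using lim by (auto simp: weak_limit_evolve_iff[OF T borel_prob_return] integral_return_bcontfun)
  have "evolve m T s = m" if s: "0 \<le> s" for s
  proof (rule borel_prob_eqI[OF evolve_integral(1)[OF T bm s] bm])
    fix f
    have "((\<lambda>t. apply_bcontfun (T (t + s) f) \<xi>) \<longlongrightarrow> (\<integral>\<eta>. apply_bcontfun f \<eta> \<partial>m)) at_top"
      by (rule filterlim_compose[OF L]) (rule filterlim_at_top_mono[OF filterlim_ident], use s in simp)
    moreover have "\<forall>\<^sub>F t in at_top. apply_bcontfun (T (t + s) f) \<xi> = apply_bcontfun (T t (T s f)) \<xi>"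
      by (rule eventually_mono[OF eventually_ge_at_top[of 0]]) (simp add: semigroup_add[OF T _ s])
    ultimately have "((\<lambda>t. apply_bcontfun (T t (T s f)) \<xi>) \<longlongrightarrow> (\<integral>\<eta>. apply_bcontfun f \<eta> \<partial>m)) at_top"
      by (rule Lim_transform_eventually)
    then have "(\<integral>\<eta>. apply_bcontfun (T s f) \<eta> \<partial>m) = (\<integral>\<eta>. apply_bcontfun f \<eta> \<partial>m)"
      by (rule tendsto_unique[OF trivial_limit_at_top_linorder L])
    then show "(\<integral>\<eta>. apply_bcontfun f \<eta> \<partial>evolve m T s) = (\<integral>\<eta>. apply_bcontfun f \<eta> \<partial>m)"
      by (simp add: evolve_integral(2)[OF T bm s])
  qed
  then show ?thesis using bm by (simp add: invariant_prob_def)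
qed

lemma invariant_weak_limit_unique:
  fixes m m' :: "('v::countable) config measure"
  assumes T: "markov_semigroup T" and inv: "invariant_prob T m" and lim: "weak_limit (evolve m T) m'"
  shows "m = m'"
proof -
  have bm: "borel_prob m" and ev: "\<And>t. 0 \<le> t \<Longrightarrow> evolve m T t = m" using inv by (auto simp: invariant_prob_def)
  have bm': "borel_prob m'" using lim by (simp add: weak_limit_def)
  show ?thesis
  proof (rule borel_prob_eqI[OF bm bm'])
    fix f :: "'v config \<Rightarrow>\<^sub>C real"
    have "((\<lambda>t. \<integral>\<eta>. apply_bcontfun f \<eta> \<partial>evolve m T t) \<longlongrightarrow> (\<integral>\<eta>. apply_bcontfun f \<eta> \<partial>m)) at_top"
      by (rule tendsto_eventually) (rule eventually_mono[OF eventually_ge_at_top[of 0]], simp add: ev)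
    moreover have "((\<lambda>t. \<integral>\<eta>. apply_bcontfun f \<eta> \<partial>evolve m T t) \<longlongrightarrow> (\<integral>\<eta>. apply_bcontfun f \<eta> \<partial>m')) at_top"
      using lim by (simp add: weak_limit_def)
    ultimately show "(\<integral>\<eta>. apply_bcontfun f \<eta> \<partial>m) = (\<integral>\<eta>. apply_bcontfun f \<eta> \<partial>m')"
      by (rule tendsto_unique[OF trivial_limit_at_top_linorder])
  qed
qed

theorem theorem3p2:
  fixes p :: "'v::{countable, discrete_topology} \<Rightarrow> 'v \<Rightarrow> real"
    and orig :: 'v
    and \<rho> lam :: real
    and TRW :: "real \<Rightarrow> ('v \<Rightarrow>\<^sub>C real) \<Rightarrow> ('v \<Rightarrow>\<^sub>C real)"
    and PRW :: "'v \<Rightarrow> 'a measure" and X :: "real \<Rightarrow> 'a \<Rightarrow> 'v"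
    and TSEP :: "real \<Rightarrow> (('v \<times> 'v) \<Rightarrow>\<^sub>C real) \<Rightarrow> (('v \<times> 'v) \<Rightarrow>\<^sub>C real)"
    and PSEP :: "'v \<times> 'v \<Rightarrow> 'b measure" and Z :: "real \<Rightarrow> 'b \<Rightarrow> 'v \<times> 'v"
  assumes "irreducible_symmetric_rates p"
    and "0 \<le> \<rho>" "\<rho> \<le> 1" "0 \<le> lam"
    and "process_with_generator UNIV (rw_gen p) TRW PRW X"
    and "process_with_generator UNIV (sep2_gen p) TSEP PSEP Z"
  shows
    "(\<forall>(S0 :: real \<Rightarrow> ('v config \<Rightarrow>\<^sub>C real) \<Rightarrow> ('v config \<Rightarrow>\<^sub>C real))
       (P0 :: 'v config \<Rightarrow> 'c measure) (eta :: real \<Rightarrow> 'c \<Rightarrow> 'v config).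
       process_with_generator local_functions (source_gen p orig lam) S0 P0 eta \<longrightarrow>
       (recurrent PRW X \<and> lam > 0 \<longrightarrow>
          weak_limit (evolve (bernoulli_measure \<rho>) S0) (return borel (\<lambda>_. True)) \<and>
          (\<forall>\<xi>. weak_limit (evolve (return borel \<xi>) S0) (return borel (\<lambda>_. True))) \<and>
          (\<forall>m. invariant_prob S0 m \<longleftrightarrow> m = return borel (\<lambda>_. True))) \<and>
       (transient PRW X \<longrightarrow>
          (\<exists>m. weak_limit (evolve (bernoulli_measure \<rho>) S0) m \<and>
             (\<forall>x. ((\<lambda>t. \<integral>\<xi>. (\<integral>\<omega>. 1 - occ x (eta t \<omega>) \<partial>P0 \<xi>) \<partial>bernoulli_measure \<rho>)
                    \<longlongrightarrow> (1 - \<rho>) * rw_functional PRW X orig lam x) at_top) \<and>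
             (\<forall>x y. x \<noteq> y \<longrightarrow>
                covar m (occ x) (occ y) =
                  (1 - \<rho>)\<^sup>2 * (sep2_functional PSEP Z orig lam x y
                               - irw_functional PRW X orig lam x y))))) \<and>
     (\<forall>mu > 0. \<forall>(S1 :: real \<Rightarrow> ('v config \<Rightarrow>\<^sub>C real) \<Rightarrow> ('v config \<Rightarrow>\<^sub>C real))
       (P1 :: 'v config \<Rightarrow> 'd measure) (eta :: real \<Rightarrow> 'd \<Rightarrow> 'v config) \<rho>R.
       process_with_generator local_functions (source_sink_gen p orig lam mu) S1 P1 eta \<and>
       \<rho>R = lam / (lam + mu) \<longrightarrow>
       (recurrent PRW X \<longrightarrow>
          weak_limit (evolve (bernoulli_measure \<rho>) S1) (bernoulli_measure \<rho>R) \<and>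
          (\<forall>\<xi>. weak_limit (evolve (return borel \<xi>) S1) (bernoulli_measure \<rho>R))) \<and>
       (transient PRW X \<longrightarrow>
          (\<exists>m. weak_limit (evolve (bernoulli_measure \<rho>) S1) m \<and>
             (\<forall>x. ((\<lambda>t. \<integral>\<xi>. (\<integral>\<omega>. occ x (eta t \<omega>) \<partial>P1 \<xi>) \<partial>bernoulli_measure \<rho>)
                    \<longlongrightarrow> \<rho>R + (\<rho> - \<rho>R) * rw_functional PRW X orig (lam + mu) x) at_top) \<and>
             (\<forall>x y. x \<noteq> y \<longrightarrow>
                covar m (occ x) (occ y) =
                  (\<rho> - \<rho>R)\<^sup>2 * (sep2_functional PSEP Z orig (lam + mu) x y
                                - irw_functional PRW X orig (lam + mu) x y)))))"
proof (rule conjI, goal_cases)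
  note p = assms(1) and \<rho> = assms(2,3) and lam = assms(4) and rw = assms(5) and sep2 = assms(6)
  case 1
  show ?case
  proof (intro allI impI, goal_cases)
    case (1 S0 P0 eta)
    \<comment> \<open>The source alone is the reservoir of density one with a sink of rate zero.\<close>
    have "source_gen p orig lam = source_sink_gen p orig lam 0"
      by (intro ext) (simp add: source_sink_gen_def)
    with 1 have proc: "process_with_generator local_functions (source_sink_gen p orig lam 0) S0 P0 eta" by simp
    interpret boundary_exclusion p orig lam 0 1 S0
      by (rule boundary_exclusionI[OF p _ _ lam _ _ proc]) auto
    have P0: "markov_process S0 P0 eta" using proc by (simp add: process_with_generator_def)
    have zero: "(\<integral>\<eta>. apply_bcontfun (centred_prod 1 A) \<eta> \<partial>return borel (\<lambda>_. True)) = 0"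
      if "finite A" "A \<noteq> {}" for A :: "'v set"
      unfolding integral_return_bcontfun using that card_gt_0_iff[of A] by (simp add: occ_def)
    have lim: "weak_limit (evolve m S0) (return borel (\<lambda>_. True))"
      if "recurrent PRW X \<and> lam > 0" "borel_prob m" for m
      using that by (intro recurrent_weak_limit[OF rw _ _ _ borel_prob_return zero]) auto
    show ?case
    proof (intro conjI impI, goal_cases)
      case 1
      then show ?case by (rule lim[OF _ borel_prob_bernoulli])
    next
      case 2
      then show ?case by (intro allI lim borel_prob_return)
    next
      case rec: 3
      show ?case
      proof (intro allI iffI)
        fix m assume inv: "invariant_prob S0 m"
        then have "borel_prob m" by (simp add: invariant_prob_def)
        then show "m = return borel (\<lambda>_. True)" by (rule invariant_weak_limit_unique[OF T inv lim[OF rec]])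
      next
        fix m :: "'v config measure" assume "m = return borel (\<lambda>_. True)"
        then show "invariant_prob S0 m" using weak_limit_imp_invariant[OF T lim[OF rec borel_prob_return]] by simp
      qed
    next
      case 4
      obtain m where m: "weak_limit (evolve (bernoulli_measure \<rho>) S0) m"
        and dens: "\<And>x. ((\<lambda>t. \<integral>\<xi>. (\<integral>\<omega>. occ x (eta t \<omega>) \<partial>P0 \<xi>) \<partial>bernoulli_measure \<rho>) \<longlongrightarrow> 1 + (\<rho> - 1) * rw_functional PRW X orig (lam + 0) x) at_top"
        and cov: "\<And>x y. x \<noteq> y \<Longrightarrow> covar m (occ x) (occ y) = (\<rho> - 1)\<^sup>2 * (sep2_functional PSEP Z orig (lam + 0) x y - irw_functional PRW X orig (lam + 0) x y)"
        using bernoulli_limit[OF rw sep2 P0 \<rho>] by blast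
      have "((\<lambda>t. \<integral>\<xi>. (\<integral>\<omega>. 1 - occ x (eta t \<omega>) \<partial>P0 \<xi>) \<partial>bernoulli_measure \<rho>) \<longlongrightarrow> 1 - (1 + (\<rho> - 1) * rw_functional PRW X orig (lam + 0) x)) at_top" for x
        by (rule Lim_transform_eventually[OF tendsto_diff[OF tendsto_const dens]], rule eventually_mono[OF eventually_ge_at_top[of 0]])
           (simp add: expected_vacancy[OF P0 borel_prob_bernoulli])
      moreover have "1 - (1 + (\<rho> - 1) * w) = (1 - \<rho>) * w" for w by (simp add: algebra_simps)
      ultimately show ?case using m cov by (intro exI[of _ m]) (simp add: power2_commute[of 1 \<rho>])
    qed
  qed
next
  note p = assms(1) and \<rho> = assms(2,3) and lam = assms(4) and rw = assms(5) and sep2 = assms(6)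
  case 2
  show ?case
  proof (intro allI impI, elim conjE, goal_cases)
    case (1 mu S1 P1 eta \<rho>R)
    note mu_pos = 1(1) and proc = 1(2) and \<rho>R = 1(3)
    have r: "0 \<le> \<rho>R" "\<rho>R \<le> 1" "lam = (lam + mu) * \<rho>R" using lam mu_pos by (simp_all add: \<rho>R divide_le_eq)
    interpret boundary_exclusion p orig lam mu \<rho>R S1
      by (rule boundary_exclusionI[OF p r(1,2) lam _ r(3) proc]) (use mu_pos in simp)
    have P1: "markov_process S1 P1 eta" using proc by (simp add: process_with_generator_def)
    have zero: "(\<integral>\<eta>. apply_bcontfun (centred_prod \<rho>R A) \<eta> \<partial>bernoulli_measure \<rho>R) = 0"
      if "finite A" "A \<noteq> {}" for A :: "'v set"
    proof -
      have "0 < card A" using card_gt_0_iff[of A] that by blast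
      then show ?thesis unfolding integral_bernoulli_centred_prod[OF r(1,2) that(1)] by simp
    qed
    have lim: "weak_limit (evolve m S1) (bernoulli_measure \<rho>R)" if "recurrent PRW X" "borel_prob m" for m
      using lam mu_pos that by (intro recurrent_weak_limit[OF rw _ _ _ borel_prob_bernoulli zero]) auto
    show ?case
    proof (intro conjI impI, goal_cases)
      case 1
      then show ?case by (rule lim[OF _ borel_prob_bernoulli])
    next
      case 2
      then show ?case by (intro allI lim borel_prob_return)
    next
      case 3
      show ?case by (rule bernoulli_limit[OF rw sep2 P1 \<rho>])
    qed
  qed
qed

end
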